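(* Suppose $0<\alpha\le\beta\le 1$ (with $\alpha<1$). Then $$\mathcal V(p)=V_2(p),$$ where $\mathcal V$ is the value function of the sequential optimal stopping problem and $V_2$ is the value function of the entry problem. The optimal purchase and sale rules for the sequential optimal stopping problem are given by $$\tau^*:=\inf\bigl\{t\ge 0: V_2(P_t)=G_2(P_t)\bigr\},$$ $$\nu^*:=\inf\Bigl\{t\ge\tau^*: P_t\ge \frac{c}{\gamma}\bigl(\lambda P_{\tau^*}+\Psi+R\bigr)\Bigr\}.$$
   Context: Setting. $(\Omega,\mathcal F,\{\mathcal F_t\},\mathbb P)$ is a filtered probability space satisfying the usual conditions and supporting a Brownian motion $B$. The asset price is a geometric Brownian motion $dP_t=P_t(\mu\,dt+\sigma\,dB_t)$, $P_0=p>0$, with $\mu\ge 0$, $\sigma>0$; $\beta:=1-\frac{2\mu}{\sigma^2}\le 1$. $\mathcal T$ is the set of $\{\mathcal F_t\}$-stopping times valued in $[0,+\infty]$. Parameters: $\lambda\ge 1$, $\gamma\in(0,1]$, $\Psi\ge0$, $R>0$, $\alpha\in(0,1)$, $k>1$. The utility function is $U(x)=x^\alpha$ for $x>0$ and $U(x)=-k|x|^\alpha$ for $x\le 0$. Objective and value function of the sequential problem (choose a purchase time $\tau$ and a sale time $\nu$): $$J(p;\tau,\nu):=\mathbb E\Bigl[U\bigl(\gamma P_\nu \mathbf 1_{\{\tau<\infty,\nu<\infty\}}-(\lambda P_\tau+\Psi)\mathbf 1_{\{\tau<\infty\}}-R\bigr)\,\Big|\,P_0=p\Bigr],\qquad \mathcal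 V(p):=\sup_{\tau,\nu\in\mathcal T:\ \tau\le\nu}J(p;\tau,\nu).$$ A pair $(\tau^*,\nu^* )$ is optimal if it attains this supremum. Exit problem: for $H>0$, $V_1(p;H):=\sup_{\nu\in\mathcal T}\mathbb E[U(\gamma P_\nu-H)\mid P_0=p]$. Entry problem: $G_2(p):=\max\{V_1(p;\lambda p+\Psi+R),\,U(-R)\}$ and $V_2(p):=\sup_{\tau\in\mathcal T}\mathbb E[G_2(P_\tau)\mid P_0=p]$. In the exit and entry problems, on the event that the stopping time equals $+\infty$ the price is taken to be $P_\infty:=\lim_{t\to\infty}P_t=0$ (which holds a.s. since $\beta>0$), with $V_1(0;H)=U(-H)$. The convention $\inf\emptyset=+\infty$ is used, and $\nu^*=+\infty$ when $\tau^*=+\infty$. The constant $c>1$ is the solution of $\frac{\alpha}{\beta}c(c-1)^{\alpha-1}-(c-1)^\alpha-k=0$.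
   Formalization: Optimality of (τ*,ν* ) is asserted only if V₂(p)≠U(−R) or V₁(p;λp+Ψ+R)=U(−R); otherwise τ*=0 forces a purchase worse than never buying and the claim fails. Whenever V₂(p)=U(−R), never buying (τ=ν=∞) is shown optimal. *)

theory Defs
  imports "HOL-Probability.Probability"
begin

section \<open>Filtered probability space and asset price\<close>

text \<open>
  The filtration is indexed by \<^typ>\<open>ennreal\<close>, so that \<^const>\<open>stopping_time\<close> is literally the
  notion of a stopping time with values in \<open>[0, \<infinity>]\<close>.  Only \<open>F t\<close> with \<open>t < \<infinity>\<close> matters:
  \<open>F \<infinity>\<close> is an arbitrary \<open>\<sigma>\<close>-algebra containing all of them (the stopping time condition at
  \<open>t = \<infinity>\<close> is vacuous).
\<close>

definition usual_conditions :: "'a measure \<Rightarrow> (ennreal \<Rightarrow> 'a measure) \<Rightarrow> bool" where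
  "usual_conditions M F \<longleftrightarrow>
     prob_space M \<and> complete_measure M \<and>
     filtration (space M) F \<and> (\<forall>t. subalgebra M (F t)) \<and>
     null_sets M \<subseteq> sets (F 0) \<and>
     (\<forall>t<\<infinity>. sets (F t) = (\<Inter>s\<in>{t<..<\<infinity>}. sets (F s)))"

text \<open>Processes \<open>X :: real \<Rightarrow> 'a \<Rightarrow> real\<close> are only considered at times \<open>t \<ge> 0\<close>.\<close>

definition adapted :: "(ennreal \<Rightarrow> 'a measure) \<Rightarrow> (real \<Rightarrow> 'a \<Rightarrow> real) \<Rightarrow> bool" where
  "adapted F X \<longleftrightarrow> (\<forall>t\<ge>0. X t \<in> borel_measurable (F (ennreal t)))"

definition brownian_motion ::
  "'a measure \<Rightarrow> (ennreal \<Rightarrow> 'a measure) \<Rightarrow> (real \<Rightarrow> 'a \<Rightarrow> real) \<Rightarrow> bool" where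
  "brownian_motion M F B \<longleftrightarrow>
     adapted F B \<and>
     (AE \<omega> in M. B 0 \<omega> = 0) \<and>
     (AE \<omega> in M. continuous_on {0..} (\<lambda>t. B t \<omega>)) \<and>
     (\<forall>s t. 0 \<le> s \<longrightarrow> s < t \<longrightarrow>
        distributed M lborel (\<lambda>\<omega>. B t \<omega> - B s \<omega>) (normal_density 0 (sqrt (t - s))) \<and>
        prob_space.indep_set M (sets (F (ennreal s)))
          (sets (vimage_algebra (space M) (\<lambda>\<omega>. B t \<omega> - B s \<omega>) borel)))"

text \<open>
  \<open>I = \<integral>\<^sub>0\<^sup>t X dB\<close> for an adapted integrand \<open>X\<close> with almost surely continuous paths: the Ito
  integral of such an integrand is the limit in probability of its left-point Riemann sums.
\<close>

definition has_ito_integral ::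
  "'a measure \<Rightarrow> (real \<Rightarrow> 'a \<Rightarrow> real) \<Rightarrow> (real \<Rightarrow> 'a \<Rightarrow> real) \<Rightarrow> real \<Rightarrow> ('a \<Rightarrow> real) \<Rightarrow> bool" where
  "has_ito_integral M B X t I \<longleftrightarrow>
     I \<in> borel_measurable M \<and>
     (\<forall>\<epsilon>>0. (\<lambda>n. measure M {\<omega> \<in> space M.
         \<epsilon> < \<bar>(\<Sum>i<n. X (t * real i / real n) \<omega> *
                 (B (t * real (Suc i) / real n) \<omega> - B (t * real i / real n) \<omega>)) - I \<omega>\<bar>})
       \<longlonglongrightarrow> 0)"

text \<open>\<open>dP\<^sub>t = P\<^sub>t (\<mu> dt + \<sigma> dB\<^sub>t)\<close>, \<open>P\<^sub>0 = p\<close>, solved for the stochastic integral.\<close>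

definition geometric_brownian_motion ::
  "'a measure \<Rightarrow> (ennreal \<Rightarrow> 'a measure) \<Rightarrow> (real \<Rightarrow> 'a \<Rightarrow> real) \<Rightarrow> real \<Rightarrow> real \<Rightarrow> real \<Rightarrow>
   (real \<Rightarrow> 'a \<Rightarrow> real) \<Rightarrow> bool" where
  "geometric_brownian_motion M F B \<mu> \<sigma> p P \<longleftrightarrow>
     adapted F P \<and>
     (AE \<omega> in M. continuous_on {0..} (\<lambda>t. P t \<omega>)) \<and>
     (AE \<omega> in M. P 0 \<omega> = p) \<and>
     (\<forall>t\<ge>0. has_ito_integral M B (\<lambda>s \<omega>. \<sigma> * P s \<omega>) t
               (\<lambda>\<omega>. P t \<omega> - p - (LINT s:{0..t}|lborel. \<mu> * P s \<omega>)))"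


section \<open>Optimal stopping problems\<close>

text \<open>
  Expectation with values in \<open>[-\<infinity>, \<infinity>]\<close>, \<open>E[X\<^sup>+] - E[X\<^sup>-]\<close>.  In the setting \<open>0 < \<alpha> \<le> \<beta>\<close>
  of the theorem all positive and negative parts below have finite expectation, so the
  value of \<open>\<infinity> - \<infinity>\<close> plays no role.
\<close>

definition ext_expectation :: "'a measure \<Rightarrow> ('a \<Rightarrow> ereal) \<Rightarrow> ereal" where
  "ext_expectation M X =
     enn2ereal (\<integral>\<^sup>+\<omega>. e2ennreal (X \<omega>) \<partial>M) - enn2ereal (\<integral>\<^sup>+\<omega>. e2ennreal (- X \<omega>) \<partial>M)"

definition utility :: "real \<Rightarrow> real \<Rightarrow> real \<Rightarrow> real" where
  "utility \<alpha> k x = (if x > 0 then x powr \<alpha> else - k * \<bar>x\<bar> powr \<alpha>)"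

text \<open>
  From here on \<open>P p\<close> is the price process started at \<open>p\<close>, and \<open>E[\<sqdot> | P\<^sub>0 = p]\<close> is rendered
  as the expectation with the process \<open>P p\<close> inserted.
\<close>

text \<open>The price at a \<open>[0, \<infinity>]\<close>-valued time, with \<open>P\<^sub>\<infinity> = 0\<close>.\<close>

definition price_at :: "(real \<Rightarrow> real \<Rightarrow> 'a \<Rightarrow> real) \<Rightarrow> real \<Rightarrow> ('a \<Rightarrow> ennreal) \<Rightarrow> 'a \<Rightarrow> real" where
  "price_at P p \<tau> \<omega> = (if \<tau> \<omega> = \<infinity> then 0 else P p (enn2real (\<tau> \<omega>)) \<omega>)"

definition J :: "'a measure \<Rightarrow> (real \<Rightarrow> real \<Rightarrow> 'a \<Rightarrow> real) \<Rightarrow> (real \<Rightarrow> real) \<Rightarrow>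
    real \<Rightarrow> real \<Rightarrow> real \<Rightarrow> real \<Rightarrow> real \<Rightarrow> ('a \<Rightarrow> ennreal) \<Rightarrow> ('a \<Rightarrow> ennreal) \<Rightarrow> ereal" where
  "J M P U \<gamma> l \<Psi> R p \<tau> \<nu> = ext_expectation M (\<lambda>\<omega>. ereal (U (
       \<gamma> * price_at P p \<nu> \<omega> * of_bool (\<tau> \<omega> < \<infinity> \<and> \<nu> \<omega> < \<infinity>)
       - (l * price_at P p \<tau> \<omega> + \<Psi>) * of_bool (\<tau> \<omega> < \<infinity>) - R)))"

definition admissible_pairs ::
  "'a measure \<Rightarrow> (ennreal \<Rightarrow> 'a measure) \<Rightarrow> (('a \<Rightarrow> ennreal) \<times> ('a \<Rightarrow> ennreal)) set" where
  "admissible_pairs M F =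
     {(\<tau>, \<nu>). stopping_time F \<tau> \<and> stopping_time F \<nu> \<and> (\<forall>\<omega>\<in>space M. \<tau> \<omega> \<le> \<nu> \<omega>)}"

definition sequential_value ::
  "'a measure \<Rightarrow> (ennreal \<Rightarrow> 'a measure) \<Rightarrow> (real \<Rightarrow> real \<Rightarrow> 'a \<Rightarrow> real) \<Rightarrow> (real \<Rightarrow> real) \<Rightarrow>
   real \<Rightarrow> real \<Rightarrow> real \<Rightarrow> real \<Rightarrow> real \<Rightarrow> ereal" where
  "sequential_value M F P U \<gamma> l \<Psi> R p =
     (SUP (\<tau>, \<nu>) \<in> admissible_pairs M F. J M P U \<gamma> l \<Psi> R p \<tau> \<nu>)"

definition optimal_pair ::
  "'a measure \<Rightarrow> (ennreal \<Rightarrow> 'a measure) \<Rightarrow> (real \<Rightarrow> real \<Rightarrow> 'a \<Rightarrow> real) \<Rightarrow> (real \<Rightarrow> real) \<Rightarrow>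
   real \<Rightarrow> real \<Rightarrow> real \<Rightarrow> real \<Rightarrow> real \<Rightarrow> ('a \<Rightarrow> ennreal) \<Rightarrow> ('a \<Rightarrow> ennreal) \<Rightarrow> bool" where
  "optimal_pair M F P U \<gamma> l \<Psi> R p \<tau> \<nu> \<longleftrightarrow>
     (\<tau>, \<nu>) \<in> admissible_pairs M F \<and>
     J M P U \<gamma> l \<Psi> R p \<tau> \<nu> = sequential_value M F P U \<gamma> l \<Psi> R p"

definition V1 ::
  "'a measure \<Rightarrow> (ennreal \<Rightarrow> 'a measure) \<Rightarrow> (real \<Rightarrow> real \<Rightarrow> 'a \<Rightarrow> real) \<Rightarrow> (real \<Rightarrow> real) \<Rightarrow>
   real \<Rightarrow> real \<Rightarrow> real \<Rightarrow> ereal" where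
  "V1 M F P U \<gamma> p H =
     (if p = 0 then ereal (U (- H))
      else (SUP \<nu> \<in> {\<nu>. stopping_time F \<nu>}.
              ext_expectation M (\<lambda>\<omega>. ereal (U (\<gamma> * price_at P p \<nu> \<omega> - H)))))"

definition G2 ::
  "'a measure \<Rightarrow> (ennreal \<Rightarrow> 'a measure) \<Rightarrow> (real \<Rightarrow> real \<Rightarrow> 'a \<Rightarrow> real) \<Rightarrow> (real \<Rightarrow> real) \<Rightarrow>
   real \<Rightarrow> real \<Rightarrow> real \<Rightarrow> real \<Rightarrow> real \<Rightarrow> ereal" where
  "G2 M F P U \<gamma> l \<Psi> R p = max (V1 M F P U \<gamma> p (l * p + \<Psi> + R)) (ereal (U (- R)))"

definition V2 ::
  "'a measure \<Rightarrow> (ennreal \<Rightarrow> 'a measure) \<Rightarrow> (real \<Rightarrow> real \<Rightarrow> 'a \<Rightarrow> real) \<Rightarrow> (real \<Rightarrow> real) \<Rightarrow>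
   real \<Rightarrow> real \<Rightarrow> real \<Rightarrow> real \<Rightarrow> real \<Rightarrow> ereal" where
  "V2 M F P U \<gamma> l \<Psi> R p =
     (SUP \<tau> \<in> {\<tau>. stopping_time F \<tau>}.
        ext_expectation M (\<lambda>\<omega>. G2 M F P U \<gamma> l \<Psi> R (price_at P p \<tau> \<omega>)))"


section \<open>Candidate optimal rules\<close>

text \<open>Note that \<open>Inf {} = \<infinity>\<close> in \<^typ>\<open>ennreal\<close>; so \<open>sale_rule\<close> is \<open>\<infinity>\<close> where \<open>\<tau>\<close> is.\<close>

definition purchase_rule ::
  "'a measure \<Rightarrow> (ennreal \<Rightarrow> 'a measure) \<Rightarrow> (real \<Rightarrow> real \<Rightarrow> 'a \<Rightarrow> real) \<Rightarrow> (real \<Rightarrow> real) \<Rightarrow>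
   real \<Rightarrow> real \<Rightarrow> real \<Rightarrow> real \<Rightarrow> real \<Rightarrow> 'a \<Rightarrow> ennreal" where
  "purchase_rule M F P U \<gamma> l \<Psi> R p \<omega> =
     Inf {ennreal t | t. 0 \<le> t \<and>
            V2 M F P U \<gamma> l \<Psi> R (P p t \<omega>) = G2 M F P U \<gamma> l \<Psi> R (P p t \<omega>)}"

definition sale_rule ::
  "(real \<Rightarrow> real \<Rightarrow> 'a \<Rightarrow> real) \<Rightarrow> real \<Rightarrow> real \<Rightarrow> real \<Rightarrow> real \<Rightarrow> real \<Rightarrow> real \<Rightarrow>
   ('a \<Rightarrow> ennreal) \<Rightarrow> 'a \<Rightarrow> ennreal" where
  "sale_rule P c \<gamma> l \<Psi> R p \<tau> \<omega> =
     Inf {ennreal t | t. 0 \<le> t \<and> \<tau> \<omega> \<le> ennreal t \<and>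
            P p t \<omega> \<ge> c / \<gamma> * (l * price_at P p \<tau> \<omega> + \<Psi> + R)}"

end

theory Submission
  imports Defs "HOL-Real_Asymp.Real_Asymp"
begin

text \<open>
  The price solves a linear stochastic differential equation, so it is almost surely
  \<open>q exp (\<sigma> B\<^sub>t + (\<mu> - \<sigma>\<^sup>2/2) t)\<close>: the difference of two solutions is an integral of itself, and
  the isometry for left-point sums gives a Gronwall bound for its localised second moments.
  Consequently \<open>S = P\<^sup>\<beta>\<close> is a positive martingale that tends to \<open>0\<close>.

  As a function of \<open>s = y\<^sup>\<beta>\<close>, the utility \<open>U (\<gamma> y - H)\<close> lies below the line through its value at
  \<open>y = 0\<close> that is tangent to it at \<open>y = c H / \<gamma>\<close>; the equation for \<open>c\<close> says exactly this. Because
  \<open>\<gamma> \<le> 1 \<le> l\<close>, a purchase always happens below the threshold, so the line bounds the expected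
  utility of every sale by optional stopping, and selling at the threshold attains the bound since
  only the two contact points of the line occur as sale values.

  The entry problem is thereby to stop \<open>S\<close> with reward \<open>g(S)\<close>. An affine majorant of \<open>g\<close> that is
  minimal at the starting point bounds the reward of every stopping time. It touches \<open>g\<close> on both
  sides of the starting point, unless it is constant, and in between it is the lower envelope of
  all affine majorants. Hence \<open>S\<close> first meets the set where \<open>g\<close> equals this envelope at a point of
  the majorant, and the bound is attained there.
\<close>

subsection \<open>Increments of Brownian motion\<close>

text \<open>Stochastic integrals enter only as limits in probability of left-point sums, so Ito's
  formula is replaced by a second-moment estimate showing that the exponential satisfies its own
  Euler scheme; subtracting it from the given price leaves a homogeneous linear equation. Since the
  positive martingale \<open>S\<close> tends to 0, the convention that the price at infinity is 0
  leaves only a supermartingale: its mean at an unbounded stopping time may drop. This is harmless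
  for upper bounds, as all slopes are nonnegative. For equality no mass may escape, and both rules
  ensure this by staying under an integrable bound, namely the sale threshold or the right contact
  point, unless the slope is 0. A second obstacle is \<open>\<alpha> = \<beta>\<close>, where the
  reward may grow linearly and the right contact could lie at infinity; an asymptote that the reward
  never reaches excludes this. Finally, where the entry value equals \<open>U (- R)\<close> the
  purchase rule stops at once although buying may be worse than staying out, so optimality there is
  a case of its own.\<close>

lemma normal_density_times_exp:
  assumes "s > 0"
  shows "normal_density 0 s x * exp (a * x) = exp (a\<^sup>2 * s\<^sup>2 / 2) * normal_density (a * s\<^sup>2) s x"
proof -
  have "- (x\<^sup>2 / (2 * s\<^sup>2)) + a * x = a\<^sup>2 * s\<^sup>2 / 2 - (x - a * s\<^sup>2)\<^sup>2 / (2 * s\<^sup>2)"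
    using assms by (simp add: field_simps power2_eq_square)
  then show ?thesis
    using assms by (simp add: normal_density_def exp_add[symmetric] mult.assoc)
qed

lemma square_integrable_mult:
  fixes f g :: "'a \<Rightarrow> real"
  assumes [measurable]: "f \<in> borel_measurable M" "g \<in> borel_measurable M"
    and "integrable M (\<lambda>x. (f x)\<^sup>2)" "integrable M (\<lambda>x. (g x)\<^sup>2)"
  shows "integrable M (\<lambda>x. f x * g x)"
proof (rule Bochner_Integration.integrable_bound)
  show "integrable M (\<lambda>x. (f x)\<^sup>2 + (g x)\<^sup>2)"
    using assms by auto
  show "AE x in M. norm (f x * g x) \<le> norm ((f x)\<^sup>2 + (g x)\<^sup>2)"
  proof (rule AE_I2)
    fix x
    have "0 \<le> (\<bar>f x\<bar> - \<bar>g x\<bar>)\<^sup>2" by simp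
    then have "2 * (\<bar>f x\<bar> * \<bar>g x\<bar>) \<le> (f x)\<^sup>2 + (g x)\<^sup>2"
      by (simp add: power2_diff)
    moreover have "0 \<le> \<bar>f x\<bar> * \<bar>g x\<bar>" by simp
    ultimately have "\<bar>f x\<bar> * \<bar>g x\<bar> \<le> (f x)\<^sup>2 + (g x)\<^sup>2" by linarith
    then show "norm (f x * g x) \<le> norm ((f x)\<^sup>2 + (g x)\<^sup>2)"
      by (simp add: abs_mult)
  qed
qed measurable

lemma square_integrable_add:
  fixes f g :: "'a \<Rightarrow> real"
  assumes "f \<in> borel_measurable M" "g \<in> borel_measurable M"
    and "integrable M (\<lambda>x. (f x)\<^sup>2)" "integrable M (\<lambda>x. (g x)\<^sup>2)"
  shows "integrable M (\<lambda>x. (f x + g x)\<^sup>2)"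
  using square_integrable_mult[OF assms] assms(3,4) by (simp add: power2_sum mult.assoc)

text \<open>A regularised Brownian motion: every path is continuous and starts at 0, so that stopped
  values and hitting times can be treated pathwise. Independence is stated as factorisation of
  expectations, the only form in which it is used.\<close>

locale brownian_space =
  fixes M :: "'a measure" and F :: "ennreal \<Rightarrow> 'a measure" and W :: "real \<Rightarrow> 'a \<Rightarrow> real"
  assumes usual: "usual_conditions M F"
    and W_adapted: "adapted F W"
    and W_0 [simp]: "W 0 \<omega> = 0"
    and W_cont: "continuous_on {0..} (\<lambda>t. W t \<omega>)"
    and W_gauss: "0 \<le> s \<Longrightarrow> s < t \<Longrightarrow>
      distributed M lborel (\<lambda>\<omega>. W t \<omega> - W s \<omega>) (\<lambda>x. ennreal (normal_density 0 (sqrt (t - s)) x))"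
    and W_indep: "0 \<le> s \<Longrightarrow> s < t \<Longrightarrow> Z \<in> borel_measurable (F (ennreal s)) \<Longrightarrow>
      f \<in> borel_measurable borel \<Longrightarrow> integrable M Z \<Longrightarrow> integrable M (\<lambda>\<omega>. f (W t \<omega> - W s \<omega>)) \<Longrightarrow>
      integrable M (\<lambda>\<omega>. Z \<omega> * f (W t \<omega> - W s \<omega> :: real) :: real) \<and>
      (\<integral>\<omega>. Z \<omega> * f (W t \<omega> - W s \<omega>) \<partial>M) = (\<integral>\<omega>. Z \<omega> \<partial>M) * (\<integral>\<omega>. f (W t \<omega> - W s \<omega>) \<partial>M)"

sublocale brownian_space \<subseteq> prob_space M
  using usual by (simp add: usual_conditions_def)

context brownian_space
begin

lemma space_F [simp]: "space (F t) = space M"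
  using usual by (simp add: usual_conditions_def subalgebra_def)

lemma sets_F_mono: "s \<le> t \<Longrightarrow> sets (F s) \<subseteq> sets (F t)"
  using usual by (simp add: usual_conditions_def filtration_def)

lemma sets_F: "sets (F t) \<subseteq> sets M"
  using usual by (simp add: usual_conditions_def subalgebra_def)

lemma measurable_F_mono: "f \<in> measurable (F s) N \<Longrightarrow> s \<le> t \<Longrightarrow> f \<in> measurable (F t) N"
  using sets_F_mono[of s t] by (auto simp: measurable_def)

lemma measurable_F_M: "f \<in> measurable (F s) N \<Longrightarrow> f \<in> measurable M N"
  using sets_F[of s] by (auto simp: measurable_def)

lemma W_measurable_F: "0 \<le> s \<Longrightarrow> s \<le> t \<Longrightarrow> W s \<in> borel_measurable (F (ennreal t))"
  using W_adapted measurable_F_mono[of "W s" "ennreal s" borel "ennreal t"]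
  by (simp add: adapted_def ennreal_leI)

lemma W_measurable: "0 \<le> s \<Longrightarrow> W s \<in> borel_measurable M"
  using measurable_F_M[OF W_measurable_F[of s s]] by simp

lemma increment_expectation:
  fixes f :: "real \<Rightarrow> real"
  assumes "0 \<le> s" "s < t" "f \<in> borel_measurable borel"
  shows "integrable M (\<lambda>\<omega>. f (W t \<omega> - W s \<omega>)) \<longleftrightarrow>
           integrable lborel (\<lambda>x. normal_density 0 (sqrt (t - s)) x * f x)"
    and "(\<integral>\<omega>. f (W t \<omega> - W s \<omega>) \<partial>M) = (\<integral>x. normal_density 0 (sqrt (t - s)) x * f x \<partial>lborel)"
  using distributed_integral[OF W_gauss[OF assms(1,2)], of f]
    distributed_integrable[OF W_gauss[OF assms(1,2)], of f] assms by auto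

lemma exp_increment:
  assumes "0 \<le> s" "s < t"
  shows "integrable M (\<lambda>\<omega>. exp (a * (W t \<omega> - W s \<omega>)))"
    and "(\<integral>\<omega>. exp (a * (W t \<omega> - W s \<omega>)) \<partial>M) = exp (a\<^sup>2 * (t - s) / 2)"
proof -
  \<comment> \<open>Completing the square turns the exponential factor into a shift of the Gaussian
    mean, so only the total mass of a density remains to be integrated.\<close>
  have eq: "normal_density 0 (sqrt (t - s)) x * exp (a * x) =
      exp (a\<^sup>2 * (t - s) / 2) * normal_density (a * (t - s)) (sqrt (t - s)) x" for x
    using normal_density_times_exp[of "sqrt (t - s)" x a] assms by simp
  show "integrable M (\<lambda>\<omega>. exp (a * (W t \<omega> - W s \<omega>)))"
    by (subst increment_expectation(1)[OF assms]) (use assms in \<open>simp_all add: eq\<close>)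
  show "(\<integral>\<omega>. exp (a * (W t \<omega> - W s \<omega>)) \<partial>M) = exp (a\<^sup>2 * (t - s) / 2)"
    by (subst increment_expectation(2)[OF assms]) (use assms in \<open>simp_all add: eq\<close>)
qed

text \<open>The cross term between the exact growth factor of the price and its linearisation needs
  this tilted first moment; \<open>a = 0\<close> yields the mean of an increment.\<close>

lemma increment_exp_moment:
  assumes "0 \<le> s" "s < t"
  shows "integrable M (\<lambda>\<omega>. (W t \<omega> - W s \<omega>) * exp (a * (W t \<omega> - W s \<omega>)))"
    and "(\<integral>\<omega>. (W t \<omega> - W s \<omega>) * exp (a * (W t \<omega> - W s \<omega>)) \<partial>M) = a * (t - s) * exp (a\<^sup>2 * (t - s) / 2)"
proof -
  let ?s = "sqrt (t - s)"
  have eq: "normal_density 0 ?s x * (x * exp (a * x)) =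
      exp (a\<^sup>2 * (t - s) / 2) * (normal_density (a * (t - s)) ?s x * x)" for x
  proof -
    have "normal_density 0 ?s x * (x * exp (a * x)) = (normal_density 0 ?s x * exp (a * x)) * x"
      by (simp only: mult_ac)
    also have "\<dots> = exp (a\<^sup>2 * (t - s) / 2) * (normal_density (a * (t - s)) ?s x * x)"
      using normal_density_times_exp[of ?s x a] assms by simp
    finally show ?thesis .
  qed
  have i: "integrable lborel (\<lambda>x. normal_density (a * (t - s)) ?s x * x)"
    using assms by (intro integrable_normal_moment_nz_1) auto
  show "integrable M (\<lambda>\<omega>. (W t \<omega> - W s \<omega>) * exp (a * (W t \<omega> - W s \<omega>)))"
    by (subst increment_expectation(1)[OF assms, where f = "\<lambda>x. x * exp (a * x)"])
       (use i in \<open>simp_all add: eq\<close>)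
  show "(\<integral>\<omega>. (W t \<omega> - W s \<omega>) * exp (a * (W t \<omega> - W s \<omega>)) \<partial>M) = a * (t - s) * exp (a\<^sup>2 * (t - s) / 2)"
    by (subst increment_expectation(2)[OF assms, where f = "\<lambda>x. x * exp (a * x)"])
       (use integral_normal_moment_nz_1[of ?s "a * (t - s)"] assms in \<open>simp_all add: eq\<close>)
qed

lemma increment_moments:
  assumes "0 \<le> s" "s < t"
  shows "integrable M (\<lambda>\<omega>. W t \<omega> - W s \<omega>)" "(\<integral>\<omega>. W t \<omega> - W s \<omega> \<partial>M) = 0"
    "integrable M (\<lambda>\<omega>. (W t \<omega> - W s \<omega>)\<^sup>2)" "(\<integral>\<omega>. (W t \<omega> - W s \<omega>)\<^sup>2 \<partial>M) = t - s"
proof -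
  show "integrable M (\<lambda>\<omega>. W t \<omega> - W s \<omega>)"
    using increment_exp_moment(1)[OF assms, of 0] by simp
  show "(\<integral>\<omega>. W t \<omega> - W s \<omega> \<partial>M) = 0"
    using increment_exp_moment(2)[OF assms, of 0] by simp
  have i: "integrable lborel (\<lambda>x. normal_density 0 (sqrt (t - s)) x * x\<^sup>2)"
    using integrable_normal_moment[of "sqrt (t - s)" 0 2] assms by simp
  have v: "(\<integral>x. normal_density 0 (sqrt (t - s)) x * x\<^sup>2 \<partial>lborel) = t - s"
    using integral_normal_moment_even[of "sqrt (t - s)" 0 1] assms by (simp add: fact_2)
  show "integrable M (\<lambda>\<omega>. (W t \<omega> - W s \<omega>)\<^sup>2)"
    by (subst increment_expectation(1)[OF assms]) (use i in simp_all)
  show "(\<integral>\<omega>. (W t \<omega> - W s \<omega>)\<^sup>2 \<partial>M) = t - s"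
    by (subst increment_expectation(2)[OF assms]) (use v in simp_all)
qed

text \<open>Discrete Ito isometry: the sum up to \<open>n\<close> times the next coefficient is
  known at time \<open>s n\<close>, hence uncorrelated with the next centred increment, and all
  cross terms vanish. A general function \<open>\<psi>\<close> of the increment is allowed because
  the Euler residual is nonlinear in it.\<close>

lemma sum_increments_orthogonal:
  fixes s :: "nat \<Rightarrow> real" and \<xi> :: "nat \<Rightarrow> 'a \<Rightarrow> real" and \<psi> :: "real \<Rightarrow> real"
  assumes s: "\<And>i. 0 \<le> s i" "\<And>i. s i < s (Suc i)"
    and \<xi>: "\<And>i. \<xi> i \<in> borel_measurable (F (ennreal (s i)))" "\<And>i. integrable M (\<lambda>\<omega>. (\<xi> i \<omega>)\<^sup>2)"
    and \<psi>: "\<psi> \<in> borel_measurable borel"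
      "\<And>i. integrable M (\<lambda>\<omega>. (\<psi> (W (s (Suc i)) \<omega> - W (s i) \<omega>))\<^sup>2)"
      "\<And>i. (\<integral>\<omega>. \<psi> (W (s (Suc i)) \<omega> - W (s i) \<omega>) \<partial>M) = 0"
      "\<And>i. (\<integral>\<omega>. (\<psi> (W (s (Suc i)) \<omega> - W (s i) \<omega>))\<^sup>2 \<partial>M) = v"
  defines "S \<equiv> \<lambda>n \<omega>. \<Sum>i<n. \<xi> i \<omega> * \<psi> (W (s (Suc i)) \<omega> - W (s i) \<omega>)"
  shows "S n \<in> borel_measurable (F (ennreal (s n))) \<and> integrable M (\<lambda>\<omega>. (S n \<omega>)\<^sup>2) \<and>
    (\<integral>\<omega>. (S n \<omega>)\<^sup>2 \<partial>M) = v * (\<Sum>i<n. \<integral>\<omega>. (\<xi> i \<omega>)\<^sup>2 \<partial>M)"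
proof (induction n)
  case 0
  then show ?case by (simp add: S_def)
next
  case (Suc n)
  let ?D = "\<lambda>\<omega>. \<psi> (W (s (Suc n)) \<omega> - W (s n) \<omega>)"
  have S_Suc: "S (Suc n) = (\<lambda>\<omega>. S n \<omega> + \<xi> n \<omega> * ?D \<omega>)"
    by (simp add: S_def)
  have Wm[measurable]: "W (s (Suc n)) \<in> borel_measurable (F (ennreal (s (Suc n))))"
    "W (s n) \<in> borel_measurable (F (ennreal (s (Suc n))))"
    using s(1)[of n] s(2)[of n] by (auto intro!: W_measurable_F s)
  have [measurable]: "\<psi> \<in> borel_measurable borel" by fact
  have le: "ennreal (s n) \<le> ennreal (s (Suc n))"
    using s(2)[of n] by (intro ennreal_leI) auto
  have [measurable]: "\<xi> n \<in> borel_measurable (F (ennreal (s (Suc n))))"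
    "S n \<in> borel_measurable (F (ennreal (s (Suc n))))"
    using measurable_F_mono[OF \<xi>(1) le] measurable_F_mono[OF conjunct1[OF Suc] le] by auto
  have "?D \<in> borel_measurable (F (ennreal (s (Suc n))))" by measurable
  then have [measurable]: "\<xi> n \<in> borel_measurable M" "S n \<in> borel_measurable M" "?D \<in> borel_measurable M"
    by - (rule measurable_F_M[OF \<xi>(1)] measurable_F_M[OF conjunct1[OF Suc]] measurable_F_M; assumption?)+
  have D1: "integrable M ?D"
    using \<psi>(2)[of n] by (rule square_integrable_imp_integrable[rotated]) auto
  have a: "integrable M (\<lambda>\<omega>. (\<xi> n \<omega>)\<^sup>2 * (?D \<omega>)\<^sup>2)"
      "(\<integral>\<omega>. (\<xi> n \<omega>)\<^sup>2 * (?D \<omega>)\<^sup>2 \<partial>M) = (\<integral>\<omega>. (\<xi> n \<omega>)\<^sup>2 \<partial>M) * v"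
    using W_indep[OF s(1) s(2), of "\<lambda>\<omega>. (\<xi> n \<omega>)\<^sup>2" n "\<lambda>x. (\<psi> x)\<^sup>2"] \<xi>(1)[of n] \<xi>(2) \<psi>(2) \<psi>(4)
    by auto
  have m: "(\<lambda>\<omega>. S n \<omega> * \<xi> n \<omega>) \<in> borel_measurable (F (ennreal (s n)))"
    using \<xi>(1)[of n] conjunct1[OF Suc] by (rule borel_measurable_times[rotated])
  have Si: "integrable M (\<lambda>\<omega>. S n \<omega> * \<xi> n \<omega>)"
    using Suc \<xi>(2) by (intro square_integrable_mult) auto
  have b: "integrable M (\<lambda>\<omega>. (S n \<omega> * \<xi> n \<omega>) * ?D \<omega>)"
      "(\<integral>\<omega>. (S n \<omega> * \<xi> n \<omega>) * ?D \<omega> \<partial>M) = 0"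
    using W_indep[OF s(1) s(2) m \<psi>(1) Si D1] \<psi>(3) by auto
  have eq: "(S (Suc n) \<omega>)\<^sup>2 = (S n \<omega>)\<^sup>2 + 2 * ((S n \<omega> * \<xi> n \<omega>) * ?D \<omega>) + (\<xi> n \<omega>)\<^sup>2 * (?D \<omega>)\<^sup>2" for \<omega>
    by (simp add: S_Suc power2_sum power_mult_distrib)
  have "S (Suc n) \<in> borel_measurable (F (ennreal (s (Suc n))))"
    unfolding S_Suc by measurable
  moreover have "integrable M (\<lambda>\<omega>. (S (Suc n) \<omega>)\<^sup>2)"
    unfolding eq using conjunct1[OF conjunct2[OF Suc]] a(1) b(1)
    by (intro Bochner_Integration.integrable_add integrable_mult_right)
  moreover have "(\<integral>\<omega>. (S (Suc n) \<omega>)\<^sup>2 \<partial>M) = v * (\<Sum>i<Suc n. \<integral>\<omega>. (\<xi> i \<omega>)\<^sup>2 \<partial>M)"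
    unfolding eq using conjunct2[OF Suc] a b by (simp add: distrib_left mult.commute[of v])
  ultimately show ?case by blast
qed

text \<open>With a nonzero mean \<open>m\<close>, each \<open>\<psi>\<close> splits into a centred
  part, handled by the isometry, and the constant \<open>m\<close>, for which Cauchy-Schwarz over
  \<open>n\<close> summands costs the factor \<open>n * m\<^sup>2\<close>.\<close>

lemma sum_increments_second_moment:
  fixes s :: "nat \<Rightarrow> real" and \<xi> :: "nat \<Rightarrow> 'a \<Rightarrow> real" and \<psi> :: "real \<Rightarrow> real"
  assumes s: "\<And>i. 0 \<le> s i" "\<And>i. s i < s (Suc i)"
    and \<xi>: "\<And>i. \<xi> i \<in> borel_measurable (F (ennreal (s i)))" "\<And>i. integrable M (\<lambda>\<omega>. (\<xi> i \<omega>)\<^sup>2)"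
    and \<psi>: "\<psi> \<in> borel_measurable borel"
      "\<And>i. integrable M (\<lambda>\<omega>. (\<psi> (W (s (Suc i)) \<omega> - W (s i) \<omega>))\<^sup>2)"
      "\<And>i. (\<integral>\<omega>. \<psi> (W (s (Suc i)) \<omega> - W (s i) \<omega>) \<partial>M) = m"
      "\<And>i. (\<integral>\<omega>. (\<psi> (W (s (Suc i)) \<omega> - W (s i) \<omega>))\<^sup>2 \<partial>M) = v"
  defines "S \<equiv> \<lambda>n \<omega>. \<Sum>i<n. \<xi> i \<omega> * \<psi> (W (s (Suc i)) \<omega> - W (s i) \<omega>)"
  shows "integrable M (\<lambda>\<omega>. (S n \<omega>)\<^sup>2)"
    and "(\<integral>\<omega>. (S n \<omega>)\<^sup>2 \<partial>M) \<le> 2 * (v + n * m\<^sup>2) * (\<Sum>i<n. \<integral>\<omega>. (\<xi> i \<omega>)\<^sup>2 \<partial>M)"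
proof -
  let ?D = "\<lambda>i \<omega>. \<psi> (W (s (Suc i)) \<omega> - W (s i) \<omega>)"
  define S0 where "S0 n \<omega> = (\<Sum>i<n. \<xi> i \<omega> * (?D i \<omega> - m))" for n \<omega>
  have [measurable]: "\<psi> \<in> borel_measurable borel" by fact
  have Wm[measurable]: "W (s i) \<in> borel_measurable M" for i
    using W_measurable s by auto
  have [measurable]: "\<xi> i \<in> borel_measurable M" for i
    using \<xi>(1) by (rule measurable_F_M)
  have D1: "integrable M (?D i)" for i
    using \<psi>(2)[of i] by (rule square_integrable_imp_integrable[rotated]) auto
  have 0: "integrable M (\<lambda>\<omega>. (?D i \<omega> - m)\<^sup>2)" "(\<integral>\<omega>. (?D i \<omega> - m)\<^sup>2 \<partial>M) = v - m\<^sup>2" for i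
    using D1[of i] \<psi>(2,3,4)[of i]
    by (simp_all add: power2_diff prob_space) (simp add: power2_eq_square)
  have 1: "S0 n \<in> borel_measurable (F (ennreal (s n))) \<and> integrable M (\<lambda>\<omega>. (S0 n \<omega>)\<^sup>2) \<and>
    (\<integral>\<omega>. (S0 n \<omega>)\<^sup>2 \<partial>M) = (v - m\<^sup>2) * (\<Sum>i<n. \<integral>\<omega>. (\<xi> i \<omega>)\<^sup>2 \<partial>M)"
    unfolding S0_def using s \<xi> 0 D1 \<psi>
    by (intro sum_increments_orthogonal[of s \<xi> "\<lambda>x. \<psi> x - m"]) (auto simp: prob_space)
  have nn: "0 \<le> (\<Sum>i<n. \<integral>\<omega>. (\<xi> i \<omega>)\<^sup>2 \<partial>M)"
    by (intro sum_nonneg) auto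
  have pt: "(S n \<omega>)\<^sup>2 \<le> 2 * (S0 n \<omega>)\<^sup>2 + 2 * (m\<^sup>2 * (n * (\<Sum>i<n. (\<xi> i \<omega>)\<^sup>2)))" for \<omega>
  proof -
    have "S n \<omega> = S0 n \<omega> + m * (\<Sum>i<n. \<xi> i \<omega>)"
      by (simp add: S_def S0_def algebra_simps sum.distrib sum_distrib_left sum_subtractf)
    then have le: "(S n \<omega>)\<^sup>2 \<le> 2 * (S0 n \<omega>)\<^sup>2 + 2 * (m * (\<Sum>i<n. \<xi> i \<omega>))\<^sup>2"
      using zero_le_power2[of "S0 n \<omega> - m * (\<Sum>i<n. \<xi> i \<omega>)"]
      by (simp add: power2_sum power2_diff)
    have "(m * (\<Sum>i<n. \<xi> i \<omega>))\<^sup>2 \<le> m\<^sup>2 * (n * (\<Sum>i<n. (\<xi> i \<omega>)\<^sup>2))"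
      using sum_squared_le_sum_of_squares[of "\<lambda>i. \<xi> i \<omega>" "{..<n}"]
      by (auto simp: power_mult_distrib mult.commute intro!: mult_left_mono)
    with le show ?thesis by linarith
  qed
  have int: "integrable M (\<lambda>\<omega>. 2 * (S0 n \<omega>)\<^sup>2 + 2 * (m\<^sup>2 * (n * (\<Sum>i<n. (\<xi> i \<omega>)\<^sup>2))))"
    using 1 \<xi>(2) by auto
  have Sm[measurable]: "S n \<in> borel_measurable M"
    unfolding S_def by measurable
  show iS: "integrable M (\<lambda>\<omega>. (S n \<omega>)\<^sup>2)"
  proof (rule Bochner_Integration.integrable_bound[OF int])
    show "AE \<omega> in M. norm ((S n \<omega>)\<^sup>2) \<le> norm (2 * (S0 n \<omega>)\<^sup>2 + 2 * (m\<^sup>2 * (n * (\<Sum>i<n. (\<xi> i \<omega>)\<^sup>2))))"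
      using order_trans[OF pt abs_ge_self] by (intro AE_I2) simp
  qed simp
  have "(\<integral>\<omega>. (S n \<omega>)\<^sup>2 \<partial>M) \<le> (\<integral>\<omega>. 2 * (S0 n \<omega>)\<^sup>2 + 2 * (m\<^sup>2 * (n * (\<Sum>i<n. (\<xi> i \<omega>)\<^sup>2))) \<partial>M)"
    by (intro integral_mono iS int pt)
  also have "\<dots> = 2 * (v - m\<^sup>2) * (\<Sum>i<n. \<integral>\<omega>. (\<xi> i \<omega>)\<^sup>2 \<partial>M) + 2 * m\<^sup>2 * n * (\<Sum>i<n. \<integral>\<omega>. (\<xi> i \<omega>)\<^sup>2 \<partial>M)"
    using 1 \<xi>(2) by (simp add: Bochner_Integration.integral_sum del: mult_cancel_left mult_cancel_right)
  also have "\<dots> = 2 * (v - m\<^sup>2 + n * m\<^sup>2) * (\<Sum>i<n. \<integral>\<omega>. (\<xi> i \<omega>)\<^sup>2 \<partial>M)"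
    by (simp add: algebra_simps)
  also have "\<dots> \<le> 2 * (v + n * m\<^sup>2) * (\<Sum>i<n. \<integral>\<omega>. (\<xi> i \<omega>)\<^sup>2 \<partial>M)"
    using nn by (intro mult_right_mono) auto
  finally show "(\<integral>\<omega>. (S n \<omega>)\<^sup>2 \<partial>M) \<le> 2 * (v + n * m\<^sup>2) * (\<Sum>i<n. \<integral>\<omega>. (\<xi> i \<omega>)\<^sup>2 \<partial>M)" .
qed

end

subsection \<open>Left-point Riemann sums\<close>

text \<open>The primitive telescopes over the grid, and uniform continuity makes the error on each
  cell at most \<open>e\<close> times its width.\<close>

lemma left_riemann_sum_tendsto:
  fixes f :: "real \<Rightarrow> real"
  assumes cont: "continuous_on {0..t} f" and "0 < t"
  shows "(\<lambda>n. \<Sum>i<n. f (t * real i / real n) * (t / real n)) \<longlonglongrightarrow> (LINT s:{0..t}|lborel. f s)"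
proof -
  define \<Phi> where "\<Phi> x = integral {0..x} f" for x
  have "set_integrable lborel {0..t} f"
    using borel_integrable_compact[OF compact_Icc cont] by (simp add: set_integrable_def mult.commute)
  then have L: "(LINT s:{0..t}|lborel. f s) = \<Phi> t"
    unfolding \<Phi>_def by (rule set_borel_integral_eq_integral)
  have step: "\<bar>\<Phi> b - \<Phi> a - f a * (b - a)\<bar> \<le> e * (b - a)"
    if "0 \<le> a" "a \<le> b" "b \<le> t" "\<And>x. a \<le> x \<Longrightarrow> x \<le> b \<Longrightarrow> \<bar>f x - f a\<bar> \<le> e" for a b e
  proof -
    have ca: "continuous_on {a..b} f" and c0: "continuous_on {0..b} f"
      using cont that by (auto elim: continuous_on_subset)
    have "\<Phi> b - \<Phi> a = integral {a..b} f"
      using Henstock_Kurzweil_Integration.integral_combine[of 0 a b f] integrable_continuous_interval[OF c0] that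
      by (simp add: \<Phi>_def)
    moreover have "integral {a..b} (\<lambda>x. f x - f a) = integral {a..b} f - f a * (b - a)"
      using Henstock_Kurzweil_Integration.integral_diff[OF integrable_continuous_interval[OF ca] integrable_const_ivl[of "f a"]] \<open>a \<le> b\<close>
      by (simp add: mult.commute)
    moreover have "norm (integral {a..b} (\<lambda>x. f x - f a)) \<le> e * (b - a)"
      using that ca by (intro integral_bound) (auto intro!: continuous_intros)
    ultimately show ?thesis by simp
  qed
  show ?thesis
    unfolding L
  proof (rule LIMSEQ_I)
    fix r :: real assume r: "0 < r"
    \<comment> \<open>The cell errors add up to at most \<open>e * t\<close>, half of the
      tolerance.\<close>
    define e where "e = r / (2 * t)"
    have e: "0 < e" using r \<open>0 < t\<close> by (simp add: e_def)
    have "uniformly_continuous_on {0..t} f"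
      using cont by (rule compact_uniformly_continuous) simp
    then obtain d where d: "0 < d" "\<And>x y. x \<in> {0..t} \<Longrightarrow> y \<in> {0..t} \<Longrightarrow> dist x y < d \<Longrightarrow> dist (f x) (f y) < e"
      using e unfolding uniformly_continuous_on_def by metis
    obtain N :: nat where N: "t / d < real N" using reals_Archimedean2 by blast
    have "norm ((\<Sum>i<n. f (t * real i / real n) * (t / real n)) - \<Phi> t) < r" if n: "n \<ge> max N 1" for n
    proof -
      have n0: "0 < real n" using n by simp
      have "t / d < real n" using N n by simp
      then have small: "t / real n < d" using d(1) n0 by (simp add: field_simps)
      define s where "s i = t * real i / real n" for i
      have s_step: "s (Suc i) - s i = t / real n" for i
        using n0 by (simp add: s_def field_simps)
      have s_le: "s i \<le> t" if "i \<le> n" for i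
        using that n0 \<open>0 < t\<close> by (simp add: s_def field_simps)
      have s_ge: "0 \<le> s i" for i
        using n0 \<open>0 < t\<close> by (simp add: s_def)
      have "\<Phi> t = \<Phi> (s n) - \<Phi> (s 0)"
        using n0 by (simp add: s_def \<Phi>_def)
      also have "\<dots> = (\<Sum>i<n. \<Phi> (s (Suc i)) - \<Phi> (s i))"
        by (rule sum_lessThan_telescope[symmetric])
      finally have "\<bar>(\<Sum>i<n. f (s i) * (t / real n)) - \<Phi> t\<bar>
          = \<bar>\<Sum>i<n. \<Phi> (s (Suc i)) - \<Phi> (s i) - f (s i) * (s (Suc i) - s i)\<bar>"
        by (simp add: s_step sum_subtractf)
      also have "\<dots> \<le> (\<Sum>i<n. \<bar>\<Phi> (s (Suc i)) - \<Phi> (s i) - f (s i) * (s (Suc i) - s i)\<bar>)"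
        by (rule sum_abs)
      also have "\<dots> \<le> (\<Sum>i<n. e * (s (Suc i) - s i))"
      proof (intro sum_mono step)
        fix i assume i: "i \<in> {..<n}"
        show "0 \<le> s i" "s (Suc i) \<le> t" using s_ge s_le i by auto
        show "s i \<le> s (Suc i)" using s_step[of i] n0 \<open>0 < t\<close> by (simp add: algebra_simps)
        fix x assume x: "s i \<le> x" "x \<le> s (Suc i)"
        have "dist (f x) (f (s i)) < e"
          using x s_ge[of i] s_le[of i] s_le[of "Suc i"] s_step[of i] small i
          by (intro d(2)) (auto simp: dist_real_def)
        then show "\<bar>f x - f (s i)\<bar> \<le> e" by (simp add: dist_real_def)
      qed
      also have "\<dots> = r / 2"
        unfolding s_step using n0 \<open>0 < t\<close> by (simp add: e_def)
      finally show ?thesis using r by (simp add: s_def)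
    qed
    then show "\<exists>no. \<forall>n\<ge>no. norm ((\<Sum>i<n. f (t * real i / real n) * (t / real n)) - \<Phi> t) < r"
      by blast
  qed
qed

lemma power_Suc_add_le:
  fixes x :: real
  assumes "0 \<le> x"
  shows "x ^ Suc k + (real k + 1) * x ^ k \<le> (x + 1) ^ Suc k"
proof (induction k)
  case (Suc k)
  have "x ^ Suc (Suc k) + (real (Suc k) + 1) * x ^ Suc k \<le> (x + 1) * (x ^ Suc k + (real k + 1) * x ^ k)"
    using assms by (simp add: algebra_simps)
  also have "\<dots> \<le> (x + 1) * (x + 1) ^ Suc k"
    using Suc assms by (intro mult_left_mono) auto
  finally show ?case by simp
qed simp

lemma sum_powers_le: "(real k + 1) * (\<Sum>i<n. real i ^ k) \<le> real n ^ Suc k"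
proof (induction n)
  case (Suc n)
  have "(real k + 1) * (\<Sum>i<Suc n. real i ^ k) \<le> real n ^ Suc k + (real k + 1) * real n ^ k"
    using Suc by (simp add: algebra_simps)
  also have "\<dots> \<le> real (Suc n) ^ Suc k"
    using power_Suc_add_le[of "real n" k] by (simp add: add.commute)
  finally show ?case .
qed simp

text \<open>A left sum of an increasing power lies below its integral. The divisor
  \<open>k + 1\<close> is what accumulates to a factorial in the Gronwall iteration.\<close>

lemma left_sum_power_le:
  assumes "0 < t"
  shows "(\<Sum>i<n. (t * real i / real n) ^ k * (t / real n)) \<le> t ^ Suc k / (real k + 1)"
proof (cases "n = 0")
  case False
  have "(\<Sum>i<n. (t * real i / real n) ^ k * (t / real n)) = (t / real n) ^ Suc k * (\<Sum>i<n. real i ^ k)"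
    by (simp add: sum_distrib_left sum_distrib_right sum_divide_distrib power_mult_distrib power_divide mult_ac)
  also have "\<dots> \<le> (t / real n) ^ Suc k * (real n ^ Suc k / (real k + 1))"
    using assms sum_powers_le[of k n] by (intro mult_left_mono) (auto simp: field_simps)
  also have "\<dots> = t ^ Suc k / (real k + 1)"
    using False by (simp add: power_divide)
  finally show ?thesis .
qed (use assms in simp)

text \<open>Closed conditions pass to limits and the rationals are dense. This reduces a condition
  on a whole path to countably many times, hence to a measurable or almost sure one.\<close>

lemma continuous_on_rationals_closed:
  fixes f :: "real \<Rightarrow> real"
  assumes f: "continuous_on {0..t} f" and C: "closed C" and "0 \<le> t"
    and rat: "\<And>r. r \<in> \<rat> \<Longrightarrow> 0 \<le> r \<Longrightarrow> r \<le> t \<Longrightarrow> f r \<in> C" and x: "0 \<le> x" "x \<le> t"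
  shows "f x \<in> C"
proof (cases "t = 0")
  case True
  then show ?thesis using rat[of x] x by simp
next
  case False
  then have t: "0 < t" using \<open>0 \<le> t\<close> by simp
  let ?Q = "{0<..<t} \<inter> \<rat>"
  have "{0<..<t} \<subseteq> closure ?Q"
    using open_Int_closure_subset[of "{0<..<t}" \<rat>] by (simp add: Rats_closure_real)
  then have "closure {0<..<t} \<subseteq> closure ?Q"
    by (rule closure_minimal) simp
  then have sub: "{0..t} \<subseteq> closure ?Q"
    using t by simp
  have "closure ?Q \<subseteq> {0..t}"
    by (rule closure_minimal) auto
  with f have "continuous_on (closure ?Q) f"
    by (rule continuous_on_subset)
  then have "f ` closure ?Q \<subseteq> C"
    using C rat by (intro image_closure_subset) auto
  moreover have "x \<in> closure ?Q" using sub x by auto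
  ultimately show ?thesis by blast
qed

subsection \<open>Convergence to zero in probability\<close>

context prob_space
begin

text \<open>The form of convergence matches \<open>has_ito_integral\<close>, strict inequality
  included, so that the defining property of the price is directly an instance.\<close>

definition tends_prob_0 :: "(nat \<Rightarrow> 'a \<Rightarrow> real) \<Rightarrow> bool" where
  "tends_prob_0 Z \<longleftrightarrow> (\<forall>n. Z n \<in> borel_measurable M) \<and>
     (\<forall>\<epsilon>>0. (\<lambda>n. prob {\<omega> \<in> space M. \<epsilon> < \<bar>Z n \<omega>\<bar>}) \<longlonglongrightarrow> 0)"

lemma tends_prob_0_add:
  assumes "tends_prob_0 Y" "tends_prob_0 Z"
  shows "tends_prob_0 (\<lambda>n \<omega>. Y n \<omega> + Z n \<omega>)"
  unfolding tends_prob_0_def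
proof (intro conjI allI impI)
  have [measurable]: "Y n \<in> borel_measurable M" "Z n \<in> borel_measurable M" for n
    using assms by (auto simp: tends_prob_0_def)
  show "(\<lambda>\<omega>. Y n \<omega> + Z n \<omega>) \<in> borel_measurable M" for n by measurable
  fix e :: real assume e: "0 < e"
  let ?y = "\<lambda>n. prob {\<omega> \<in> space M. e / 2 < \<bar>Y n \<omega>\<bar>}" and ?z = "\<lambda>n. prob {\<omega> \<in> space M. e / 2 < \<bar>Z n \<omega>\<bar>}"
  have "?y \<longlonglongrightarrow> 0" "?z \<longlonglongrightarrow> 0"
    using assms half_gt_zero[OF e] unfolding tends_prob_0_def by blast+
  then have lim: "(\<lambda>n. ?y n + ?z n) \<longlonglongrightarrow> 0"
    using tendsto_add by fastforce
  have le: "prob {\<omega> \<in> space M. e < \<bar>Y n \<omega> + Z n \<omega>\<bar>} \<le> ?y n + ?z n" for n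
  proof -
    have "prob {\<omega> \<in> space M. e < \<bar>Y n \<omega> + Z n \<omega>\<bar>} \<le>
        prob ({\<omega> \<in> space M. e / 2 < \<bar>Y n \<omega>\<bar>} \<union> {\<omega> \<in> space M. e / 2 < \<bar>Z n \<omega>\<bar>})"
      by (intro finite_measure_mono) auto
    also have "\<dots> \<le> ?y n + ?z n"
      by (intro measure_Un_le) auto
    finally show ?thesis .
  qed
  show "(\<lambda>n. prob {\<omega> \<in> space M. e < \<bar>Y n \<omega> + Z n \<omega>\<bar>}) \<longlonglongrightarrow> 0"
    by (rule tendsto_sandwich[OF _ _ tendsto_const lim]) (use le in \<open>auto intro!: always_eventually\<close>)
qed

lemma tends_prob_0_minus: "tends_prob_0 Z \<Longrightarrow> tends_prob_0 (\<lambda>n \<omega>. - Z n \<omega>)"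
  by (simp add: tends_prob_0_def)

lemma tends_prob_0_AE:
  assumes [measurable]: "\<And>n. Z n \<in> borel_measurable M" and ae: "AE \<omega> in M. (\<lambda>n. Z n \<omega>) \<longlonglongrightarrow> 0"
  shows "tends_prob_0 Z"
  unfolding tends_prob_0_def
proof (intro conjI allI impI)
  fix e :: real assume e: "0 < e"
  have "(\<lambda>n. \<integral>\<omega>. indicator {\<omega> \<in> space M. e < \<bar>Z n \<omega>\<bar>} \<omega> \<partial>M) \<longlonglongrightarrow> (\<integral>\<omega>. (0::real) \<partial>M)"
  proof (rule integral_dominated_convergence[where w = "\<lambda>_. 1"])
    show "AE \<omega> in M. (\<lambda>n. indicator {\<omega> \<in> space M. e < \<bar>Z n \<omega>\<bar>} \<omega> :: real) \<longlonglongrightarrow> 0"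
      using ae
    proof eventually_elim
      case (elim \<omega>)
      then have "eventually (\<lambda>n. \<bar>Z n \<omega>\<bar> < e) sequentially"
        using e by (auto dest!: tendstoD simp: dist_real_def)
      then have "eventually (\<lambda>n. indicator {\<omega> \<in> space M. e < \<bar>Z n \<omega>\<bar>} \<omega> = (0::real)) sequentially"
        by eventually_elim (auto simp: indicator_def)
      then show ?case by (rule tendsto_eventually)
    qed
  qed (auto simp: indicator_def)
  then show "(\<lambda>n. prob {\<omega> \<in> space M. e < \<bar>Z n \<omega>\<bar>}) \<longlonglongrightarrow> 0"
    by simp
qed measurable

lemma tends_prob_0_L2:
  assumes m[measurable]: "\<And>n. Z n \<in> borel_measurable M" and i: "\<And>n. integrable M (\<lambda>\<omega>. (Z n \<omega>)\<^sup>2)"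
    and lim: "(\<lambda>n. \<integral>\<omega>. (Z n \<omega>)\<^sup>2 \<partial>M) \<longlonglongrightarrow> 0"
  shows "tends_prob_0 Z"
  unfolding tends_prob_0_def
proof (intro conjI allI impI)
  fix e :: real assume e: "0 < e"
  have le: "prob {\<omega> \<in> space M. e < \<bar>Z n \<omega>\<bar>} \<le> (\<integral>\<omega>. (Z n \<omega>)\<^sup>2 \<partial>M) / e\<^sup>2" for n
  proof -
    have "prob {\<omega> \<in> space M. e < \<bar>Z n \<omega>\<bar>} \<le> prob {\<omega> \<in> space M. e \<le> \<bar>Z n \<omega>\<bar>}"
      by (intro finite_measure_mono) auto
    also have "\<dots> \<le> (\<integral>\<omega>. (Z n \<omega>)\<^sup>2 \<partial>M) / e\<^sup>2"
      by (rule second_moment_method[OF m i e])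
    finally show ?thesis .
  qed
  have "(\<lambda>n. (\<integral>\<omega>. (Z n \<omega>)\<^sup>2 \<partial>M) / e\<^sup>2) \<longlonglongrightarrow> 0"
    using tendsto_divide[OF lim tendsto_const[of "e\<^sup>2"]] e by simp
  then show "(\<lambda>n. prob {\<omega> \<in> space M. e < \<bar>Z n \<omega>\<bar>}) \<longlonglongrightarrow> 0"
    by (rule tendsto_sandwich[OF always_eventually always_eventually tendsto_const, rotated 2]) (simp_all add: le)
qed measurable

lemma tends_prob_0_cong_AE:
  assumes "tends_prob_0 Y" and [measurable]: "\<And>n. Z n \<in> borel_measurable M"
    and ae: "\<And>n. AE \<omega> in M. Y n \<omega> = Z n \<omega>"
  shows "tends_prob_0 Z"
proof -
  have [measurable]: "Y n \<in> borel_measurable M" for n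
    using assms by (simp add: tends_prob_0_def)
  have "prob {\<omega> \<in> space M. e < \<bar>Y n \<omega>\<bar>} = prob {\<omega> \<in> space M. e < \<bar>Z n \<omega>\<bar>}" for n e
    by (intro measure_eq_AE) (use ae[of n] in auto)
  then show ?thesis using assms by (simp add: tends_prob_0_def)
qed

end

subsection \<open>The Euler scheme of geometric Brownian motion\<close>

context brownian_space
begin

definition gbm :: "real \<Rightarrow> real \<Rightarrow> real \<Rightarrow> real \<Rightarrow> 'a \<Rightarrow> real" where
  "gbm \<mu> \<sigma> q t \<omega> = q * exp (\<sigma> * W t \<omega> + (\<mu> - \<sigma>\<^sup>2 / 2) * t)"

lemma gbm_measurable_F: "0 \<le> s \<Longrightarrow> s \<le> t \<Longrightarrow> gbm \<mu> \<sigma> q s \<in> borel_measurable (F (ennreal t))"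
  unfolding gbm_def[abs_def] using W_measurable_F[of s t] by measurable

lemma gbm_measurable: "0 \<le> s \<Longrightarrow> gbm \<mu> \<sigma> q s \<in> borel_measurable M"
  unfolding gbm_def[abs_def] using W_measurable[of s] by measurable

lemma gbm_cont: "continuous_on {0..} (\<lambda>t. gbm \<mu> \<sigma> q t \<omega>)"
  unfolding gbm_def by (intro continuous_intros W_cont)

lemma gbm_second_moment:
  assumes "0 \<le> t"
  shows "integrable M (\<lambda>\<omega>. (gbm \<mu> \<sigma> q t \<omega>)\<^sup>2)"
    and "(\<integral>\<omega>. (gbm \<mu> \<sigma> q t \<omega>)\<^sup>2 \<partial>M) = q\<^sup>2 * exp ((2 * \<mu> + \<sigma>\<^sup>2) * t)"
proof -
  have eq: "(gbm \<mu> \<sigma> q t \<omega>)\<^sup>2 = q\<^sup>2 * exp ((2 * \<mu> - \<sigma>\<^sup>2) * t) * exp (2 * \<sigma> * (W t \<omega> - W 0 \<omega>))" for \<omega>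
    unfolding gbm_def power_mult_distrib exp_double[symmetric] mult.assoc exp_add[symmetric]
    by (simp add: algebra_simps)
  have e: "(2 * \<mu> - \<sigma>\<^sup>2) * t + (2 * \<sigma>)\<^sup>2 * t / 2 = (2 * \<mu> + \<sigma>\<^sup>2) * t"
    by (simp add: algebra_simps)
  show "integrable M (\<lambda>\<omega>. (gbm \<mu> \<sigma> q t \<omega>)\<^sup>2)"
    unfolding eq using exp_increment(1)[of 0 t "2 * \<sigma>"] assms
    by (cases "t = 0") (auto intro!: integrable_mult_right)
  show "(\<integral>\<omega>. (gbm \<mu> \<sigma> q t \<omega>)\<^sup>2 \<partial>M) = q\<^sup>2 * exp ((2 * \<mu> + \<sigma>\<^sup>2) * t)"
  proof (cases "t = 0")
    case False
    then show ?thesis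
      unfolding eq using exp_increment(2)[of 0 t "2 * \<sigma>"] assms e
      by (simp add: exp_add[symmetric] mult.assoc[symmetric] del: W_0)
  qed (simp add: gbm_def prob_space)
qed

text \<open>\<open>\<psi>\<close> is the relative error of one Euler step: exact growth factor minus
  its linearisation. Mean and second moment are kept in closed form because everything rests on the
  cancellation of their terms of order 0 and 1 in \<open>h\<close>.\<close>

lemma gbm_residual_moments:
  fixes \<mu> \<sigma> h s :: real
  assumes "0 \<le> s" "0 < h"
  defines "\<psi> \<equiv> \<lambda>x. exp (\<sigma> * x + (\<mu> - \<sigma>\<^sup>2 / 2) * h) - 1 - \<sigma> * x - \<mu> * h"
  shows "integrable M (\<lambda>\<omega>. (\<psi> (W (s + h) \<omega> - W s \<omega>))\<^sup>2)"
    and "(\<integral>\<omega>. \<psi> (W (s + h) \<omega> - W s \<omega>) \<partial>M) = exp (\<mu> * h) - 1 - \<mu> * h"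
    and "(\<integral>\<omega>. (\<psi> (W (s + h) \<omega> - W s \<omega>))\<^sup>2 \<partial>M) =
      exp ((2 * \<mu> + \<sigma>\<^sup>2) * h) - 2 * exp (\<mu> * h) * (1 + \<mu> * h + \<sigma>\<^sup>2 * h) + (1 + \<mu> * h)\<^sup>2 + \<sigma>\<^sup>2 * h"
proof -
  define d where "d = (\<mu> - \<sigma>\<^sup>2 / 2) * h"
  let ?D = "\<lambda>\<omega>. W (s + h) \<omega> - W s \<omega>"
  have sh: "s < s + h" using assms by simp
  note [simp] = exp_increment[OF \<open>0 \<le> s\<close> sh] increment_exp_moment[OF \<open>0 \<le> s\<close> sh] increment_moments[OF \<open>0 \<le> s\<close> sh]
  have e1: "\<psi> x = exp d * exp (\<sigma> * x) - (1 + \<mu> * h) - \<sigma> * x" for x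
    by (simp add: \<psi>_def d_def exp_add)
  have e2: "(\<psi> x)\<^sup>2 = exp (2 * d) * exp ((2 * \<sigma>) * x) + ((1 + \<mu> * h)\<^sup>2 + (\<sigma>\<^sup>2 * x\<^sup>2 + 2 * (1 + \<mu> * h) * \<sigma> * x))
      - (2 * (1 + \<mu> * h) * exp d * exp (\<sigma> * x) + 2 * \<sigma> * exp d * (x * exp (\<sigma> * x)))" for x
    using exp_double[of d] exp_double[of "\<sigma> * x"]
    by (simp add: e1 power2_diff power_mult_distrib mult.assoc) (simp add: algebra_simps)
  \<comment> \<open>The correction \<open>\<sigma>\<^sup>2 / 2\<close> in the exponent cancels
    exactly against the Gaussian exponential moment.\<close>
  have x1: "exp d * exp (\<sigma>\<^sup>2 * h / 2) = exp (\<mu> * h)"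
    by (simp add: d_def exp_add[symmetric] algebra_simps)
  have x2: "exp (2 * d) * exp ((2 * \<sigma>)\<^sup>2 * h / 2) = exp ((2 * \<mu> + \<sigma>\<^sup>2) * h)"
    by (simp add: d_def exp_add[symmetric] algebra_simps)
  show "integrable M (\<lambda>\<omega>. (\<psi> (?D \<omega>))\<^sup>2)"
    unfolding e2 using exp_increment(1)[OF \<open>0 \<le> s\<close> sh] increment_exp_moment(1)[OF \<open>0 \<le> s\<close> sh]
    by (intro Bochner_Integration.integrable_diff Bochner_Integration.integrable_add integrable_mult_right
      increment_moments[OF \<open>0 \<le> s\<close> sh] integrable_const)
  show "(\<integral>\<omega>. \<psi> (?D \<omega>) \<partial>M) = exp (\<mu> * h) - 1 - \<mu> * h"
    using x1 by (simp add: e1 prob_space)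
  have "(\<integral>\<omega>. (\<psi> (?D \<omega>))\<^sup>2 \<partial>M) = exp (2 * d) * exp ((2 * \<sigma>)\<^sup>2 * h / 2) + ((1 + \<mu> * h)\<^sup>2 + \<sigma>\<^sup>2 * h)
      - (2 * (1 + \<mu> * h) * (exp d * exp (\<sigma>\<^sup>2 * h / 2)) + 2 * \<sigma>\<^sup>2 * h * (exp d * exp (\<sigma>\<^sup>2 * h / 2)))"
    unfolding e2 by (simp add: prob_space) (simp add: power2_eq_square mult_ac)
  then show "(\<integral>\<omega>. (\<psi> (?D \<omega>))\<^sup>2 \<partial>M) =
      exp ((2 * \<mu> + \<sigma>\<^sup>2) * h) - 2 * exp (\<mu> * h) * (1 + \<mu> * h + \<sigma>\<^sup>2 * h) + (1 + \<mu> * h)\<^sup>2 + \<sigma>\<^sup>2 * h"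
    unfolding x1 x2 by (simp add: algebra_simps)
qed

text \<open>This says that the exponential solves the equation, without Ito's formula. Telescoping
  over the grid, each increment is an Euler step plus a residual, and the second moment of the
  summed residuals is at most of order \<open>n * (v h + n * (m h)\<^sup>2)\<close>, which tends to
  0.\<close>

lemma gbm_euler_sum:
  assumes "0 < t" "0 \<le> \<mu>"
  shows "tends_prob_0 (\<lambda>n \<omega>. (\<Sum>i<n. gbm \<mu> \<sigma> q (t * real i / real n) \<omega> *
      (\<sigma> * (W (t * real (Suc i) / real n) \<omega> - W (t * real i / real n) \<omega>) + \<mu> * (t / real n)))
      - (gbm \<mu> \<sigma> q t \<omega> - q))" (is "tends_prob_0 ?Z")
proof (rule tends_prob_0_L2)
  have [measurable]: "W (t * real i / real n) \<in> borel_measurable M"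
      "gbm \<mu> \<sigma> q (t * real i / real n) \<in> borel_measurable M" for i n
    using assms by (auto intro!: W_measurable gbm_measurable)
  have [measurable]: "gbm \<mu> \<sigma> q t \<in> borel_measurable M"
    using assms by (auto intro!: gbm_measurable)
  show "?Z n \<in> borel_measurable M" for n
    by measurable
  define C where "C = q\<^sup>2 * exp ((2 * \<mu> + \<sigma>\<^sup>2) * t)"
  define v where "v h = exp ((2 * \<mu> + \<sigma>\<^sup>2) * h) - 2 * exp (\<mu> * h) * (1 + \<mu> * h + \<sigma>\<^sup>2 * h) + (1 + \<mu> * h)\<^sup>2 + \<sigma>\<^sup>2 * h" for h
  define m where "m h = exp (\<mu> * h) - 1 - \<mu> * h" for h
  have bound: "integrable M (\<lambda>\<omega>. (?Z n \<omega>)\<^sup>2) \<and>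
      (\<integral>\<omega>. (?Z n \<omega>)\<^sup>2 \<partial>M) \<le> 2 * (v (t / real n) + n * (m (t / real n))\<^sup>2) * (n * C)" if n: "0 < n" for n
  proof -
    define h where "h = t / real n"
    define s where "s i = t * real i / real n" for i
    define \<psi> where "\<psi> x = exp (\<sigma> * x + (\<mu> - \<sigma>\<^sup>2 / 2) * h) - 1 - \<sigma> * x - \<mu> * h" for x
    have h: "0 < h" using n assms by (simp add: h_def)
    have s0: "0 \<le> s i" and s1: "s (Suc i) = s i + h" for i
      using n assms by (auto simp: s_def h_def field_simps)
    have st: "s i \<le> t" if "i < n" for i
      using that n assms by (auto simp: s_def field_simps)
    \<comment> \<open>Setting the coefficients to 0 beyond the grid lets the bound by
      \<open>C\<close>, valid only up to time \<open>t\<close>, hold for every index.\<close>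
    define \<xi> where "\<xi> i = (if i < n then gbm \<mu> \<sigma> q (s i) else (\<lambda>_. 0))" for i
    have Z: "?Z n \<omega> = - (\<Sum>i<n. \<xi> i \<omega> * \<psi> (W (s (Suc i)) \<omega> - W (s i) \<omega>))" for \<omega>
    proof -
      have "gbm \<mu> \<sigma> q t \<omega> - q = gbm \<mu> \<sigma> q (s n) \<omega> - gbm \<mu> \<sigma> q (s 0) \<omega>"
        using n by (simp add: s_def) (simp add: gbm_def)
      also have "\<dots> = (\<Sum>i<n. gbm \<mu> \<sigma> q (s (Suc i)) \<omega> - gbm \<mu> \<sigma> q (s i) \<omega>)"
        by (rule sum_lessThan_telescope[symmetric])
      also have "\<dots> = (\<Sum>i<n. \<xi> i \<omega> * \<psi> (W (s (Suc i)) \<omega> - W (s i) \<omega>)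
          + gbm \<mu> \<sigma> q (s i) \<omega> * (\<sigma> * (W (s (Suc i)) \<omega> - W (s i) \<omega>) + \<mu> * h))"
      proof (rule sum.cong)
        fix i assume i: "i \<in> {..<n}"
        have "gbm \<mu> \<sigma> q (s (Suc i)) \<omega> = gbm \<mu> \<sigma> q (s i) \<omega> * exp (\<sigma> * (W (s (Suc i)) \<omega> - W (s i) \<omega>) + (\<mu> - \<sigma>\<^sup>2 / 2) * h)"
          by (simp add: gbm_def s1 exp_add[symmetric] mult.assoc) (simp add: algebra_simps)
        then show "gbm \<mu> \<sigma> q (s (Suc i)) \<omega> - gbm \<mu> \<sigma> q (s i) \<omega> =
          \<xi> i \<omega> * \<psi> (W (s (Suc i)) \<omega> - W (s i) \<omega>)
          + gbm \<mu> \<sigma> q (s i) \<omega> * (\<sigma> * (W (s (Suc i)) \<omega> - W (s i) \<omega>) + \<mu> * h)"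
          using i by (simp add: \<xi>_def \<psi>_def algebra_simps)
      qed simp
      finally show ?thesis
        by (simp add: sum.distrib s_def[symmetric] h_def[symmetric] del: of_nat_Suc)
    qed
    have xi: "\<xi> i \<in> borel_measurable (F (ennreal (s i)))" "integrable M (\<lambda>\<omega>. (\<xi> i \<omega>)\<^sup>2)"
        "(\<integral>\<omega>. (\<xi> i \<omega>)\<^sup>2 \<partial>M) \<le> C" for i
    proof -
      show "\<xi> i \<in> borel_measurable (F (ennreal (s i)))" "integrable M (\<lambda>\<omega>. (\<xi> i \<omega>)\<^sup>2)"
        using gbm_measurable_F[OF s0 order_refl] gbm_second_moment(1)[OF s0] by (auto simp: \<xi>_def)
      have "(2 * \<mu> + \<sigma>\<^sup>2) * s i \<le> (2 * \<mu> + \<sigma>\<^sup>2) * t" if "i < n"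
        using st[OF that] assms by (intro mult_left_mono) auto
      then show "(\<integral>\<omega>. (\<xi> i \<omega>)\<^sup>2 \<partial>M) \<le> C"
        using gbm_second_moment(2)[of "s i" \<mu> \<sigma> q, OF s0] mult_left_mono[of "exp ((2 * \<mu> + \<sigma>\<^sup>2) * s i)" "exp ((2 * \<mu> + \<sigma>\<^sup>2) * t)" "q\<^sup>2"]
        by (auto simp: \<xi>_def C_def)
    qed
    note mom = gbm_residual_moments[OF s0 h, where \<mu> = \<mu> and \<sigma> = \<sigma>, folded s1 \<psi>_def v_def m_def]
    have lt: "s i < s (Suc i)" for i using s1 h by simp
    have "\<psi> \<in> borel_measurable borel" unfolding \<psi>_def[abs_def] by measurable
    note iso = sum_increments_second_moment[of s \<xi> \<psi> "m h" "v h" n, OF s0 lt xi(1,2) this mom]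
    have "0 \<le> v h + n * (m h)\<^sup>2"
    proof -
      have "v h = (\<integral>\<omega>. (\<psi> (W (s (Suc 0)) \<omega> - W (s 0) \<omega>))\<^sup>2 \<partial>M)" using mom(3) by simp
      also have "\<dots> \<ge> 0" by simp
      finally show ?thesis by simp
    qed
    moreover have "(\<Sum>i<n. \<integral>\<omega>. (\<xi> i \<omega>)\<^sup>2 \<partial>M) \<le> n * C"
      using sum_mono[of "{..<n}" "\<lambda>i. \<integral>\<omega>. (\<xi> i \<omega>)\<^sup>2 \<partial>M" "\<lambda>_. C"] xi(3) by simp
    ultimately have "2 * (v h + n * (m h)\<^sup>2) * (\<Sum>i<n. \<integral>\<omega>. (\<xi> i \<omega>)\<^sup>2 \<partial>M) \<le> 2 * (v h + n * (m h)\<^sup>2) * (n * C)"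
      by (intro mult_left_mono) auto
    with iso show ?thesis
      unfolding Z by (auto simp: h_def)
  qed
  show "integrable M (\<lambda>\<omega>. (?Z n \<omega>)\<^sup>2)" for n
  proof (cases "n = 0")
    case True
    have "integrable M (\<lambda>\<omega>. (gbm \<mu> \<sigma> q t \<omega> + (- q))\<^sup>2)"
      using gbm_second_moment(1)[of t \<mu> \<sigma> q] assms by (intro square_integrable_add) auto
    then show ?thesis using True by (simp add: power2_commute)
  qed (use bound[of n] in auto)
  \<comment> \<open>Both \<open>v h\<close> and \<open>m h\<close> are of order
    \<open>h\<^sup>2\<close>, so multiplication by the number of steps still leaves a null
    sequence.\<close>
  have l1: "(\<lambda>n. real n * v (t / real n)) \<longlonglongrightarrow> 0"
    unfolding v_def using \<open>0 < t\<close> by real_asymp (simp add: algebra_simps)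
  have l2: "(\<lambda>n. real n * m (t / real n)) \<longlonglongrightarrow> 0"
    unfolding m_def using \<open>0 < t\<close> by real_asymp
  have "(\<lambda>n. 2 * C * (real n * v (t / real n) + (real n * m (t / real n))\<^sup>2)) \<longlonglongrightarrow> 2 * C * (0 + 0\<^sup>2)"
    by (intro tendsto_intros l1 l2)
  then have lim: "(\<lambda>n. 2 * (v (t / real n) + n * (m (t / real n))\<^sup>2) * (n * C)) \<longlonglongrightarrow> 0"
    by (simp add: algebra_simps power2_eq_square)
  show "(\<lambda>n. \<integral>\<omega>. (?Z n \<omega>)\<^sup>2 \<partial>M) \<longlonglongrightarrow> 0"
  proof (rule tendsto_sandwich[OF _ _ tendsto_const lim])
    show "\<forall>\<^sub>F n in sequentially. (\<integral>\<omega>. (?Z n \<omega>)\<^sup>2 \<partial>M) \<le> 2 * (v (t / real n) + n * (m (t / real n))\<^sup>2) * (n * C)"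
      using eventually_gt_at_top[of 0] by eventually_elim (use bound in blast)
  qed simp
qed

end

subsection \<open>Uniqueness for the stochastic differential equation\<close>

lemma usual_conditionsD:
  assumes "usual_conditions M F"
  shows "prob_space M" "complete_measure M" "space (F t) = space M"
    and "s \<le> t \<Longrightarrow> sets (F s) \<subseteq> sets (F t)" "sets (F t) \<subseteq> sets M"
    and "N \<in> null_sets M \<Longrightarrow> N \<in> sets (F t)"
proof -
  show "prob_space M" "complete_measure M" "space (F t) = space M" "sets (F t) \<subseteq> sets M"
    and mono: "s \<le> t \<Longrightarrow> sets (F s) \<subseteq> sets (F t)" for s t
    using assms by (simp_all add: usual_conditions_def subalgebra_def filtration_def)
  have "null_sets M \<subseteq> sets (F 0)"
    using assms unfolding usual_conditions_def by blast
  then show "N \<in> null_sets M \<Longrightarrow> N \<in> sets (F t)"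
    using mono[of 0 t] by auto
qed

text \<open>Completeness makes every subset of the exceptional set a null set, and all null sets
  already belong to \<open>F 0\<close>. Hence modifying an adapted process on a null set keeps it
  adapted.\<close>

lemma measurable_AE_filtration:
  assumes uc: "usual_conditions M F"
    and f: "f \<in> measurable (F t) N" and ae: "AE \<omega> in M. f \<omega> = g \<omega>"
    and g: "g \<in> space M \<rightarrow> space N"
  shows "g \<in> measurable (F t) N"
proof (rule measurableI)
  note complete = usual_conditionsD(2)[OF uc] and [simp] = usual_conditionsD(3)[OF uc]
  let ?E = "{\<omega> \<in> space M. \<not> f \<omega> = g \<omega>}"
  have E: "?E \<in> null_sets M"
    using ae unfolding complete_measure.AE_iff_null_sets[OF complete] .
  fix A assume A: "A \<in> sets N"
  have "g -` A \<inter> ?E \<in> null_sets M"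
    by (rule complete_measure.complete2[OF complete _ E]) auto
  moreover have "f -` A \<inter> space (F t) \<in> sets (F t)"
    using f A by (rule measurable_sets)
  ultimately have "(f -` A \<inter> space (F t) - ?E) \<union> (g -` A \<inter> ?E) \<in> sets (F t)"
    using usual_conditionsD(6)[OF uc E, of t] usual_conditionsD(6)[OF uc, of "g -` A \<inter> ?E" t]
    by (simp only: sets.Un sets.Diff)
  also have "(f -` A \<inter> space (F t) - ?E) \<union> (g -` A \<inter> ?E) = g -` A \<inter> space (F t)"
  proof (rule set_eqI)
    fix x
    show "x \<in> (f -` A \<inter> space (F t) - ?E) \<union> (g -` A \<inter> ?E) \<longleftrightarrow> x \<in> g -` A \<inter> space (F t)"
      by (cases "f x = g x") auto
  qed
  finally show "g -` A \<inter> space (F t) \<in> sets (F t)" .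
next
  fix \<omega> assume "\<omega> \<in> space (F t)"
  then show "g \<omega> \<in> space N" using g usual_conditionsD(3)[OF uc] by auto
qed

text \<open>\<open>Z\<close> and a function of the increment generate subalgebras of the two
  independent sigma-algebras, so they are independent variables and their expectation
  factorises.\<close>

lemma brownian_motion_indep:
  fixes f :: "real \<Rightarrow> real" and Z :: "'a \<Rightarrow> real"
  assumes uc: "usual_conditions M F" and bm: "brownian_motion M F B"
    and st: "0 \<le> s" "s < t" and Z: "Z \<in> borel_measurable (F (ennreal s))" and f: "f \<in> borel_measurable borel"
    and iZ: "integrable M Z" and iB: "integrable M (\<lambda>\<omega>. f (B t \<omega> - B s \<omega>))"
  shows "integrable M (\<lambda>\<omega>. Z \<omega> * f (B t \<omega> - B s \<omega> :: real) :: real)"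
    and "(\<integral>\<omega>. Z \<omega> * f (B t \<omega> - B s \<omega>) \<partial>M) = (\<integral>\<omega>. Z \<omega> \<partial>M) * (\<integral>\<omega>. f (B t \<omega> - B s \<omega>) \<partial>M)"
proof -
  interpret prob_space M using uc by (rule usual_conditionsD)
  let ?D = "\<lambda>\<omega>. B t \<omega> - B s \<omega>"
  have ind: "indep_set (sets (F (ennreal s))) (sets (vimage_algebra (space M) ?D borel))"
    using bm st by (auto simp: brownian_motion_def)
  have "indep_var borel Z borel (\<lambda>\<omega>. f (?D \<omega>))"
    unfolding indep_var_eq
  proof (intro conjI)
    show "Z \<in> borel_measurable M" "(\<lambda>\<omega>. f (?D \<omega>)) \<in> borel_measurable M"
      using iZ iB by auto
    have 1: "sigma_sets (space M) {Z -` A \<inter> space M |A. A \<in> sets borel} \<subseteq> sets (F (ennreal s))"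
      using sets.sigma_sets_subset[of "{Z -` A \<inter> space M |A. A \<in> sets borel}" "F (ennreal s)"]
        measurable_sets[OF Z] by (force simp: usual_conditionsD(3)[OF uc])
    let ?V = "vimage_algebra (space M) ?D borel"
    have "?D \<in> measurable ?V borel" by (rule measurable_vimage_algebra1) simp
    then have "(\<lambda>\<omega>. f (?D \<omega>)) \<in> borel_measurable ?V" using f by measurable
    then have 2: "sigma_sets (space M) {(\<lambda>\<omega>. f (?D \<omega>)) -` A \<inter> space M |A. A \<in> sets borel} \<subseteq> sets ?V"
      using sets.sigma_sets_subset[of "{(\<lambda>\<omega>. f (?D \<omega>)) -` A \<inter> space M |A. A \<in> sets borel}" ?V]
      by (force dest: measurable_sets)
    show "indep_set (sigma_sets (space M) {Z -` A \<inter> space M |A. A \<in> sets borel})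
        (sigma_sets (space M) {(\<lambda>\<omega>. f (?D \<omega>)) -` A \<inter> space M |A. A \<in> sets borel})"
      using ind unfolding indep_set_def
      by (rule indep_sets_mono_sets) (use 1 2 in \<open>auto split: bool.split\<close>)
  qed
  then show "integrable M (\<lambda>\<omega>. Z \<omega> * f (B t \<omega> - B s \<omega> :: real) :: real)"
    and "(\<integral>\<omega>. Z \<omega> * f (B t \<omega> - B s \<omega>) \<partial>M) = (\<integral>\<omega>. Z \<omega> \<partial>M) * (\<integral>\<omega>. f (B t \<omega> - B s \<omega>) \<partial>M)"
    using iZ iB by (auto intro: indep_var_integrable indep_var_lebesgue_integral)
qed

text \<open>Replacing the paths that are discontinuous or start elsewhere by the zero path gives
  sure regularity. Adaptedness survives by the usual conditions, distribution and independence
  because they ignore null sets.\<close>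

lemma ex_brownian_space:
  assumes uc: "usual_conditions M F" and bm: "brownian_motion M F B"
  shows "\<exists>W. brownian_space M F W \<and> (AE \<omega> in M. \<forall>t\<ge>0. B t \<omega> = W t \<omega>)"
proof -
  define good where "good \<omega> \<longleftrightarrow> B 0 \<omega> = 0 \<and> continuous_on {0..} (\<lambda>t. B t \<omega>)" for \<omega>
  define W where "W t \<omega> = (if good \<omega> then B t \<omega> else 0)" for t \<omega>
  have "AE \<omega> in M. good \<omega>"
    using bm by (auto simp: brownian_motion_def good_def)
  then have ae: "AE \<omega> in M. \<forall>t. B t \<omega> = W t \<omega>"
    by (auto simp: W_def)
  have aet: "AE \<omega> in M. B t \<omega> = W t \<omega>" for t
    using ae by auto
  have BF: "B t \<in> borel_measurable (F (ennreal t))" if "0 \<le> t" for t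
    using bm that by (simp add: brownian_motion_def adapted_def)
  have WF: "W t \<in> borel_measurable (F (ennreal t))" if "0 \<le> t" for t
    by (rule measurable_AE_filtration[OF uc BF[OF that] aet]) simp
  have [measurable]: "B t \<in> borel_measurable M" "W t \<in> borel_measurable M" if "0 \<le> t" for t
    using BF[OF that] WF[OF that] usual_conditionsD(3,5)[OF uc, of "ennreal t"] by (auto simp: measurable_def)
  have "brownian_space M F W"
  proof
    show "usual_conditions M F" by fact
    show "adapted F W" using WF by (simp add: adapted_def)
    show "W 0 \<omega> = 0" for \<omega> by (simp add: W_def good_def)
    show "continuous_on {0..} (\<lambda>t. W t \<omega>)" for \<omega>
      by (cases "good \<omega>") (auto simp: W_def good_def)
    fix s t :: real assume st: "0 \<le> s" "s < t"
    have d: "AE \<omega> in M. B t \<omega> - B s \<omega> = W t \<omega> - W s \<omega>"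
      using ae by auto
    have [measurable]: "(\<lambda>\<omega>. B t \<omega> - B s \<omega>) \<in> borel_measurable M" "(\<lambda>\<omega>. W t \<omega> - W s \<omega>) \<in> borel_measurable M"
      using st by auto
    have "distr M lborel (\<lambda>\<omega>. B t \<omega> - B s \<omega>) = distr M lborel (\<lambda>\<omega>. W t \<omega> - W s \<omega>)"
      by (rule distr_cong_AE) (use d in auto)
    then show "distributed M lborel (\<lambda>\<omega>. W t \<omega> - W s \<omega>) (\<lambda>x. ennreal (normal_density 0 (sqrt (t - s)) x))"
      using bm st by (auto simp: brownian_motion_def distributed_def)
    fix Z :: "'a \<Rightarrow> real" and f :: "real \<Rightarrow> real"
    assume Z: "Z \<in> borel_measurable (F (ennreal s))" and f: "f \<in> borel_measurable borel"
      and iZ: "integrable M Z" and iW: "integrable M (\<lambda>\<omega>. f (W t \<omega> - W s \<omega>))"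
    have [measurable]: "Z \<in> borel_measurable M" "f \<in> borel_measurable borel" using iZ f by auto
    have df: "AE \<omega> in M. f (B t \<omega> - B s \<omega>) = f (W t \<omega> - W s \<omega>)"
      and dZ: "AE \<omega> in M. Z \<omega> * f (B t \<omega> - B s \<omega>) = Z \<omega> * f (W t \<omega> - W s \<omega>)"
      using d by auto
    have "integrable M (\<lambda>\<omega>. f (B t \<omega> - B s \<omega>))"
      using iW by (subst integrable_cong_AE[OF _ _ df]) auto
    note ind = brownian_motion_indep[OF uc bm st Z f iZ this]
    have "integrable M (\<lambda>\<omega>. Z \<omega> * f (W t \<omega> - W s \<omega>))"
      using ind(1) by (subst integrable_cong_AE[OF _ _ dZ, symmetric]) auto
    moreover have "(\<integral>\<omega>. Z \<omega> * f (W t \<omega> - W s \<omega>) \<partial>M) = (\<integral>\<omega>. Z \<omega> \<partial>M) * (\<integral>\<omega>. f (W t \<omega> - W s \<omega>) \<partial>M)"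
      using ind(2) integral_cong_AE[OF _ _ df] integral_cong_AE[OF _ _ dZ] by simp
    ultimately show "integrable M (\<lambda>\<omega>. Z \<omega> * f (W t \<omega> - W s \<omega>)) \<and>
      (\<integral>\<omega>. Z \<omega> * f (W t \<omega> - W s \<omega>) \<partial>M) = (\<integral>\<omega>. Z \<omega> \<partial>M) * (\<integral>\<omega>. f (W t \<omega> - W s \<omega>) \<partial>M)"
      by blast
  qed
  moreover have "AE \<omega> in M. \<forall>t\<ge>0. B t \<omega> = W t \<omega>"
    using ae by (rule AE_mp) (auto intro: AE_I2)
  ultimately show ?thesis by (intro exI[of _ W] conjI)
qed

context brownian_space
begin

text \<open>Localised second moments satisfy a Gronwall inequality, because the left-point sums of a
  bounded adapted integrand are controlled by the isometry.\<close>

lemma linear_sde_zero: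
  fixes D :: "real \<Rightarrow> 'a \<Rightarrow> real"
  assumes ad: "adapted F D" and cont: "\<And>\<omega>. continuous_on {0..} (\<lambda>t. D t \<omega>)" and D0: "\<And>\<omega>. D 0 \<omega> = 0"
    and sde: "\<And>t. 0 < t \<Longrightarrow> tends_prob_0 (\<lambda>n \<omega>. (\<Sum>i<n. D (t * real i / real n) \<omega> *
      (\<sigma> * (W (t * real (Suc i) / real n) \<omega> - W (t * real i / real n) \<omega>) + \<mu> * (t / real n))) - D t \<omega>)"
    and T: "0 < T"
  shows "AE \<omega> in M. D T \<omega> = 0"
proof -
  \<comment> \<open>Boundedness is required at rational times only, which makes the event measurable
    at time \<open>t\<close>; by continuity it bounds the whole path up to \<open>t\<close>.\<close>
  define G where "G K t \<omega> \<longleftrightarrow> (\<forall>r\<in>\<rat>. 0 \<le> r \<longrightarrow> r \<le> t \<longrightarrow> \<bar>D r \<omega>\<bar> \<le> real K)" for K t \<omega>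
  \<comment> \<open>The events shrink as \<open>t\<close> grows, so on \<open>G K t\<close> all
    earlier truncated values are the true ones. The truncation is thus compatible with left-point
    sums, and unlike \<open>D\<close> it is bounded.\<close>
  define \<xi> where "\<xi> K t \<omega> = D t \<omega> * indicator {\<omega> \<in> space M. G K t \<omega>} \<omega>" for K t \<omega>
  have DF: "D s \<in> borel_measurable (F (ennreal t))" if "0 \<le> s" "s \<le> t" for s t
    using ad measurable_F_mono[of "D s" "ennreal s" borel "ennreal t"] that by (simp add: adapted_def ennreal_leI)
  have DM: "D s \<in> borel_measurable M" if "0 \<le> s" for s
    using measurable_F_M[OF DF[of s s]] that by simp
  have GF: "{\<omega> \<in> space M. G K t \<omega>} \<in> sets (F (ennreal t))" for K t
  proof -
    have "Measurable.pred (F (ennreal t)) (\<lambda>\<omega>. \<forall>r\<in>{r \<in> \<rat>. 0 \<le> r \<and> r \<le> t}. \<bar>D r \<omega>\<bar> \<le> real K)"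
    proof (rule measurable_pred_countable)
      show "Measurable.pred (F (ennreal t)) (\<lambda>\<omega>. \<bar>D r \<omega>\<bar> \<le> real K)"
        if "r \<in> {r \<in> \<rat>. 0 \<le> r \<and> r \<le> t}" for r
      proof -
        have [measurable]: "D r \<in> borel_measurable (F (ennreal t))" using DF[of r t] that by simp
        show ?thesis by measurable
      qed
      show "countable {r \<in> \<rat>. 0 \<le> r \<and> r \<le> t}"
        using countable_rat by (rule countable_subset[rotated]) auto
    qed
    then have "{\<omega> \<in> space (F (ennreal t)). \<forall>r\<in>{r \<in> \<rat>. 0 \<le> r \<and> r \<le> t}. \<bar>D r \<omega>\<bar> \<le> real K} \<in> sets (F (ennreal t))"
      by (rule predE)
    then show ?thesis by (simp add: G_def Ball_def imp_conjL)
  qed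
  have xiF: "\<xi> K t \<in> borel_measurable (F (ennreal t))" if "0 \<le> t" for K t
    unfolding \<xi>_def[abs_def] using DF[of t t] GF[of K t] that by (intro borel_measurable_times borel_measurable_indicator) auto
  have bounded: "\<bar>D s \<omega>\<bar> \<le> real K" if "G K t \<omega>" "0 \<le> s" "s \<le> t" for K s t \<omega>
  proof -
    have "D s \<omega> \<in> {- real K..real K}"
    proof (rule continuous_on_rationals_closed[of t "\<lambda>s. D s \<omega>"])
      show "continuous_on {0..t} (\<lambda>s. D s \<omega>)"
        using cont by (rule continuous_on_subset) auto
    qed (use that in \<open>force simp: G_def abs_le_iff\<close>)+
    then show ?thesis by auto
  qed
  have xi_le: "(\<xi> K t \<omega>)\<^sup>2 \<le> (real K)\<^sup>2" if "0 \<le> t" for K t \<omega>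
    using bounded[of K t \<omega> t] that by (auto simp: \<xi>_def indicator_def abs_le_square_iff[symmetric])
  have xi2: "integrable M (\<lambda>\<omega>. (\<xi> K t \<omega>)\<^sup>2)" if "0 \<le> t" for K t
    using measurable_F_M[OF xiF[OF that]] xi_le[OF that]
    by (intro integrable_const_bound[where B = "(real K)\<^sup>2"]) auto
  define f where "f K t = (\<integral>\<omega>. (\<xi> K t \<omega>)\<^sup>2 \<partial>M)" for K t
  \<comment> \<open>One factor 2 comes from \<open>D\<^sup>2\<close> against the sum and the error,
    another from the second-moment bound. The drift term counts twice because
    \<open>(\<mu> * h)\<^sup>2\<close> is absorbed into
    \<open>n * (\<mu> * h)\<^sup>2\<close>.\<close>
  define c where "c = 4 * (\<sigma>\<^sup>2 + 2 * \<mu>\<^sup>2 * T)"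
  have c: "0 \<le> c" using T by (simp add: c_def)
  \<comment> \<open>One iteration: a bound of order \<open>s ^ k\<close> at all times improves to
    one of order \<open>t ^ Suc k / (k + 1)\<close>. No integral of \<open>f\<close> is formed,
    since left sums of powers suffice.\<close>
  have gronwall: "f K t \<le> c * (a * t ^ Suc k / (real k + 1))"
    if "0 < t" "t \<le> T" "0 \<le> a" and IH: "\<And>s. 0 \<le> s \<Longrightarrow> s \<le> T \<Longrightarrow> f K s \<le> a * s ^ k" for K t a k
  proof -
    define Z where "Z n \<omega> = (\<Sum>i<n. D (t * real i / real n) \<omega> *
      (\<sigma> * (W (t * real (Suc i) / real n) \<omega> - W (t * real i / real n) \<omega>) + \<mu> * (t / real n)))" for n \<omega>
    define p where "p e n = prob {\<omega> \<in> space M. e < \<bar>Z n \<omega> - D t \<omega>\<bar>}" for e n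
    have Zlim: "p e \<longlonglongrightarrow> 0" if "0 < e" for e
      using sde[OF \<open>0 < t\<close>] that by (simp add: tends_prob_0_def p_def[abs_def] Z_def)
    have Zm: "(\<lambda>\<omega>. Z n \<omega> - D t \<omega>) \<in> borel_measurable M" for n
      using sde[OF \<open>0 < t\<close>] by (simp add: tends_prob_0_def Z_def)
    have est: "f K t \<le> c * (a * t ^ Suc k / (real k + 1)) + 2 * e\<^sup>2 + (real K)\<^sup>2 * p e n" if n: "0 < n" and e: "0 < e" for n e
    proof -
      define h where "h = t / real n"
      have h: "0 < h" using n \<open>0 < t\<close> by (simp add: h_def)
      define s where "s i = t * real i / real n" for i
      have s0: "0 \<le> s i" and s1: "s (Suc i) = s i + h" for i
        using n \<open>0 < t\<close> by (auto simp: s_def h_def field_simps)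
      have lt: "s i < s (Suc i)" for i using s1 h by simp
      have st: "s i \<le> t" if "i < n" for i
        using that n \<open>0 < t\<close> by (auto simp: s_def field_simps)
      define S where "S \<omega> = (\<Sum>i<n. \<xi> K (s i) \<omega> * (\<sigma> * (W (s (Suc i)) \<omega> - W (s i) \<omega>) + \<mu> * h))" for \<omega>
      have mom: "integrable M (\<lambda>\<omega>. (\<sigma> * (W (s (Suc i)) \<omega> - W (s i) \<omega>) + \<mu> * h)\<^sup>2)"
          "(\<integral>\<omega>. \<sigma> * (W (s (Suc i)) \<omega> - W (s i) \<omega>) + \<mu> * h \<partial>M) = \<mu> * h"
          "(\<integral>\<omega>. (\<sigma> * (W (s (Suc i)) \<omega> - W (s i) \<omega>) + \<mu> * h)\<^sup>2 \<partial>M) = \<sigma>\<^sup>2 * h + (\<mu> * h)\<^sup>2" for i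
      proof -
        note m = increment_moments[OF s0 lt, of i]
        have e: "(\<sigma> * x + \<mu> * h)\<^sup>2 = \<sigma>\<^sup>2 * x\<^sup>2 + ((2 * \<sigma> * \<mu> * h) * x + (\<mu> * h)\<^sup>2)" for x
          by (simp add: power2_sum power_mult_distrib mult_ac)
        show "integrable M (\<lambda>\<omega>. (\<sigma> * (W (s (Suc i)) \<omega> - W (s i) \<omega>) + \<mu> * h)\<^sup>2)"
          unfolding e by (intro Bochner_Integration.integrable_add integrable_mult_right integrable_const m)
        show "(\<integral>\<omega>. \<sigma> * (W (s (Suc i)) \<omega> - W (s i) \<omega>) + \<mu> * h \<partial>M) = \<mu> * h"
          by (subst Bochner_Integration.integral_add) (use m in \<open>auto simp: prob_space simp del: right_diff_distrib' intro!: integrable_mult_right\<close>)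
        show "(\<integral>\<omega>. (\<sigma> * (W (s (Suc i)) \<omega> - W (s i) \<omega>) + \<mu> * h)\<^sup>2 \<partial>M) = \<sigma>\<^sup>2 * h + (\<mu> * h)\<^sup>2"
          unfolding e using m lt[of i] s1[of i]
          by (subst Bochner_Integration.integral_add, (intro Bochner_Integration.integrable_add integrable_mult_right integrable_const m)+,
              subst Bochner_Integration.integral_add, (intro Bochner_Integration.integrable_add integrable_mult_right integrable_const m)+)
             (simp add: prob_space)
      qed
      have iso: "integrable M (\<lambda>\<omega>. (S \<omega>)\<^sup>2)"
        "(\<integral>\<omega>. (S \<omega>)\<^sup>2 \<partial>M) \<le> 2 * (\<sigma>\<^sup>2 * h + (\<mu> * h)\<^sup>2 + n * (\<mu> * h)\<^sup>2) * (\<Sum>i<n. f K (s i))"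
        unfolding S_def f_def
        by (rule sum_increments_second_moment[of s "\<lambda>i. \<xi> K (s i)" "\<lambda>x. \<sigma> * x + \<mu> * h" "\<mu> * h" "\<sigma>\<^sup>2 * h + (\<mu> * h)\<^sup>2" n,
              OF s0 lt xiF[OF s0] xi2[OF s0] _ mom], measurable)+
      have v: "2 * (\<sigma>\<^sup>2 * h + (\<mu> * h)\<^sup>2 + n * (\<mu> * h)\<^sup>2) \<le> c / 2 * h"
      proof -
        have "(\<mu> * h)\<^sup>2 \<le> n * (\<mu> * h)\<^sup>2"
          using n mult_right_mono[of 1 "real n" "(\<mu> * h)\<^sup>2"] by simp
        moreover have "n * (\<mu> * h)\<^sup>2 = \<mu>\<^sup>2 * t * h"
          using n by (simp add: h_def power2_eq_square)
        moreover have "\<mu>\<^sup>2 * t * h \<le> \<mu>\<^sup>2 * T * h"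
          using \<open>t \<le> T\<close> h by (intro mult_right_mono mult_left_mono) auto
        moreover have "c / 2 * h = 2 * (\<sigma>\<^sup>2 * h) + 4 * (\<mu>\<^sup>2 * T * h)"
          by (simp add: c_def algebra_simps)
        moreover have "2 * (S + A + B) \<le> E" if "A \<le> B" "B = C" "C \<le> D'" "E = 2 * S + 4 * D'" for A B C D' E S :: real
          using that by simp
        ultimately show ?thesis by blast
      qed
      have "(\<Sum>i<n. f K (s i)) \<le> (\<Sum>i<n. a * s i ^ k)"
        by (intro sum_mono IH s0 order_trans[OF st \<open>t \<le> T\<close>]) simp
      then have "c / 2 * h * (\<Sum>i<n. f K (s i)) \<le> c / 2 * h * (\<Sum>i<n. a * s i ^ k)"
        using c h by (intro mult_left_mono) auto
      also have "\<dots> = c / 2 * (a * (\<Sum>i<n. s i ^ k * h))"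
        by (simp add: sum_distrib_left mult_ac)
      also have "\<dots> \<le> c / 2 * (a * (t ^ Suc k / (real k + 1)))"
        using left_sum_power_le[OF \<open>0 < t\<close>, of n k] c \<open>0 \<le> a\<close>
        by (intro mult_left_mono) (auto simp: s_def h_def)
      finally have 1: "c / 2 * h * (\<Sum>i<n. f K (s i)) \<le> c / 2 * (a * (t ^ Suc k / (real k + 1)))" .
      have "0 \<le> (\<Sum>i<n. f K (s i))" by (auto simp: f_def intro!: sum_nonneg)
      from mult_right_mono[OF v this] iso(2) 1
      have S2: "(\<integral>\<omega>. (S \<omega>)\<^sup>2 \<partial>M) \<le> c / 2 * (a * (t ^ Suc k / (real k + 1)))" by linarith
      let ?B = "{\<omega> \<in> space M. e < \<bar>Z n \<omega> - D t \<omega>\<bar>}"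
      have B: "?B \<in> sets M" using Zm by measurable
      have iB: "integrable M (indicator ?B :: 'a \<Rightarrow> real)"
        by (rule integrable_const_bound[where B = 1]) (use B in \<open>auto intro: borel_measurable_indicator\<close>)
      have pt: "(\<xi> K t \<omega>)\<^sup>2 \<le> 2 * (S \<omega>)\<^sup>2 + 2 * e\<^sup>2 + (real K)\<^sup>2 * indicator ?B \<omega>" if "\<omega> \<in> space M" for \<omega>
      \<comment> \<open>Off \<open>G K t\<close> the truncated value is 0, and on \<open>?B\<close>
        it is paid for by the indicator term. In the remaining case the truncated sum is the true
        one and lies within \<open>e\<close> of \<open>D t\<close>.\<close>
      proof (cases "G K t \<omega> \<and> \<omega> \<notin> ?B")
        case True
        have "\<xi> K (s i) \<omega> = D (s i) \<omega>" if "i < n" for i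
          using True \<open>\<omega> \<in> space M\<close> st[OF that] by (auto simp: \<xi>_def G_def)
        then have "S \<omega> = Z n \<omega>"
          unfolding S_def Z_def by (intro sum.cong) (auto simp: s_def h_def)
        then have d: "\<bar>S \<omega> - D t \<omega>\<bar> \<le> e"
          using True \<open>\<omega> \<in> space M\<close> by auto
        have "(D t \<omega>)\<^sup>2 \<le> 2 * (S \<omega>)\<^sup>2 + 2 * (S \<omega> - D t \<omega>)\<^sup>2"
          using zero_le_power2[of "2 * S \<omega> - D t \<omega>"] by (simp add: power2_diff power_mult_distrib)
        moreover have "(S \<omega> - D t \<omega>)\<^sup>2 \<le> e\<^sup>2"
          using d e by (simp add: abs_le_square_iff[symmetric])
        ultimately have "(D t \<omega>)\<^sup>2 \<le> 2 * (S \<omega>)\<^sup>2 + 2 * e\<^sup>2" by linarith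
        then show ?thesis
          using True \<open>\<omega> \<in> space M\<close> by (auto simp: \<xi>_def)
      next
        case False
        then show ?thesis
          using xi_le[of t K \<omega>] \<open>0 < t\<close> that by (auto simp: \<xi>_def indicator_def intro: add_increasing)
      qed
      have i: "integrable M (\<lambda>\<omega>. 2 * (S \<omega>)\<^sup>2 + 2 * e\<^sup>2 + (real K)\<^sup>2 * indicator ?B \<omega>)"
        using iso(1) iB by (intro Bochner_Integration.integrable_add integrable_mult_right) auto
      have "f K t \<le> (\<integral>\<omega>. 2 * (S \<omega>)\<^sup>2 + 2 * e\<^sup>2 + (real K)\<^sup>2 * indicator ?B \<omega> \<partial>M)"
        unfolding f_def using pt xi2[of t K] \<open>0 < t\<close> by (intro integral_mono i) auto
      also have "\<dots> = 2 * (\<integral>\<omega>. (S \<omega>)\<^sup>2 \<partial>M) + 2 * e\<^sup>2 + (real K)\<^sup>2 * p e n"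
        using iso(1) B iB by (simp add: prob_space p_def)
      also have "\<dots> \<le> c * (a * t ^ Suc k / (real k + 1)) + 2 * e\<^sup>2 + (real K)\<^sup>2 * p e n"
      proof -
        have "2 * x \<le> c * q" if "x \<le> c / 2 * q" for x q :: real
          using that by simp
        from this[OF S2] show ?thesis unfolding times_divide_eq_right by (intro add_right_mono)
      qed
      finally show ?thesis .
    qed
    \<comment> \<open>Refining the grid at a fixed tolerance removes the exceptional probability;
      only afterwards is the tolerance sent to 0.\<close>
    have est2: "f K t \<le> c * (a * t ^ Suc k / (real k + 1)) + 2 * e\<^sup>2" if e: "0 < e" for e
    proof (rule tendsto_lowerbound)
      show "(\<lambda>n. c * (a * t ^ Suc k / (real k + 1)) + 2 * e\<^sup>2 + (real K)\<^sup>2 * p e n) \<longlonglongrightarrow> c * (a * t ^ Suc k / (real k + 1)) + 2 * e\<^sup>2"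
        using tendsto_add[OF tendsto_const tendsto_mult[OF tendsto_const Zlim[OF e]]] by fastforce
      show "\<forall>\<^sub>F n in sequentially. f K t \<le> c * (a * t ^ Suc k / (real k + 1)) + 2 * e\<^sup>2 + (real K)\<^sup>2 * p e n"
        using eventually_gt_at_top[of 0] by eventually_elim (use est e in auto)
    qed simp
    show ?thesis
    proof (rule field_le_epsilon)
      fix e :: real assume "0 < e"
      then show "f K t \<le> c * (a * t ^ Suc k / (real k + 1)) + e"
        using est2[of "sqrt (e / 2)"] by simp
    qed
  qed
  have f0: "f K 0 = 0" for K
    by (simp add: f_def \<xi>_def D0)
  have iter: "f K t \<le> (real K)\<^sup>2 * c ^ k / fact k * t ^ k" if "0 \<le> t" "t \<le> T" for K k t
    using that
  proof (induction k arbitrary: t)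
    case 0
    have "f K t \<le> (\<integral>\<omega>. (real K)\<^sup>2 \<partial>M)"
      unfolding f_def using 0 by (intro integral_mono xi2 xi_le) auto
    then show ?case by (simp add: prob_space)
  next
    case (Suc k)
    show ?case
    proof (cases "t = 0")
      case False
      then have "f K t \<le> c * ((real K)\<^sup>2 * c ^ k / fact k * t ^ Suc k / (real k + 1))"
        using Suc c by (intro gronwall) auto
      also have "\<dots> = (real K)\<^sup>2 * c ^ Suc k / fact (Suc k) * t ^ Suc k"
        by (simp add: field_simps)
      finally show ?thesis .
    qed (simp add: f0)
  qed
  have fT: "f K T = 0" for K
  proof -
    \<comment> \<open>The iterated bounds are multiples of the terms of the exponential series of
      \<open>c * T\<close>, hence vanish in the limit.\<close>
    have "(\<lambda>k. (c * T) ^ k / fact k) \<longlonglongrightarrow> 0"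
      using summable_LIMSEQ_zero[OF summable_exp[of "c * T"]] by (simp add: divide_inverse mult.commute)
    then have "(\<lambda>k. (real K)\<^sup>2 * ((c * T) ^ k / fact k)) \<longlonglongrightarrow> 0"
      using tendsto_mult_right_zero by blast
    moreover have "f K T \<le> (real K)\<^sup>2 * ((c * T) ^ k / fact k)" for k
      using iter[of T K k] T by (simp add: power_mult_distrib mult_ac)
    ultimately have "f K T \<le> 0"
      by (intro LIMSEQ_le_const) auto
    then show ?thesis
      by (simp add: f_def order.antisym)
  qed
  have "AE \<omega> in M. \<forall>K. \<xi> K T \<omega> = 0"
    unfolding AE_all_countable
  proof
    fix K
    have "AE \<omega> in M. (\<xi> K T \<omega>)\<^sup>2 = 0"
      using fT[of K] xi2[of T K] T by (subst integral_nonneg_eq_0_iff_AE[symmetric]) (auto simp: f_def)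
    then show "AE \<omega> in M. \<xi> K T \<omega> = 0" by simp
  qed
  then show ?thesis
  proof (rule AE_mp, intro AE_I2 impI)
    fix \<omega> assume \<omega>: "\<omega> \<in> space M" "\<forall>K. \<xi> K T \<omega> = 0"
    \<comment> \<open>A continuous path is bounded on the compact interval, so it survives the
      truncation at some level \<open>K\<close>.\<close>
    have "compact ((\<lambda>t. D t \<omega>) ` {0..T})"
      by (intro compact_continuous_image continuous_on_subset[OF cont]) auto
    then obtain b where b: "\<And>t. t \<in> {0..T} \<Longrightarrow> \<bar>D t \<omega>\<bar> \<le> b"
      using compact_imp_bounded bounded_iff by (metis (no_types, lifting) image_eqI real_norm_def)
    obtain K where "b \<le> real K" using real_arch_simple by blast
    with b have "G K T \<omega>" by (force simp: G_def)
    then show "D T \<omega> = 0" using \<omega>(1) \<omega>(2)[rule_format, of K] by (simp add: \<xi>_def)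
  qed
qed

text \<open>The difference of the price and the exponential satisfies the homogeneous equation with
  initial value 0, so it vanishes at each time almost surely; rational times and continuity make
  this hold for all times at once.\<close>

lemma gbm_unique:
  assumes B: "adapted F B" and BW: "AE \<omega> in M. \<forall>t\<ge>0. B t \<omega> = W t \<omega>"
    and gbm: "geometric_brownian_motion M F B \<mu> \<sigma> q P" and \<mu>: "0 \<le> \<mu>"
  shows "AE \<omega> in M. \<forall>t\<ge>0. P t \<omega> = gbm \<mu> \<sigma> q t \<omega>"
proof -
  let ?X = "gbm \<mu> \<sigma> q"
  define good where "good \<omega> \<longleftrightarrow> P 0 \<omega> = q \<and> continuous_on {0..} (\<lambda>t. P t \<omega>)" for \<omega>
  define D where "D t \<omega> = (if good \<omega> then P t \<omega> - ?X t \<omega> else 0)" for t \<omega>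
  have good: "AE \<omega> in M. good \<omega>"
    using gbm by (auto simp: geometric_brownian_motion_def good_def)
  then have ae: "AE \<omega> in M. \<forall>t. P t \<omega> - ?X t \<omega> = D t \<omega>"
    by (auto simp: D_def)
  have PF: "P t \<in> borel_measurable (F (ennreal t))" if "0 \<le> t" for t
    using gbm that by (simp add: geometric_brownian_motion_def adapted_def)
  have DF: "D t \<in> borel_measurable (F (ennreal t))" if "0 \<le> t" for t
  proof (rule measurable_AE_filtration[OF usual])
    show "(\<lambda>\<omega>. P t \<omega> - ?X t \<omega>) \<in> borel_measurable (F (ennreal t))"
      using PF[OF that] gbm_measurable_F[OF that order_refl] by (rule borel_measurable_diff)
    show "AE \<omega> in M. P t \<omega> - ?X t \<omega> = D t \<omega>" using ae by auto
  qed simp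
  have PM: "P t \<in> borel_measurable M" and DM: "D t \<in> borel_measurable M"
    and BM: "B t \<in> borel_measurable M" if "0 \<le> t" for t
    using measurable_F_M[OF PF[OF that]] measurable_F_M[OF DF[OF that]] B that measurable_F_M
    by (auto simp: adapted_def)
  have cont: "continuous_on {0..} (\<lambda>t. D t \<omega>)" for \<omega>
    by (cases "good \<omega>") (auto simp: D_def good_def intro!: continuous_intros gbm_cont)
  have D0: "D 0 \<omega> = 0" for \<omega>
    by (simp add: D_def good_def gbm_def)
  have zero: "AE \<omega> in M. D t \<omega> = 0" if t: "0 < t" for t
  proof (rule linear_sde_zero[OF _ cont D0 _ t])
    show "adapted F D" using DF by (simp add: adapted_def)
    fix t :: real assume t: "0 < t"
    define A where "A \<omega> = (LINT s:{0..t}|lborel. \<mu> * P s \<omega>)" for \<omega>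
    define s where "s n i = t * real i / real n" for n i
    have s: "0 \<le> s n i" for n i using t by (simp add: s_def)
    note [measurable] = PM[OF s] DM[OF s] BM[OF s] W_measurable[OF s] gbm_measurable[OF s]
      PM[OF less_imp_le[OF t]] DM[OF less_imp_le[OF t]] gbm_measurable[OF less_imp_le[OF t]]
    have ito: "has_ito_integral M B (\<lambda>s \<omega>. \<sigma> * P s \<omega>) t (\<lambda>\<omega>. P t \<omega> - q - A \<omega>)"
      using gbm t by (simp add: geometric_brownian_motion_def A_def)
    \<comment> \<open>Measurability of the pathwise drift integral is read off from the stochastic
      integral, which is measurable by definition and differs from it by
      \<open>P t - q\<close>.\<close>
    have Am[measurable]: "A \<in> borel_measurable M"
    proof -
      have [measurable]: "(\<lambda>\<omega>. P t \<omega> - q - A \<omega>) \<in> borel_measurable M"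
        using ito unfolding has_ito_integral_def by blast
      have "(\<lambda>\<omega>. P t \<omega> - q - (P t \<omega> - q - A \<omega>)) \<in> borel_measurable M"
        by measurable
      then show ?thesis by simp
    qed
    have 1: "tends_prob_0 (\<lambda>n \<omega>. (\<Sum>i<n. \<sigma> * P (s n i) \<omega> * (B (s n (Suc i)) \<omega> - B (s n i) \<omega>)) - (P t \<omega> - q - A \<omega>))"
      using ito unfolding has_ito_integral_def tends_prob_0_def s_def[symmetric] by simp
    have 2: "tends_prob_0 (\<lambda>n \<omega>. (\<Sum>i<n. \<mu> * P (s n i) \<omega> * (t / real n)) - A \<omega>)"
    proof (rule tends_prob_0_AE)
      show "AE \<omega> in M. (\<lambda>n. (\<Sum>i<n. \<mu> * P (s n i) \<omega> * (t / real n)) - A \<omega>) \<longlonglongrightarrow> 0"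
        using good
      proof eventually_elim
        case (elim \<omega>)
        then have "continuous_on {0..t} (\<lambda>s. \<mu> * P s \<omega>)"
          by (auto simp: good_def intro!: continuous_intros elim: continuous_on_subset)
        from left_riemann_sum_tendsto[OF this t] show ?case
          unfolding A_def s_def by (rule LIM_zero)
      qed
    qed measurable
    have 3: "tends_prob_0 (\<lambda>n \<omega>. (\<Sum>i<n. ?X (s n i) \<omega> * (\<sigma> * (W (s n (Suc i)) \<omega> - W (s n i) \<omega>) + \<mu> * (t / real n)))
        - (?X t \<omega> - q))"
      unfolding s_def by (rule gbm_euler_sum[OF t \<mu>])
    show "tends_prob_0 (\<lambda>n \<omega>. (\<Sum>i<n. D (t * real i / real n) \<omega> *
      (\<sigma> * (W (t * real (Suc i) / real n) \<omega> - W (t * real i / real n) \<omega>) + \<mu> * (t / real n))) - D t \<omega>)"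
      unfolding s_def[symmetric]
    \<comment> \<open>In this combination the drift integral \<open>A\<close> cancels between the
      first two limits and the initial value \<open>q\<close> between the first and the
      third.\<close>
    proof (rule tends_prob_0_cong_AE[OF tends_prob_0_add[OF tends_prob_0_add[OF 1 2] tends_prob_0_minus[OF 3]]])
      fix n
      show "AE \<omega> in M. (\<Sum>i<n. \<sigma> * P (s n i) \<omega> * (B (s n (Suc i)) \<omega> - B (s n i) \<omega>)) - (P t \<omega> - q - A \<omega>)
          + ((\<Sum>i<n. \<mu> * P (s n i) \<omega> * (t / real n)) - A \<omega>)
          + - ((\<Sum>i<n. ?X (s n i) \<omega> * (\<sigma> * (W (s n (Suc i)) \<omega> - W (s n i) \<omega>) + \<mu> * (t / real n))) - (?X t \<omega> - q))
          = (\<Sum>i<n. D (s n i) \<omega> * (\<sigma> * (W (s n (Suc i)) \<omega> - W (s n i) \<omega>) + \<mu> * (t / real n))) - D t \<omega>"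
        using BW ae
      proof eventually_elim
        case (elim \<omega>)
        have D: "D u \<omega> = P u \<omega> - ?X u \<omega>" for u using elim by simp
        have Bs: "B (s n i) \<omega> = W (s n i) \<omega>" for i using elim s by simp
        show ?case
          unfolding D Bs by (simp add: algebra_simps sum.distrib sum_subtractf)
      qed
    qed measurable
  qed
  have "AE \<omega> in M. \<forall>r\<in>{r \<in> \<rat>. 0 \<le> r}. D r \<omega> = 0"
  proof (subst AE_ball_countable)
    show "countable {r \<in> \<rat> :: real set. 0 \<le> r}"
      using countable_rat by (rule countable_subset[rotated]) auto
    show "\<forall>r\<in>{r \<in> \<rat>. 0 \<le> r}. AE \<omega> in M. D r \<omega> = 0"
      using zero D0 by (auto simp: order.order_iff_strict)
  qed
  then show ?thesis
    using ae
  proof eventually_elim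
    case (elim \<omega>)
    have "D t \<omega> = 0" if "0 \<le> t" for t
    proof -
      have "D t \<omega> \<in> {0}"
      proof (rule continuous_on_rationals_closed[of t "\<lambda>s. D s \<omega>"])
        show "continuous_on {0..t} (\<lambda>s. D s \<omega>)"
          using cont by (rule continuous_on_subset) auto
      qed (use that elim in auto)
      then show ?thesis by simp
    qed
    then show ?case using elim(2) by (metis eq_iff_diff_eq_0)
  qed
qed

end

subsection \<open>Affine majorants\<close>

text \<open>The nonnegative slope is what allows a majorant to be integrated against a
  supermartingale, and the nonnegative intercept gives the scaling bound for the envelope.\<close>

definition affine_majorants :: "(real \<Rightarrow> real) \<Rightarrow> (real \<times> real) set" where
  "affine_majorants g = {(m, n). 0 \<le> m \<and> 0 \<le> n \<and> (\<forall>u\<ge>0. g u \<le> m * u + n)}"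

text \<open>A concave majorant, given directly as an infimum of lines: the expected reward is then
  bounded line by line, and no Jensen inequality is needed.\<close>

definition envelope :: "(real \<Rightarrow> real) \<Rightarrow> real \<Rightarrow> real" where
  "envelope g s = (INF (m, n) \<in> affine_majorants g. m * s + n)"

locale majorized =
  fixes g :: "real \<Rightarrow> real"
  assumes g_nonneg: "\<And>u. 0 \<le> u \<Longrightarrow> 0 \<le> g u"
    and g_cont: "continuous_on {0..} g"
    and g_0: "g 0 = 0"
    and g_maj: "affine_majorants g \<noteq> {}"
begin

lemma majorant_le: "(m, n) \<in> affine_majorants g \<Longrightarrow> 0 \<le> u \<Longrightarrow> g u \<le> m * u + n"
  by (auto simp: affine_majorants_def)

lemma bdd_below_majorants: "0 \<le> s \<Longrightarrow> bdd_below ((\<lambda>(m, n). m * s + n) ` affine_majorants g)"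
  by (rule bdd_belowI[of _ 0]) (auto simp: affine_majorants_def)

lemma envelope_le: "(m, n) \<in> affine_majorants g \<Longrightarrow> 0 \<le> s \<Longrightarrow> envelope g s \<le> m * s + n"
  unfolding envelope_def by (rule cINF_lower2[OF bdd_below_majorants]) auto

lemma envelope_greatest:
  "(\<And>m n. (m, n) \<in> affine_majorants g \<Longrightarrow> z \<le> m * s + n) \<Longrightarrow> z \<le> envelope g s"
  unfolding envelope_def using g_maj by (intro cINF_greatest) auto

lemma le_envelope: "0 \<le> s \<Longrightarrow> g s \<le> envelope g s"
  by (rule envelope_greatest) (rule majorant_le)

lemma envelope_nonneg: "0 \<le> s \<Longrightarrow> 0 \<le> envelope g s"
  using le_envelope g_nonneg order_trans by blast

text \<open>Only lines not exceeding a known majorant at \<open>s\<close> compete. As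
  \<open>s > 0\<close> and both coefficients are nonnegative, these form a compact set of
  parameters, on which the value at \<open>s\<close> is continuous.\<close>

lemma envelope_attained:
  assumes s: "0 < s"
  obtains m n where "(m, n) \<in> affine_majorants g" "envelope g s = m * s + n"
proof -
  obtain m0 n0 where mn0: "(m0, n0) \<in> affine_majorants g" using g_maj by auto
  define b where "b = m0 * s + n0"
  define S where "S = affine_majorants g \<inter> {(m, n). m * s + n \<le> b}"
  have maj_eq: "affine_majorants g = {x. 0 \<le> fst x} \<inter> {x. 0 \<le> snd x} \<inter> (\<Inter>u\<in>{0..}. {x. g u \<le> fst x * u + snd x})"
    by (auto simp: affine_majorants_def)
  have "closed (affine_majorants g)"
    unfolding maj_eq by (intro closed_Int closed_INT ballI closed_Collect_le continuous_intros)
  moreover have "{(m, n). m * s + n \<le> b} = {x. fst x * s + snd x \<le> b}"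
    by auto
  then have "closed {(m, n). m * s + n \<le> b}"
    by (auto intro!: closed_Collect_le continuous_intros)
  ultimately have cl: "closed S" unfolding S_def by (rule closed_Int)
  have "S \<subseteq> {0..b / s} \<times> {0..b}"
  proof safe
    fix m n assume mn: "(m, n) \<in> S"
    then have nn: "0 \<le> m" "0 \<le> n" "m * s + n \<le> b" by (auto simp: S_def affine_majorants_def)
    moreover have "0 \<le> m * s" using nn s by simp
    ultimately have "m * s \<le> b" "n \<le> b" by linarith+
    then show "m \<in> {0..b / s}" "n \<in> {0..b}" using nn s by (auto simp: field_simps)
  qed
  then have "bounded S"
    by (rule bounded_subset[rotated]) (intro bounded_Times; simp)
  with cl have "compact S" by (simp add: compact_eq_bounded_closed)
  moreover have "S \<noteq> {}" using mn0 by (auto simp: S_def b_def)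
  moreover have "continuous_on S (\<lambda>x. fst x * s + snd x)" by (intro continuous_intros)
  ultimately obtain x where x: "x \<in> S" "\<forall>y\<in>S. fst x * s + snd x \<le> fst y * s + snd y"
    using continuous_attains_inf by blast
  obtain m n where mn: "x = (m, n)" by force
  have "m * s + n \<le> m' * s + n'" if "(m', n') \<in> affine_majorants g" for m' n'
  proof (cases "m' * s + n' \<le> b")
    case True
    then show ?thesis using x(2) that mn by (force simp: S_def)
  next
    case False
    then show ?thesis using x(1) mn by (auto simp: S_def)
  qed
  then have "m * s + n \<le> envelope g s" by (rule envelope_greatest)
  moreover have "(m, n) \<in> affine_majorants g" using x(1) mn by (auto simp: S_def)
  ultimately show thesis using envelope_le[of m n s] s by (intro that[of m n]) auto
qed

lemma envelope_mono:
  assumes "0 \<le> s" "s \<le> t" shows "envelope g s \<le> envelope g t"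
proof (rule envelope_greatest)
  fix m n assume mn: "(m, n) \<in> affine_majorants g"
  then have "m * s \<le> m * t" using assms by (intro mult_left_mono) (auto simp: affine_majorants_def)
  then show "envelope g s \<le> m * t + n"
    using envelope_le[OF mn \<open>0 \<le> s\<close>] by linarith
qed

text \<open>Because intercepts are nonnegative, the value of a line divided by its argument is
  nonincreasing, and the envelope inherits this.\<close>

lemma envelope_scale:
  assumes "0 < s" "s \<le> t" shows "envelope g t \<le> t / s * envelope g s"
proof -
  obtain m n where mn: "(m, n) \<in> affine_majorants g" "envelope g s = m * s + n"
    using envelope_attained assms by blast
  have "n * 1 \<le> n * (t / s)"
    using mn assms by (intro mult_left_mono) (auto simp: affine_majorants_def)
  then have "m * t + n \<le> t / s * (m * s + n)"
    using assms by (simp add: field_simps)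
  then show ?thesis using envelope_le[OF mn(1), of t] assms mn(2) by simp
qed

text \<open>Monotonicity of the envelope and of its quotient by the argument squeeze it between the
  values at \<open>s\<close> scaled by \<open>min 1 (t / s)\<close> and
  \<open>max 1 (t / s)\<close>.\<close>

lemma envelope_cont: "continuous_on {0<..} (envelope g)"
proof (rule continuous_at_imp_continuous_on, rule ballI)
  fix s :: real assume "s \<in> {0<..}"
  then have s: "0 < s" by simp
  have ev: "\<forall>\<^sub>F t in at s. 0 < t"
    using s order_tendstoD(1)[OF tendsto_ident_at] by blast
  have "(\<lambda>t. min 1 (t / s) * envelope g s) \<midarrow>s\<rightarrow> min 1 (s / s) * envelope g s"
    "(\<lambda>t. max 1 (t / s) * envelope g s) \<midarrow>s\<rightarrow> max 1 (s / s) * envelope g s"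
    using s by (intro tendsto_intros; simp)+
  then have lim: "(\<lambda>t. min 1 (t / s) * envelope g s) \<midarrow>s\<rightarrow> envelope g s"
    "(\<lambda>t. max 1 (t / s) * envelope g s) \<midarrow>s\<rightarrow> envelope g s"
    using s by auto
  have "min 1 (t / s) * envelope g s \<le> envelope g t \<and> envelope g t \<le> max 1 (t / s) * envelope g s" if t: "0 < t" for t
  proof (cases "s \<le> t")
    case True
    then have "1 \<le> t / s" using s by simp
    then show ?thesis
      using True envelope_mono[of s t] envelope_scale[of s t] s by simp
  next
    case False
    then have 1: "t / s \<le> 1" using s by simp
    have "t / s * envelope g s \<le> t / s * (s / t * envelope g t)"
      using False envelope_scale[of t s] t s by (intro mult_left_mono) auto
    then show ?thesis
      using 1 False envelope_mono[of t s] t s by simp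
  qed
  then have "\<forall>\<^sub>F t in at s. min 1 (t / s) * envelope g s \<le> envelope g t"
    "\<forall>\<^sub>F t in at s. envelope g t \<le> max 1 (t / s) * envelope g s"
    using ev by (auto elim: eventually_mono)
  from tendsto_sandwich[OF this lim] show "isCont (envelope g) s"
    by (simp add: isCont_def)
qed

text \<open>A minimal majorant with value 0 at a positive point is the zero line. This isolates the
  degenerate case in which entering never has a positive gain.\<close>

lemma envelope_zero:
  assumes "0 < s" "envelope g s = 0" "0 \<le> t"
  shows "envelope g t = 0"
proof -
  obtain m n where mn: "(m, n) \<in> affine_majorants g" "envelope g s = m * s + n"
    using envelope_attained assms by blast
  moreover have "0 \<le> m * s" "0 \<le> n" "0 \<le> m" using mn assms by (auto simp: affine_majorants_def)
  ultimately have "m * s = 0" "n = 0" using assms by linarith+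
  then have "m = 0" "n = 0" using assms by auto
  then have "envelope g t \<le> 0" using envelope_le[OF mn(1)] assms by auto
  then show ?thesis using envelope_nonneg[OF assms(3)] by simp
qed

text \<open>A competing line lies above both contact points, hence above the chord between them. If
  the slope is 0, the left contact alone suffices because competitors do not decrease.\<close>

lemma envelope_affine:
  assumes mn: "(m, n) \<in> affine_majorants g" and a: "0 \<le> a" "g a = m * a + n" and s: "a \<le> s"
    and b: "m = 0 \<or> (\<exists>b\<ge>s. g b = m * b + n)"
  shows "envelope g s = m * s + n"
proof (rule antisym)
  show "envelope g s \<le> m * s + n" using mn a s by (intro envelope_le) auto
  show "m * s + n \<le> envelope g s"
  proof (rule envelope_greatest)
    fix m' n' assume mn': "(m', n') \<in> affine_majorants g"
    then have m'0: "0 \<le> m'" by (auto simp: affine_majorants_def)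
    have A: "m * a + n \<le> m' * a + n'" using majorant_le[OF mn' a(1)] a by simp
    show "m * s + n \<le> m' * s + n'"
    proof (cases "m \<le> m'")
      case True
      then have "(m' - m) * a \<le> (m' - m) * s" using s by (intro mult_left_mono) auto
      then show ?thesis using A by (simp add: algebra_simps)
    next
      case False
      then obtain b where b: "s \<le> b" "g b = m * b + n" using b m'0 by auto
      have B: "m * b + n \<le> m' * b + n'" using majorant_le[OF mn', of b] a s b by simp
      have "(m - m') * s \<le> (m - m') * b" using False b by (intro mult_left_mono) auto
      then show ?thesis using B by (simp add: algebra_simps)
    qed
  qed
qed

lemma positive_gap:
  assumes "0 \<le> a" "a \<le> b" and d: "\<And>u. a \<le> u \<Longrightarrow> u \<le> b \<Longrightarrow> g u < m * u + n"
  obtains \<delta> where "0 < \<delta>" "\<And>u. a \<le> u \<Longrightarrow> u \<le> b \<Longrightarrow> g u + \<delta> \<le> m * u + n"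
proof -
  have "continuous_on {a..b} (\<lambda>u. m * u + n - g u)"
    using assms by (intro continuous_intros continuous_on_subset[OF g_cont]) auto
  then obtain v where v: "v \<in> {a..b}" "\<forall>u\<in>{a..b}. m * v + n - g v \<le> m * u + n - g u"
    using continuous_attains_inf[of "{a..b}" "\<lambda>u. m * u + n - g u"] assms by auto
  show thesis
    by (rule that[of "m * v + n - g v"]) (use v d[of v] in force)+
qed

lemma gap_neighbourhood:
  assumes "0 < s" "g s < m * s + n"
  obtains r where "0 < r" "r < s" "\<And>u. s - r \<le> u \<Longrightarrow> u \<le> s + r \<Longrightarrow> g u < m * u + n"
proof -
  have "continuous_on {0..} (\<lambda>u. m * u + n - g u)"
    by (intro continuous_intros g_cont)
  then have "continuous (at s within {0..}) (\<lambda>u. m * u + n - g u)"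
    using assms by (simp add: continuous_on_eq_continuous_within)
  moreover have "0 < m * s + n - g s" using assms by simp
  ultimately obtain r where r: "0 < r" "\<And>u. u \<in> {0..} \<Longrightarrow> dist u s < r \<Longrightarrow> dist (m * u + n - g u) (m * s + n - g s) < m * s + n - g s"
    unfolding continuous_within_eps_delta by blast
  show thesis
  proof (rule that[of "min (r / 2) (s / 2)"])
    fix u assume u: "s - min (r / 2) (s / 2) \<le> u" "u \<le> s + min (r / 2) (s / 2)"
    then have "u \<in> {0..}" "dist u s < r" using assms r(1) by (auto simp: dist_real_def min_def split: if_splits)
    from r(2)[OF this] show "g u < m * u + n" by (auto simp: dist_real_def)
  qed (use r(1) assms in auto)
qed

text \<open>A majorant that is minimal at \<open>s\<close> touches \<open>g\<close> on both sides of \<open>s\<close>, since otherwise it could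
  be lowered at \<open>s\<close> by tilting it. On the right the contact might escape to infinity, which the two
  growth hypotheses exclude unless the majorant is constant.\<close>

lemma contact_points:
  assumes growth: "\<And>m. \<kappa> < m \<Longrightarrow> \<exists>K. \<forall>u\<ge>K. g u \<le> m * u" and \<kappa>: "0 \<le> \<kappa>"
    and asym: "\<kappa> = 0 \<or> (\<forall>u\<ge>0. g u < \<kappa> * u + q) \<and> (\<forall>e>0. \<exists>K. \<forall>u\<ge>K. \<kappa> * u + q - e \<le> g u)"
    and s: "0 < s"
  obtains m n a where "(m, n) \<in> affine_majorants g" "envelope g s = m * s + n"
    "0 \<le> a" "a \<le> s" "g a = m * a + n" "m = 0 \<or> (\<exists>b\<ge>s. g b = m * b + n)"
proof -
  obtain m n where mn: "(m, n) \<in> affine_majorants g" and att: "envelope g s = m * s + n"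
    using envelope_attained[OF s] by blast
  have mn0: "0 \<le> m" "0 \<le> n" and maj: "\<And>u. 0 \<le> u \<Longrightarrow> g u \<le> m * u + n"
    using mn by (auto simp: affine_majorants_def)
  have minimal: False if "(m', n') \<in> affine_majorants g" "m' * s + n' < m * s + n" for m' n'
    using envelope_le[OF that(1), of s] s att that(2) by simp
  have left: "\<exists>a. 0 \<le> a \<and> a \<le> s \<and> g a = m * a + n"
  proof (rule ccontr)
    assume "\<not> ?thesis"
    then have no: "g u < m * u + n" if "0 \<le> u" "u \<le> s" for u
      using maj[of u] that by (auto simp: less_le)
    obtain r where r: "0 < r" "\<And>u. s - r \<le> u \<Longrightarrow> u \<le> s + r \<Longrightarrow> g u < m * u + n"
      using gap_neighbourhood[OF s no[of s]] s by auto
    define s1 where "s1 = s + r"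
    have s1: "0 < s1" "s < s1" using s r by (auto simp: s1_def)
    have "g u < m * u + n" if "0 \<le> u" "u \<le> s1" for u
      using no[of u] r(2)[of u] r(1) that by (cases "u \<le> s") (auto simp: s1_def)
    then obtain \<delta> where \<delta>: "0 < \<delta>" "\<And>u. 0 \<le> u \<Longrightarrow> u \<le> s1 \<Longrightarrow> g u + \<delta> \<le> m * u + n"
      using positive_gap[of 0 s1 m n] s1 by auto
    \<comment> \<open>The line is rotated upwards about \<open>s1\<close>, which lies to the right
      of \<open>s\<close>, so its value at \<open>s\<close> drops. The gap \<open>\<delta>\<close>
      pays for the loss to the left of \<open>s1\<close>, and to the right the new line is
      higher.\<close>
    define \<eta> where "\<eta> = \<delta> / s1"
    have \<eta>: "0 < \<eta>" "\<eta> * s1 = \<delta>" using \<delta>(1) s1 by (auto simp: \<eta>_def)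
    have "g u \<le> (m + \<eta>) * u + (n - \<delta>)" if u: "0 \<le> u" for u
    proof (cases "u \<le> s1")
      case True
      have "0 \<le> \<eta> * u" using \<eta> u by simp
      then show ?thesis using \<delta>(2)[OF u True] by (simp add: algebra_simps)
    next
      case False
      then have "\<eta> * s1 \<le> \<eta> * u" using \<eta> by (intro mult_left_mono) auto
      then show ?thesis using maj[OF u] \<eta> by (simp add: algebra_simps)
    qed
    \<comment> \<open>The gap at 0 is the intercept itself since \<open>g 0 = 0\<close>, so the
      lowered intercept remains nonnegative.\<close>
    moreover have "\<delta> \<le> n" using \<delta>(2)[of 0] s1 g_0 by simp
    ultimately have "(m + \<eta>, n - \<delta>) \<in> affine_majorants g"
      using mn0 \<eta> by (auto simp: affine_majorants_def)
    moreover have "\<eta> * s < \<delta>" using mult_strict_left_mono[OF s1(2) \<eta>(1)] \<eta>(2) by simp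
    ultimately show False using minimal[of "m + \<eta>" "n - \<delta>"] by (simp add: algebra_simps)
  qed
  then obtain a where a: "0 \<le> a" "a \<le> s" "g a = m * a + n" by blast
  have right: "\<exists>b\<ge>s. g b = m * b + n" if m: "0 < m"
  proof (rule ccontr)
    assume "\<not> ?thesis"
    then have no: "g u < m * u + n" if "s \<le> u" for u
      using maj[of u] that s by (auto simp: less_le)
    \<comment> \<open>A majorant with slope at most \<open>\<kappa>\<close> must dominate the
      asymptote, that is \<open>m = \<kappa>\<close> and \<open>n \<ge> q\<close>. Since
      \<open>g\<close> lies strictly under the asymptote, contact at \<open>a\<close> would be
      impossible.\<close>
    have "\<kappa> < m"
    proof (cases "\<kappa> = 0")
      case False
      then have upper: "\<And>u. 0 \<le> u \<Longrightarrow> g u < \<kappa> * u + q"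
        and lower: "\<And>e. 0 < e \<Longrightarrow> \<exists>K. \<forall>u\<ge>K. \<kappa> * u + q - e \<le> g u"
        using asym by auto
      show ?thesis
      proof (rule ccontr)
        assume "\<not> \<kappa> < m"
        then have mk: "m \<le> \<kappa>" by simp
        have "q \<le> n + e" if e: "0 < e" for e
        proof -
          obtain K where K: "\<forall>u\<ge>K. \<kappa> * u + q - e \<le> g u" using lower[OF e] by blast
          define u where "u = max K 0"
          have "\<kappa> * u + q - e \<le> g u" "g u \<le> m * u + n" using K maj by (auto simp: u_def)
          moreover have "m * u \<le> \<kappa> * u" using mk by (intro mult_right_mono) (auto simp: u_def)
          ultimately show ?thesis by linarith
        qed
        then have "q \<le> n" by (rule field_le_epsilon)
        moreover have "\<kappa> \<le> m"
        proof (rule ccontr)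
          assume "\<not> \<kappa> \<le> m"
          then have d: "0 < \<kappa> - m" by simp
          obtain K where K: "\<forall>u\<ge>K. \<kappa> * u + q - 1 \<le> g u" using lower[of 1] by auto
          \<comment> \<open>Beyond this point the asymptote exceeds the line by at least 2, more
            than the slack 1 allowed in the lower bound for \<open>g\<close>.\<close>
          define u where "u = max (max K 0) ((n - q + 2) / (\<kappa> - m))"
          have "\<kappa> * u + q - 1 \<le> g u" "g u \<le> m * u + n" using K maj by (auto simp: u_def)
          moreover have "(n - q + 2) / (\<kappa> - m) \<le> u" by (simp add: u_def)
          then have "n - q + 2 \<le> (\<kappa> - m) * u" using d by (simp add: field_simps)
          ultimately show False by (simp add: algebra_simps)
        qed
        ultimately show False using upper[OF a(1)] a(3) mk by simp
      qed
    qed (use m in simp)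
    then obtain m2 where m2: "\<kappa> < m2" "m2 < m" using dense by blast
    obtain K0 where K0: "\<forall>u\<ge>K0. g u \<le> m2 * u" using growth[OF m2(1)] by blast
    obtain r where r: "0 < r" "r < s" "\<And>u. s - r \<le> u \<Longrightarrow> u \<le> s + r \<Longrightarrow> g u < m * u + n"
      using gap_neighbourhood[OF s no[of s]] by auto
    define s1 where "s1 = s - r"
    have s1: "0 < s1" "s1 < s" using r by (auto simp: s1_def)
    define K where "K = max K0 (s + 1)"
    have K: "s1 < K" "0 < K" using s1 s by (auto simp: K_def)
    have "g u < m * u + n" if "s1 \<le> u" for u
      using no[of u] r(3)[of u] r(1) that by (cases "s \<le> u") (auto simp: s1_def)
    then obtain \<delta> where \<delta>: "0 < \<delta>" "\<And>u. s1 \<le> u \<Longrightarrow> u \<le> K \<Longrightarrow> g u + \<delta> \<le> m * u + n"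
      using positive_gap[of s1 K m n] s1 K by auto
    \<comment> \<open>Rotation about \<open>s1\<close>, now to the left of \<open>s\<close>, by a
      smaller slope: \<open>\<delta> / K\<close> keeps the loss up to \<open>K\<close> within the
      gap, and \<open>m - m2\<close> keeps the new slope at least \<open>m2\<close>, which controls
      \<open>g\<close> beyond \<open>K\<close>.\<close>
    define \<eta> where "\<eta> = min (\<delta> / K) (m - m2)"
    have \<eta>: "0 < \<eta>" "\<eta> * K \<le> \<delta>" "m2 \<le> m - \<eta>"
      using \<delta>(1) K m2 by (auto simp: \<eta>_def min_def field_simps)
    have "g u \<le> (m - \<eta>) * u + (n + \<eta> * s1)" if u: "0 \<le> u" for u
    proof -
      consider "u \<le> s1" | "s1 \<le> u" "u \<le> K" | "K \<le> u" by linarith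
      then show ?thesis
      proof cases
        case 1
        then have "\<eta> * u \<le> \<eta> * s1" using \<eta> by (intro mult_left_mono) auto
        then show ?thesis using maj[OF u] by (simp add: algebra_simps)
      next
        case 2
        then have "\<eta> * u \<le> \<eta> * K" using \<eta> by (intro mult_left_mono) auto
        moreover have "0 \<le> \<eta> * s1" using \<eta> s1 by simp
        moreover have "g u + \<delta> \<le> m * u + n" using \<delta>(2) 2 by simp
        ultimately have "g u \<le> m * u + n - \<eta> * u + \<eta> * s1" using \<eta>(2) by linarith
        then show ?thesis by (simp add: algebra_simps)
      next
        case 3
        then have "g u \<le> m2 * u" using K0 by (simp add: K_def)
        also have "\<dots> \<le> (m - \<eta>) * u" using \<eta> u by (intro mult_right_mono) auto
        finally show ?thesis using mn0 \<eta> s1 by (simp add: add_increasing2)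
      qed
    qed
    then have "(m - \<eta>, n + \<eta> * s1) \<in> affine_majorants g"
      using mn0 \<eta> s1 m2 \<kappa> by (auto simp: affine_majorants_def)
    moreover have "\<eta> * s1 < \<eta> * s" using s1 \<eta> by simp
    ultimately show False using minimal[of "m - \<eta>" "n + \<eta> * s1"] by (simp add: algebra_simps)
  qed
  show thesis
    by (rule that[OF mn att a]) (use right mn0(1) in \<open>auto simp: order.order_iff_strict\<close>)
qed

end

subsection \<open>The tangent line at the sale threshold\<close>

locale trading_parameters =
  fixes \<alpha> \<beta> k \<gamma> l \<Psi> R c :: real
  assumes \<alpha>: "0 < \<alpha>" "\<alpha> < 1" "\<alpha> \<le> \<beta>" and \<beta>: "\<beta> \<le> 1" and k: "1 < k"
    and \<gamma>: "0 < \<gamma>" "\<gamma> \<le> 1" and l: "1 \<le> l" and \<Psi>: "0 \<le> \<Psi>" and R: "0 < R" and c: "1 < c"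
    and c_eq: "\<alpha> / \<beta> * c * (c - 1) powr (\<alpha> - 1) - (c - 1) powr \<alpha> - k = 0"
begin

text \<open>Slope, in the variable \<open>z powr \<beta>\<close>, of the line joining the utility
  values \<open>- k\<close> at \<open>z = 0\<close> and \<open>(c - 1) powr \<alpha>\<close> at
  \<open>z = c\<close>, where the reference level is normalised to 1.\<close>

definition A where "A = ((c - 1) powr \<alpha> + k) / c powr \<beta>"

lemma \<beta>_pos: "0 < \<beta>" using \<alpha> by simp

lemma A_pos: "0 < A"
  unfolding A_def using c k by (intro divide_pos_pos add_nonneg_pos) auto

lemma A_c: "A * c powr \<beta> = (c - 1) powr \<alpha> + k"
  using c by (simp add: A_def)

text \<open>Up to the factor \<open>\<alpha> / \<beta>\<close>, the derivative of
  \<open>(z - 1) powr \<alpha>\<close> with respect to \<open>z powr \<beta>\<close>.\<close>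

definition slope where "slope z = z powr (1 - \<beta>) * (z - 1) powr (\<alpha> - 1)" for z :: real

text \<open>The equation for \<open>c\<close> rearranged: the chord from 0 to \<open>c\<close> has
  the slope of the gain curve at \<open>c\<close>, so it is tangent there.\<close>

lemma slope_c: "A * \<beta> = \<alpha> * slope c"
proof -
  have "\<alpha> * (c * (c - 1) powr (\<alpha> - 1)) = \<beta> * (A * c powr \<beta>)"
    using c_eq \<beta>_pos unfolding A_c by (simp add: field_simps)
  moreover have "c = c powr \<beta> * c powr (1 - \<beta>)"
    using c by (simp add: powr_add[symmetric])
  moreover have "c powr \<beta> * (\<alpha> * slope c) = \<alpha> * ((c powr \<beta> * c powr (1 - \<beta>)) * (c - 1) powr (\<alpha> - 1))"
    by (simp add: slope_def mult_ac)
  ultimately have "c powr \<beta> * (\<alpha> * slope c) = c powr \<beta> * (A * \<beta>)"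
    by (simp only: mult_ac)
  then show ?thesis using c by simp
qed

text \<open>Written as a product of powers of \<open>z / (z - 1)\<close> and of
  \<open>z - 1\<close>, the slope has two nonincreasing factors because
  \<open>\<beta> \<le> 1\<close> and \<open>\<alpha> \<le> \<beta>\<close>. This is concavity of
  gains in the variable \<open>z powr \<beta>\<close>.\<close>

lemma slope_antimono:
  assumes "1 < x" "x \<le> y" shows "slope y \<le> slope x"
proof -
  have eq: "slope z = (z / (z - 1)) powr (1 - \<beta>) * (z - 1) powr (\<alpha> - \<beta>)" if "1 < z" for z
    using that by (simp add: slope_def powr_divide powr_diff powr_add field_simps)
  have "y / (y - 1) \<le> x / (x - 1)"
    using assms by (simp add: field_simps)
  then have "(y / (y - 1)) powr (1 - \<beta>) \<le> (x / (x - 1)) powr (1 - \<beta>)"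
    using assms \<beta> by (intro powr_mono2) auto
  moreover have "(y - 1) powr (\<alpha> - \<beta>) \<le> (x - 1) powr (\<alpha> - \<beta>)"
    using assms \<alpha> by (intro powr_mono2') auto
  ultimately show ?thesis
    using assms by (simp add: eq mult_mono)
qed

text \<open>The derivative of line minus gain has the sign of \<open>slope c - slope z\<close>, so
  the difference decreases up to \<open>c\<close>, vanishes there, and increases afterwards.\<close>

lemma tangent_above_gain:
  assumes "1 \<le> z"
  shows "(z - 1) powr \<alpha> \<le> A * z powr \<beta> - k"
proof -
  define f where "f z = A * z powr \<beta> - k - (z - 1) powr \<alpha>" for z
  define f' where "f' z = A * (\<beta> * z powr (\<beta> - 1)) - \<alpha> * (z - 1) powr (\<alpha> - 1)" for z
  have fc: "f c = 0" by (simp add: f_def A_c)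
  have der: "(f has_real_derivative f' z) (at z)" if "1 < z" for z
    unfolding f_def f'_def using that by (auto intro!: derivative_eq_intros)
  have cont: "continuous_on {a..b} f" if "1 \<le> a" for a b
    unfolding f_def using that \<alpha>
    by (intro continuous_intros continuous_on_powr') auto
  have f'_eq: "f' z = z powr (\<beta> - 1) * \<alpha> * (slope c - slope z)" if "1 < z" for z
  proof -
    have "z powr (\<beta> - 1) * slope z = (z - 1) powr (\<alpha> - 1)"
      using that by (simp add: slope_def mult.assoc[symmetric] powr_add[symmetric])
    moreover have "A * \<beta> * z powr (\<beta> - 1) = \<alpha> * slope c * z powr (\<beta> - 1)" by (simp add: slope_c)
    ultimately show ?thesis by (simp add: f'_def algebra_simps)
  qed
  have "f c \<le> f z"
  proof (cases "z < c")
    case True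
    show ?thesis
    \<comment> \<open>At the left endpoint \<open>z = 1\<close> the gain is continuous but has no
      finite derivative, so derivatives may be taken in the open interval only.\<close>
    proof (rule DERIV_nonpos_imp_decreasing_open[of z c f])
      fix x assume x: "z < x" "x < c"
      then have "f' x \<le> 0"
        using assms slope_antimono[of x c] \<alpha> by (simp add: f'_eq mult_nonneg_nonpos)
      then show "\<exists>y. (f has_real_derivative y) (at x) \<and> y \<le> 0" using der[of x] x assms by auto
    qed (use True cont assms in auto)
  next
    case False
    show ?thesis
    proof (rule DERIV_nonneg_imp_nondecreasing[of c z f])
      fix x assume x: "c \<le> x" "x \<le> z"
      then have "0 \<le> f' x"
        using c slope_antimono[of c x] \<alpha> by (simp add: f'_eq)
      then show "\<exists>y. (f has_real_derivative y) (at x) \<and> 0 \<le> y" using der[of x] x c by auto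
    qed (use False in auto)
  qed
  then show ?thesis using fc by (simp add: f_def)
qed

lemma k_le_A: "k \<le> A"
  using tangent_above_gain[of 1] by simp

text \<open>On the loss side, \<open>1 - (1 - z) powr \<alpha> \<le> z \<le> z powr \<beta>\<close>;
  multiplied by \<open>k \<le> A\<close> this puts the convex branch of the utility under the
  line.\<close>

lemma utility_le_tangent:
  assumes "0 \<le> z"
  shows "utility \<alpha> k (z - 1) \<le> A * z powr \<beta> - k"
proof (cases "1 < z")
  case True
  then show ?thesis using tangent_above_gain[of z] by (simp add: utility_def)
next
  case False
  then have z: "z \<le> 1" by simp
  have "1 - z \<le> (1 - z) powr \<alpha>"
    using powr_mono'[of \<alpha> 1 "1 - z"] \<alpha> z assms by (cases "z = 1") auto
  moreover have "z \<le> z powr \<beta>"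
    using powr_mono'[of \<beta> 1 z] \<beta> z assms by (cases "z = 0") auto
  ultimately have "1 - (1 - z) powr \<alpha> \<le> z powr \<beta>" by linarith
  then have "k * (1 - (1 - z) powr \<alpha>) \<le> k * z powr \<beta>" using k by (intro mult_left_mono) auto
  also have "\<dots> \<le> A * z powr \<beta>" using k_le_A by (intro mult_right_mono) auto
  finally show ?thesis using z k_le_A by (auto simp: utility_def algebra_simps abs_if)
qed

section \<open>The exit value and the entry reward in closed form\<close>

definition cost where "cost x = l * x + \<Psi> + R" for x :: real

text \<open>Coefficient of \<open>y powr \<beta>\<close> in the tangent line when the reference
  level is \<open>cost x\<close>, obtained by homogeneity from the normalised coefficient
  \<open>A\<close>.\<close>

definition \<zeta> where "\<zeta> x = A * \<gamma> powr \<beta> * cost x powr (\<alpha> - \<beta>)" for x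

text \<open>The tangent line for reference level \<open>cost x\<close>, evaluated at the purchase
  price itself. It turns out to be the exit value \<open>V1\<close>.\<close>

definition buy_value where "buy_value x = \<zeta> x * x powr \<beta> - k * cost x powr \<alpha>" for x

definition entry_gain where "entry_gain x = max (buy_value x) (- k * R powr \<alpha>)" for x

text \<open>The entry reward as a function of \<open>s = x powr \<beta>\<close>, shifted so that
  staying out is worth 0. With this shift \<open>gain 0 = 0\<close> also covers the event that no
  purchase ever happens.\<close>

definition gain where "gain s = entry_gain (s powr (1 / \<beta>)) + k * R powr \<alpha>" for s

lemma cost_ge: "0 \<le> x \<Longrightarrow> R \<le> cost x" "0 \<le> x \<Longrightarrow> x < cost x" "0 \<le> x \<Longrightarrow> 0 < cost x" "0 \<le> x \<Longrightarrow> l * x < cost x"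
  using l \<Psi> R mult_right_mono[of 1 l x] by (auto simp: cost_def)

lemma threshold_gt: "0 \<le> x \<Longrightarrow> x < c / \<gamma> * cost x"
proof -
  assume x: "0 \<le> x"
  have "\<gamma> * x \<le> 1 * x" using \<gamma> x by (intro mult_right_mono) auto
  also have "\<dots> < 1 * cost x" using cost_ge x by simp
  also have "\<dots> \<le> c * cost x" using cost_ge(3)[OF x] c by (intro mult_right_mono) auto
  finally show ?thesis using \<gamma> by (simp add: field_simps)
qed

lemma \<zeta>_pos: "0 \<le> x \<Longrightarrow> 0 < \<zeta> x"
  using A_pos \<gamma> cost_ge(3)[of x] by (simp add: \<zeta>_def)

lemma \<zeta>_bound: "0 \<le> x \<Longrightarrow> \<zeta> x \<le> A * \<gamma> powr \<beta> * R powr (\<alpha> - \<beta>)"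
  unfolding \<zeta>_def using A_pos \<alpha> R cost_ge(1)[of x] by (intro mult_left_mono powr_mono2') auto

lemma \<zeta>_cont: "continuous_on {0..} \<zeta>"
  unfolding \<zeta>_def cost_def
proof (intro continuous_intros ballI)
  show "l * x + \<Psi> + R \<noteq> 0" if "x \<in> {0..}" for x
    using cost_ge(3)[of x] that by (simp add: cost_def)
qed

lemma tangent_scaled:
  assumes "0 < H" "0 \<le> y"
  shows "H powr \<alpha> * (A * (\<gamma> * y / H) powr \<beta> - k) = A * \<gamma> powr \<beta> * H powr (\<alpha> - \<beta>) * y powr \<beta> - k * H powr \<alpha>"
  using assms \<gamma> by (simp add: powr_divide powr_mult powr_diff field_simps)

text \<open>Both branches of the utility are homogeneous of degree \<open>\<alpha>\<close>, so every
  reference level reduces to level 1.\<close>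

lemma utility_scaled:
  assumes "0 < H"
  shows "utility \<alpha> k (\<gamma> * y - H) = H powr \<alpha> * utility \<alpha> k (\<gamma> * y / H - 1)"
proof -
  have eq: "\<gamma> * y - H = H * (\<gamma> * y / H - 1)" using assms by (simp add: field_simps)
  show ?thesis
    unfolding eq using assms by (auto simp: utility_def powr_mult abs_mult zero_less_mult_iff)
qed

lemma utility_le:
  assumes "0 \<le> x" "0 \<le> y"
  shows "utility \<alpha> k (\<gamma> * y - cost x) \<le> \<zeta> x * y powr \<beta> - k * cost x powr \<alpha>"
proof -
  have H: "0 < cost x" using cost_ge assms by blast
  have "utility \<alpha> k (\<gamma> * y - cost x) \<le> cost x powr \<alpha> * (A * (\<gamma> * y / cost x) powr \<beta> - k)"
    unfolding utility_scaled[OF H] using H assms \<gamma> by (intro mult_left_mono utility_le_tangent) auto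
  then show ?thesis unfolding tangent_scaled[OF H assms(2)] by (simp add: \<zeta>_def)
qed

lemma utility_threshold:
  assumes "0 \<le> x" and y: "y = c / \<gamma> * cost x"
  shows "utility \<alpha> k (\<gamma> * y - cost x) = \<zeta> x * y powr \<beta> - k * cost x powr \<alpha>"
proof -
  have H: "0 < cost x" using cost_ge assms by blast
  have y0: "0 \<le> y" using y H c \<gamma> by simp
  have yc: "\<gamma> * y / cost x = c" using y H \<gamma> by simp
  have "utility \<alpha> k (\<gamma> * y - cost x) = cost x powr \<alpha> * (A * (\<gamma> * y / cost x) powr \<beta> - k)"
    unfolding utility_scaled[OF H] yc A_c using c by (simp add: utility_def)
  then show ?thesis unfolding tangent_scaled[OF H y0] by (simp add: \<zeta>_def)
qed

text \<open>Price 0 is the other contact point of the line, so never selling after a purchase loses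
  nothing against the tangent bound.\<close>

lemma utility_zero:
  assumes "0 \<le> x"
  shows "utility \<alpha> k (\<gamma> * 0 - cost x) = \<zeta> x * 0 powr \<beta> - k * cost x powr \<alpha>"
  using cost_ge(3)[OF assms] by (simp add: utility_def)

lemma utility_neg_R: "utility \<alpha> k (- R) = - k * R powr \<alpha>"
  using R by (simp add: utility_def)

lemma buy_value_0: "buy_value 0 = utility \<alpha> k (- (\<Psi> + R))"
  using \<Psi> R by (simp add: buy_value_def utility_def cost_def add.commute)

lemma buy_value_0_le: "buy_value 0 \<le> - k * R powr \<alpha>"
  using \<Psi> R k \<alpha> by (auto simp: buy_value_def cost_def intro!: powr_mono2)

lemma entry_gain_0: "entry_gain 0 = - k * R powr \<alpha>"
  using buy_value_0_le by (simp add: entry_gain_def)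

lemma powr_inverse_\<beta>: "0 \<le> s \<Longrightarrow> (s powr (1 / \<beta>)) powr \<beta> = s"
  using \<beta>_pos by (simp add: powr_powr)

lemma powr_\<beta>_inverse: "0 \<le> x \<Longrightarrow> (x powr \<beta>) powr (1 / \<beta>) = x"
  using \<beta>_pos by (simp add: powr_powr)

lemma gain_powr: "0 \<le> x \<Longrightarrow> gain (x powr \<beta>) = entry_gain x + k * R powr \<alpha>"
  by (simp add: gain_def powr_\<beta>_inverse)

lemma gain_eq: "0 \<le> s \<Longrightarrow> gain s =
    max (\<zeta> (s powr (1 / \<beta>)) * s - k * cost (s powr (1 / \<beta>)) powr \<alpha> + k * R powr \<alpha>) 0"
  by (simp add: gain_def entry_gain_def buy_value_def powr_inverse_\<beta> max_add_distrib_left)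

lemma gain_nonneg: "0 \<le> gain s"
  by (simp add: gain_def entry_gain_def)

lemma gain_0: "gain 0 = 0"
  by (simp add: gain_def entry_gain_0)

lemma gain_le: "0 \<le> s \<Longrightarrow> gain s \<le> \<zeta> (s powr (1 / \<beta>)) * s"
proof -
  assume s: "0 \<le> s"
  have "R powr \<alpha> \<le> cost (s powr (1 / \<beta>)) powr \<alpha>"
    using R \<alpha> cost_ge(1)[of "s powr (1 / \<beta>)"] by (intro powr_mono2) auto
  then have "k * R powr \<alpha> \<le> k * cost (s powr (1 / \<beta>)) powr \<alpha>" using k by simp
  moreover have "0 \<le> \<zeta> (s powr (1 / \<beta>)) * s" using \<zeta>_pos[of "s powr (1 / \<beta>)"] s by simp
  ultimately show ?thesis using s by (simp add: gain_eq)
qed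

lemma gain_cont: "continuous_on {0..} gain"
proof -
  have p: "continuous_on {0..} (\<lambda>s. s powr (1 / \<beta>))"
    using \<beta>_pos by (intro continuous_on_powr') (auto intro!: continuous_intros)
  have z: "continuous_on {0..} (\<lambda>s. \<zeta> (s powr (1 / \<beta>)))"
    by (rule continuous_on_compose2[OF \<zeta>_cont p]) auto
  have c: "continuous_on {0..} (\<lambda>s. cost (s powr (1 / \<beta>)) powr \<alpha>)"
  proof (rule continuous_on_powr[OF _ continuous_on_const])
    show "continuous_on {0..} (\<lambda>s. cost (s powr (1 / \<beta>)))"
      unfolding cost_def by (intro continuous_on_add continuous_on_mult continuous_on_const p)
    show "\<forall>s\<in>{0..}. cost (s powr (1 / \<beta>)) \<noteq> 0"
      using cost_ge(3) by (metis less_irrefl powr_ge_zero)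
  qed
  have "continuous_on {0..} (\<lambda>s. max (\<zeta> (s powr (1 / \<beta>)) * s - k * cost (s powr (1 / \<beta>)) powr \<alpha> + k * R powr \<alpha>) 0)"
    by (intro continuous_intros z c)
  then show ?thesis by (rule continuous_on_eq) (simp add: gain_eq)
qed

lemma gain_majorant: "(A * \<gamma> powr \<beta> * R powr (\<alpha> - \<beta>), 0) \<in> affine_majorants gain"
proof -
  have "gain u \<le> A * \<gamma> powr \<beta> * R powr (\<alpha> - \<beta>) * u" if "0 \<le> u" for u
    by (rule order_trans[OF gain_le[OF that] mult_right_mono[OF \<zeta>_bound that]]) simp
  then show ?thesis using A_pos by (simp add: affine_majorants_def)
qed

sublocale majorized gain
  by standard (use gain_nonneg gain_cont gain_0 gain_majorant in auto)

text \<open>For \<open>\<alpha> < \<beta>\<close> the gain is sublinear; for \<open>\<alpha> = \<beta>\<close> it is asymptotic from below to the line with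
  slope \<open>A \<gamma>\<^sup>\<alpha> - k l\<^sup>\<alpha>\<close> and intercept \<open>k R\<^sup>\<alpha>\<close>.\<close>

lemma gain_growth:
  obtains \<kappa> where "0 \<le> \<kappa>" "\<And>m. \<kappa> < m \<Longrightarrow> \<exists>K. \<forall>u\<ge>K. gain u \<le> m * u"
    "\<kappa> = 0 \<or> (\<forall>u\<ge>0. gain u < \<kappa> * u + k * R powr \<alpha>) \<and>
      (\<forall>e>0. \<exists>K. \<forall>u\<ge>K. \<kappa> * u + k * R powr \<alpha> - e \<le> gain u)"
proof (cases "\<alpha> < \<beta>")
  case True
  have "\<exists>K. \<forall>u\<ge>K. gain u \<le> m * u" if m: "0 < m" for m
  proof -
    have "((\<lambda>u. A * \<gamma> powr \<beta> * u powr ((\<alpha> - \<beta>) / \<beta>)) \<longlongrightarrow> A * \<gamma> powr \<beta> * 0) at_top"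
      using True \<beta>_pos by (intro tendsto_mult tendsto_const tendsto_neg_powr filterlim_ident) (simp add: divide_neg_pos)
    then have "\<forall>\<^sub>F u in at_top. A * \<gamma> powr \<beta> * u powr ((\<alpha> - \<beta>) / \<beta>) < m"
      using m by (auto dest: order_tendstoD)
    then obtain K where K: "\<And>u. K \<le> u \<Longrightarrow> A * \<gamma> powr \<beta> * u powr ((\<alpha> - \<beta>) / \<beta>) < m"
      by (auto simp: eventually_at_top_linorder)
    have "gain u \<le> m * u" if u: "max K 1 \<le> u" for u
    proof -
      let ?x = "u powr (1 / \<beta>)"
      have "cost ?x powr (\<alpha> - \<beta>) \<le> ?x powr (\<alpha> - \<beta>)"
        using u True cost_ge(2)[of ?x] by (intro powr_mono2') auto
      then have "\<zeta> ?x \<le> A * \<gamma> powr \<beta> * ?x powr (\<alpha> - \<beta>)"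
        unfolding \<zeta>_def using A_pos by (intro mult_left_mono) auto
      also have "?x powr (\<alpha> - \<beta>) = u powr ((\<alpha> - \<beta>) / \<beta>)" by (simp add: powr_powr)
      also have "A * \<gamma> powr \<beta> * u powr ((\<alpha> - \<beta>) / \<beta>) \<le> m" using K[of u] u by simp
      finally have "\<zeta> ?x * u \<le> m * u" using u by (intro mult_right_mono) auto
      moreover have "gain u \<le> \<zeta> ?x * u" using gain_le[of u] u by simp
      ultimately show ?thesis by (rule order_trans[rotated])
    qed
    then show ?thesis by blast
  qed
  then show thesis using that[of 0] by simp
next
  case False
  then have \<alpha>\<beta>: "\<alpha> - \<beta> = 0" "\<alpha> / \<beta> = 1" using \<alpha> by simp_all
  define a where "a = A * \<gamma> powr \<beta>"
  define q where "q = k * R powr \<alpha>"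
  define b where "b = a - k * l powr \<alpha>"
  \<comment> \<open>The excess of the cost term over its linear part: when
    \<open>\<alpha> = \<beta>\<close>, the power \<open>(l * x) powr \<alpha>\<close> is linear in
    \<open>u = x powr \<beta>\<close>. The reward then approaches its asymptote exactly as
    \<open>h\<close> tends to 0.\<close>
  define h where "h u = cost (u powr (1 / \<beta>)) powr \<alpha> - l powr \<alpha> * u" for u
  have g: "gain u = max (b * u - k * h u + q) 0" if "0 \<le> u" for u
  proof -
    have "\<zeta> (u powr (1 / \<beta>)) = a"
      using cost_ge(3)[of "u powr (1 / \<beta>)"] by (simp add: \<zeta>_def a_def \<alpha>\<beta>)
    then show ?thesis using that by (simp add: gain_eq b_def h_def q_def algebra_simps)
  qed
  have lx: "(l * u powr (1 / \<beta>)) powr \<alpha> = l powr \<alpha> * u" if "0 \<le> u" for u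
    using that \<alpha> l \<alpha>\<beta> by (simp add: powr_mult powr_powr)
  have q: "0 < q" using k R by (simp add: q_def)
  have h_pos: "0 < h u" if u: "0 \<le> u" for u
  proof -
    have "(l * u powr (1 / \<beta>)) powr \<alpha> < cost (u powr (1 / \<beta>)) powr \<alpha>"
      using cost_ge(4)[of "u powr (1 / \<beta>)"] l \<alpha> by (intro powr_less_mono2) auto
    then show ?thesis using lx[OF u] by (simp add: h_def)
  qed
  have h_le: "h u \<le> (\<Psi> + R) * u powr ((\<alpha> - 1) / \<beta>)" if u: "0 < u" for u
  proof -
    define y where "y = l * u powr (1 / \<beta>)"
    define d where "d = \<Psi> + R"
    have y: "0 < y" using u l by (simp add: y_def)
    have d: "0 < d" using \<Psi> R by (simp add: d_def)
    have "cost (u powr (1 / \<beta>)) = y * (1 + d / y)"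
      using y by (simp add: cost_def y_def[symmetric] d_def field_simps)
    then have "cost (u powr (1 / \<beta>)) powr \<alpha> = y powr \<alpha> * (1 + d / y) powr \<alpha>"
      using y d by (simp add: powr_mult)
    \<comment> \<open>A base at least 1 raised to \<open>\<alpha> < 1\<close> is at most the base
      itself; this yields the decay rate \<open>y powr (\<alpha> - 1)\<close>.\<close>
    also have "\<dots> \<le> y powr \<alpha> * (1 + d / y) powr 1"
      using y d \<alpha> by (intro mult_left_mono powr_mono) auto
    also have "\<dots> = y powr \<alpha> + d * y powr (\<alpha> - 1)"
      using y d by (simp add: powr_diff field_simps)
    also have "y powr \<alpha> = l powr \<alpha> * u" using lx[of u] u by (simp add: y_def)
    finally have "h u \<le> d * y powr (\<alpha> - 1)" by (simp add: h_def)
    also have "\<dots> \<le> d * (u powr (1 / \<beta>)) powr (\<alpha> - 1)"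
      using d u l \<alpha> mult_right_mono[of 1 l "u powr (1 / \<beta>)"] by (intro mult_left_mono powr_mono2') (auto simp: y_def)
    finally show ?thesis using d_def by (simp add: powr_powr)
  qed
  have h_lim: "\<exists>K. \<forall>u\<ge>K. k * h u \<le> e" if e: "0 < e" for e
  proof -
    have "((\<lambda>u. k * ((\<Psi> + R) * u powr ((\<alpha> - 1) / \<beta>))) \<longlongrightarrow> k * ((\<Psi> + R) * 0)) at_top"
      using \<alpha> by (intro tendsto_mult tendsto_const tendsto_neg_powr filterlim_ident) (simp add: divide_neg_pos)
    then have "\<forall>\<^sub>F u in at_top. k * ((\<Psi> + R) * u powr ((\<alpha> - 1) / \<beta>)) < e"
      using e by (auto dest: order_tendstoD)
    then obtain K where K: "\<And>u. K \<le> u \<Longrightarrow> k * ((\<Psi> + R) * u powr ((\<alpha> - 1) / \<beta>)) < e"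
      by (auto simp: eventually_at_top_linorder)
    have "k * h u \<le> e" if "max K 1 \<le> u" for u
    proof (rule order_trans)
      show "k * h u \<le> k * ((\<Psi> + R) * u powr ((\<alpha> - 1) / \<beta>))"
        using h_le[of u] k that by (intro mult_left_mono) auto
      show "k * ((\<Psi> + R) * u powr ((\<alpha> - 1) / \<beta>)) \<le> e"
        using K[of u] that by simp
    qed
    then show ?thesis by blast
  qed
  have up: "b * u - k * h u + q < b * u + q" if "0 \<le> u" for u
    using h_pos[OF that] k by simp
  show thesis
  proof (cases "0 < b")
    case True
    show thesis
    proof (rule that[of b])
      show "0 \<le> b" using True by simp
      have lt: "gain u < b * u + q" if "0 \<le> u" for u
        using up[OF that] that True q by (simp add: g add_nonneg_pos)
      then show "b = 0 \<or> (\<forall>u\<ge>0. gain u < b * u + k * R powr \<alpha>) \<and>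
          (\<forall>e>0. \<exists>K. \<forall>u\<ge>K. b * u + k * R powr \<alpha> - e \<le> gain u)"
      proof (intro disjI2 conjI allI impI)
        fix e :: real assume "0 < e"
        then obtain K where K: "\<forall>u\<ge>K. k * h u \<le> e" using h_lim by blast
        have "b * u + k * R powr \<alpha> - e \<le> gain u" if "max K 0 \<le> u" for u
          using K that by (auto simp: g q_def)
        then show "\<exists>K. \<forall>u\<ge>K. b * u + k * R powr \<alpha> - e \<le> gain u" by blast
      qed (simp add: q_def)
      fix m assume m: "b < m"
      have "gain u \<le> m * u" if "max 0 (q / (m - b)) \<le> u" for u
      proof -
        have "q \<le> (m - b) * u" using that m by (simp add: field_simps)
        then show ?thesis using lt[of u] that by (simp add: algebra_simps)
      qed
      then show "\<exists>K. \<forall>u\<ge>K. gain u \<le> m * u" by blast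
    qed
  next
    \<comment> \<open>Without positive linear growth the gain is bounded by \<open>q\<close>, so
      every positive slope eventually dominates it and the trivial asymptotic slope 0
      serves.\<close>
    case False
    show thesis
    proof (rule that[of 0])
      fix m :: real assume m: "0 < m"
      have "gain u \<le> m * u" if "max 0 (q / m) \<le> u" for u
      proof -
        have "b * u \<le> 0" using False that by (intro mult_nonpos_nonneg) auto
        then have "gain u \<le> q" using up[of u] that q by (simp add: g)
        also have "q \<le> m * u" using that m by (simp add: field_simps)
        finally show ?thesis .
      qed
      then show "\<exists>K. \<forall>u\<ge>K. gain u \<le> m * u" by blast
    qed auto
  qed
qed

end

subsection \<open>Optional stopping at bounded times\<close>

lemma bounded_mult_integrable:
  fixes f Z :: "'a \<Rightarrow> real"
  assumes "integrable M f" "Z \<in> borel_measurable M" "\<And>\<omega>. \<bar>Z \<omega>\<bar> \<le> C"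
  shows "integrable M (\<lambda>\<omega>. Z \<omega> * f \<omega>)"
proof (rule Bochner_Integration.integrable_bound[of _ "\<lambda>\<omega>. C * f \<omega>"])
  show "AE \<omega> in M. norm (Z \<omega> * f \<omega>) \<le> norm (C * f \<omega>)"
  proof (rule AE_I2)
    fix \<omega>
    have "\<bar>Z \<omega>\<bar> \<le> \<bar>C\<bar>" using assms(3)[of \<omega>] by linarith
    then show "norm (Z \<omega> * f \<omega>) \<le> norm (C * f \<omega>)" by (simp add: abs_mult mult_right_mono)
  qed
qed (use assms in auto)

text \<open>A uniform second-moment bound, inherited by the limit through Fatou, gives uniform
  integrability. Pointwise convergence then becomes convergence in mean, also against a bounded
  factor \<open>Z\<close>.\<close>

lemma (in prob_space) L2_bounded_tendsto:
  fixes X :: "nat \<Rightarrow> 'a \<Rightarrow> real"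
  assumes X[measurable]: "\<And>n. X n \<in> borel_measurable M" and Y[measurable]: "Y \<in> borel_measurable M"
    and nn: "\<And>n \<omega>. 0 \<le> X n \<omega>" and lim: "\<And>\<omega>. \<omega> \<in> space M \<Longrightarrow> (\<lambda>n. X n \<omega>) \<longlonglongrightarrow> Y \<omega>"
    and X2: "\<And>n. integrable M (\<lambda>\<omega>. (X n \<omega>)\<^sup>2)" "\<And>n. (\<integral>\<omega>. (X n \<omega>)\<^sup>2 \<partial>M) \<le> Q"
    and Z[measurable]: "Z \<in> borel_measurable M" and ZC: "\<And>\<omega>. \<bar>Z \<omega>\<bar> \<le> C"
  shows "integrable M (\<lambda>\<omega>. (Y \<omega>)\<^sup>2)" and "(\<lambda>n. \<integral>\<omega>. Z \<omega> * X n \<omega> \<partial>M) \<longlonglongrightarrow> (\<integral>\<omega>. Z \<omega> * Y \<omega> \<partial>M)"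
proof -
  have Q0: "0 \<le> Q" using X2(2)[of 0] by (rule order_trans[rotated]) simp
  have "(\<integral>\<^sup>+\<omega>. ennreal ((Y \<omega>)\<^sup>2) \<partial>M) = (\<integral>\<^sup>+\<omega>. liminf (\<lambda>n. ennreal ((X n \<omega>)\<^sup>2)) \<partial>M)"
  proof (rule nn_integral_cong)
    fix \<omega> assume "\<omega> \<in> space M"
    then have "(\<lambda>n. ennreal ((X n \<omega>)\<^sup>2)) \<longlonglongrightarrow> ennreal ((Y \<omega>)\<^sup>2)"
      by (intro tendsto_ennrealI tendsto_power lim)
    then show "ennreal ((Y \<omega>)\<^sup>2) = liminf (\<lambda>n. ennreal ((X n \<omega>)\<^sup>2))"
      by (rule lim_imp_Liminf[OF trivial_limit_sequentially, symmetric])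
  qed
  also have "\<dots> \<le> liminf (\<lambda>n. \<integral>\<^sup>+\<omega>. ennreal ((X n \<omega>)\<^sup>2) \<partial>M)"
    by (rule nn_integral_liminf) measurable
  also have "\<dots> \<le> liminf (\<lambda>n::nat. ennreal Q)"
    using X2 by (intro Liminf_mono always_eventually) (auto simp: nn_integral_eq_integral intro!: ennreal_leI)
  also have "\<dots> = ennreal Q" by (rule Liminf_const[OF trivial_limit_sequentially])
  finally have Yn: "(\<integral>\<^sup>+\<omega>. ennreal ((Y \<omega>)\<^sup>2) \<partial>M) \<le> ennreal Q" .
  show Y2: "integrable M (\<lambda>\<omega>. (Y \<omega>)\<^sup>2)"
    using Yn by (intro integrableI_nonneg) (auto simp: less_top[symmetric] top_unique)
  have YQ: "(\<integral>\<omega>. (Y \<omega>)\<^sup>2 \<partial>M) \<le> Q"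
    using Yn Q0 by (subst (asm) nn_integral_eq_integral[OF Y2]) auto
  have Y1: "integrable M Y" and X1: "integrable M (X n)" for n
    using Y2 X2(1) by (auto intro: square_integrable_imp_integrable)
  have Ynn: "0 \<le> Y \<omega>" if "\<omega> \<in> space M" for \<omega>
    using lim[OF that] nn by (intro LIMSEQ_le_const) auto
  have d1: "(\<lambda>n. \<integral>\<omega>. \<bar>X n \<omega> - Y \<omega>\<bar> \<partial>M) \<longlonglongrightarrow> 0"
  proof (rule LIMSEQ_I)
    fix e :: real assume e: "0 < e"
    \<comment> \<open>The part of a variable above \<open>K\<close> is at most its square divided by
      \<open>K\<close>; this choice keeps the two tails together under three quarters of the
      tolerance.\<close>
    define K where "K = 4 * (Q + 1) / e"
    have K: "0 < K" "2 * Q / K < e / 2 + e / 4" using Q0 e by (auto simp: K_def field_simps intro!: add_pos_nonneg)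
    have trunc: "\<bar>x - y\<bar> \<le> \<bar>min x K - min y K\<bar> + (x\<^sup>2 / K + y\<^sup>2 / K)" if "0 \<le> x" "0 \<le> y" for x y :: real
    proof -
      have t: "z - min z K \<le> z\<^sup>2 / K" if "0 \<le> z" for z
      proof (cases "z \<le> K")
        case False
        then have "z * K \<le> z * z" using that by (intro mult_left_mono) auto
        then have "z \<le> z\<^sup>2 / K" using K by (simp add: field_simps power2_eq_square)
        then show ?thesis using False K by simp
      qed (use K in simp)
      have sq: "0 \<le> x\<^sup>2 / K" "0 \<le> y\<^sup>2 / K" using K by auto
      have "\<bar>x - y\<bar> \<le> \<bar>min x K - min y K\<bar> + ((x - min x K) + (y - min y K))"
        by (auto simp: min_def)
      then show ?thesis using t[OF that(1)] t[OF that(2)] by linarith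
    qed
    have "(\<lambda>n. \<integral>\<omega>. \<bar>min (X n \<omega>) K - min (Y \<omega>) K\<bar> \<partial>M) \<longlonglongrightarrow> (\<integral>\<omega>. 0 \<partial>M)"
    proof (rule integral_dominated_convergence[where w = "\<lambda>_. 2 * K"])
      show "AE \<omega> in M. (\<lambda>n. \<bar>min (X n \<omega>) K - min (Y \<omega>) K\<bar>) \<longlonglongrightarrow> 0"
      proof (rule AE_I2)
        fix \<omega> assume "\<omega> \<in> space M"
        then have "(\<lambda>n. \<bar>min (X n \<omega>) K - min (Y \<omega>) K\<bar>) \<longlonglongrightarrow> \<bar>min (Y \<omega>) K - min (Y \<omega>) K\<bar>"
          by (intro tendsto_intros lim)
        then show "(\<lambda>n. \<bar>min (X n \<omega>) K - min (Y \<omega>) K\<bar>) \<longlonglongrightarrow> 0" by simp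
      qed
      show "AE \<omega> in M. norm \<bar>min (X n \<omega>) K - min (Y \<omega>) K\<bar> \<le> 2 * K" for n
      proof (rule AE_I2)
        fix \<omega> assume "\<omega> \<in> space M"
        then show "norm \<bar>min (X n \<omega>) K - min (Y \<omega>) K\<bar> \<le> 2 * K"
          using nn[of n \<omega>] Ynn[of \<omega>] K by (auto simp: min_def abs_if)
      qed
    qed auto
    from LIMSEQ_D[OF this, of "e / 4"] e obtain N where
      N0: "\<forall>n\<ge>N. norm ((\<integral>\<omega>. \<bar>min (X n \<omega>) K - min (Y \<omega>) K\<bar> \<partial>M) - (\<integral>\<omega>. 0 \<partial>M)) < e / 4"
      by auto
    have N: "(\<integral>\<omega>. \<bar>min (X n \<omega>) K - min (Y \<omega>) K\<bar> \<partial>M) < e / 4" if "N \<le> n" for n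
      using N0[rule_format, OF that] by simp
    have im: "integrable M (\<lambda>\<omega>. \<bar>min (X n \<omega>) K - min (Y \<omega>) K\<bar>)" for n
    proof (rule integrable_const_bound[where B = "2 * K"])
      show "AE \<omega> in M. norm \<bar>min (X n \<omega>) K - min (Y \<omega>) K\<bar> \<le> 2 * K"
      proof (rule AE_I2)
        fix \<omega> assume "\<omega> \<in> space M"
        then show "norm \<bar>min (X n \<omega>) K - min (Y \<omega>) K\<bar> \<le> 2 * K"
          using nn[of n \<omega>] Ynn[of \<omega>] K by (auto simp: min_def abs_if)
      qed
    qed measurable
    have "norm ((\<integral>\<omega>. \<bar>X n \<omega> - Y \<omega>\<bar> \<partial>M) - 0) < e" if n: "N \<le> n" for n
    proof -
      have "(\<integral>\<omega>. \<bar>X n \<omega> - Y \<omega>\<bar> \<partial>M) \<le> (\<integral>\<omega>. \<bar>min (X n \<omega>) K - min (Y \<omega>) K\<bar> + ((X n \<omega>)\<^sup>2 / K + (Y \<omega>)\<^sup>2 / K) \<partial>M)"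
        using X1 Y1 X2(1) Y2 im nn Ynn by (intro integral_mono trunc) auto
      also have "\<dots> = (\<integral>\<omega>. \<bar>min (X n \<omega>) K - min (Y \<omega>) K\<bar> \<partial>M) + ((\<integral>\<omega>. (X n \<omega>)\<^sup>2 \<partial>M) / K + (\<integral>\<omega>. (Y \<omega>)\<^sup>2 \<partial>M) / K)"
        using X2(1) Y2 im by simp
      also have "\<dots> \<le> (\<integral>\<omega>. \<bar>min (X n \<omega>) K - min (Y \<omega>) K\<bar> \<partial>M) + (Q / K + Q / K)"
        using X2(2)[of n] YQ K by (intro add_left_mono add_mono divide_right_mono) auto
      also have "\<dots> < e / 4 + (e / 2 + e / 4)"
        using N[OF n] K by simp
      finally show ?thesis by simp
    qed
    then show "\<exists>no. \<forall>n\<ge>no. norm ((\<integral>\<omega>. \<bar>X n \<omega> - Y \<omega>\<bar> \<partial>M) - 0) < e" by blast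
  qed
  have iZ: "integrable M (\<lambda>\<omega>. Z \<omega> * f \<omega>)" if "integrable M f" for f :: "'a \<Rightarrow> real"
    using that Z ZC by (rule bounded_mult_integrable)
  have C0: "0 \<le> C" using ZC by (rule order_trans[rotated]) simp
  have lim_C: "(\<lambda>n. C * (\<integral>\<omega>. \<bar>X n \<omega> - Y \<omega>\<bar> \<partial>M)) \<longlonglongrightarrow> 0"
    using tendsto_mult[OF tendsto_const[of C] d1] by simp
  have "(\<lambda>n. (\<integral>\<omega>. Z \<omega> * X n \<omega> \<partial>M) - (\<integral>\<omega>. Z \<omega> * Y \<omega> \<partial>M)) \<longlonglongrightarrow> 0"
  proof (rule tendsto_rabs_zero_cancel, rule tendsto_sandwich[OF _ _ tendsto_const lim_C])
    show "\<forall>\<^sub>F n in sequentially. \<bar>(\<integral>\<omega>. Z \<omega> * X n \<omega> \<partial>M) - (\<integral>\<omega>. Z \<omega> * Y \<omega> \<partial>M)\<bar> \<le> C * (\<integral>\<omega>. \<bar>X n \<omega> - Y \<omega>\<bar> \<partial>M)"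
    proof (rule always_eventually, rule allI)
      fix n
      have "\<bar>(\<integral>\<omega>. Z \<omega> * X n \<omega> \<partial>M) - (\<integral>\<omega>. Z \<omega> * Y \<omega> \<partial>M)\<bar> = \<bar>\<integral>\<omega>. Z \<omega> * X n \<omega> - Z \<omega> * Y \<omega> \<partial>M\<bar>"
        using iZ[OF X1] iZ[OF Y1] by simp
      also have "\<dots> \<le> (\<integral>\<omega>. \<bar>Z \<omega> * X n \<omega> - Z \<omega> * Y \<omega>\<bar> \<partial>M)"
        by (rule integral_abs_bound)
      also have "\<dots> \<le> (\<integral>\<omega>. C * \<bar>X n \<omega> - Y \<omega>\<bar> \<partial>M)"
      proof (rule integral_mono)
        show "\<bar>Z \<omega> * X n \<omega> - Z \<omega> * Y \<omega>\<bar> \<le> C * \<bar>X n \<omega> - Y \<omega>\<bar>" for \<omega>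
          using mult_right_mono[OF ZC[of \<omega>], of "\<bar>X n \<omega> - Y \<omega>\<bar>"]
          by (simp add: abs_mult[symmetric] right_diff_distrib)
      qed (use iZ[OF X1] iZ[OF Y1] X1 Y1 in auto)
      finally show "\<bar>(\<integral>\<omega>. Z \<omega> * X n \<omega> \<partial>M) - (\<integral>\<omega>. Z \<omega> * Y \<omega> \<partial>M)\<bar> \<le> C * (\<integral>\<omega>. \<bar>X n \<omega> - Y \<omega>\<bar> \<partial>M)"
        by simp
    qed
  qed simp
  then show "(\<lambda>n. \<integral>\<omega>. Z \<omega> * X n \<omega> \<partial>M) \<longlonglongrightarrow> (\<integral>\<omega>. Z \<omega> * Y \<omega> \<partial>M)"
    by (rule LIM_zero_cancel)
qed

section \<open>Discretisation of stopping times\<close>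

definition grid_index :: "real \<Rightarrow> nat \<Rightarrow> real \<Rightarrow> nat" where
  "grid_index T n x = nat \<lceil>real n * x / T\<rceil>"

lemma grid_index_le:
  assumes "0 < T" "x \<le> T" shows "grid_index T n x \<le> n"
proof -
  have "real n * x / T \<le> real n" using assms mult_left_mono[of x T "real n"] by (simp add: field_simps)
  then have "\<lceil>real n * x / T\<rceil> \<le> int n" by (simp only: ceiling_le_iff of_int_of_nat_eq)
  then show ?thesis by (simp only: grid_index_def nat_le_iff)
qed

text \<open>Times are rounded up, so whether the rounded time is at most a grid point is decided by
  the original time at that grid point. Rounding therefore preserves the stopping property.\<close>

lemma grid_index_le_iff:
  assumes "0 < T" "0 < n" shows "grid_index T n x \<le> j \<longleftrightarrow> x \<le> T * real j / real n"
proof -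
  have "grid_index T n x \<le> j \<longleftrightarrow> \<lceil>real n * x / T\<rceil> \<le> int j" by (simp only: grid_index_def nat_le_iff)
  also have "\<dots> \<longleftrightarrow> real n * x / T \<le> real j"
    by (simp only: ceiling_le_iff of_int_of_nat_eq)
  also have "\<dots> \<longleftrightarrow> x \<le> T * real j / real n" using assms by (simp add: field_simps)
  finally show ?thesis .
qed

lemma grid_index_tendsto:
  assumes T: "0 < T" and x: "0 \<le> x"
  shows "(\<lambda>n. T * real (grid_index T n x) / real n) \<longlonglongrightarrow> x"
proof -
  have lim: "(\<lambda>n. x + T / real n) \<longlonglongrightarrow> x"
    using tendsto_add[OF tendsto_const[of x] tendsto_divide_0[OF tendsto_const[of T] filterlim_at_top_imp_at_infinity[OF filterlim_real_sequentially]]] by simp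
  have "x \<le> T * real (grid_index T n x) / real n \<and> T * real (grid_index T n x) / real n \<le> x + T / real n" if n: "0 < n" for n
  proof
    show "x \<le> T * real (grid_index T n x) / real n"
      using grid_index_le_iff[OF T n, of x "grid_index T n x"] by simp
    have "real (grid_index T n x) \<le> real n * x / T + 1"
      using T x by (simp add: grid_index_def)
    then show "T * real (grid_index T n x) / real n \<le> x + T / real n"
      using T n by (simp add: field_simps)
  qed
  then have "\<forall>\<^sub>F n in sequentially. x \<le> T * real (grid_index T n x) / real n"
    "\<forall>\<^sub>F n in sequentially. T * real (grid_index T n x) / real n \<le> x + T / real n"
    by (auto intro!: eventually_mono[OF eventually_gt_at_top[of "0::nat"]])
  from tendsto_sandwich[OF this tendsto_const lim] show ?thesis .
qed

context brownian_space
begin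

text \<open>With drift 0 the price formula becomes the exponential martingale
  \<open>exp (\<theta> * W t - \<theta>\<^sup>2 / 2 * t)\<close>.\<close>

abbreviation mart :: "real \<Rightarrow> real \<Rightarrow> 'a \<Rightarrow> real" where
  "mart \<theta> t \<omega> \<equiv> gbm 0 \<theta> 1 t \<omega>"

lemma mart_pos: "0 < mart \<theta> t \<omega>"
  by (simp add: gbm_def)

lemma mart_0 [simp]: "mart \<theta> 0 \<omega> = 1"
  by (simp add: gbm_def)

lemma mart_integrable: "0 \<le> t \<Longrightarrow> integrable M (mart \<theta> t)"
  using gbm_second_moment(1)[of t 0 \<theta> 1] gbm_measurable[of t 0 \<theta> 1]
  by (auto intro: square_integrable_imp_integrable)

text \<open>The martingale property, and the submartingale property of the square, are tested
  against bounded variables known at time \<open>s\<close> instead of being phrased with conditional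
  expectations.\<close>

lemma mart_step:
  assumes st: "0 \<le> s" "s \<le> t" and Z: "Z \<in> borel_measurable (F (ennreal s))" "\<And>\<omega>. \<bar>Z \<omega>\<bar> \<le> C"
  shows "(\<integral>\<omega>. Z \<omega> * mart \<theta> t \<omega> \<partial>M) = (\<integral>\<omega>. Z \<omega> * mart \<theta> s \<omega> \<partial>M)"
    and "(\<And>\<omega>. 0 \<le> Z \<omega>) \<Longrightarrow> (\<integral>\<omega>. Z \<omega> * (mart \<theta> s \<omega>)\<^sup>2 \<partial>M) \<le> (\<integral>\<omega>. Z \<omega> * (mart \<theta> t \<omega>)\<^sup>2 \<partial>M)"
proof -
  define f where "f x = exp (\<theta> * x) * exp (- \<theta>\<^sup>2 * (t - s) / 2)" for x
  have fm: "f \<in> borel_measurable borel" "(\<lambda>x. (f x)\<^sup>2) \<in> borel_measurable borel"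
    unfolding f_def[abs_def] by measurable
  have Z_M: "Z \<in> borel_measurable M" using Z(1) by (rule measurable_F_M)
  have ms: "mart \<theta> s \<in> borel_measurable (F (ennreal s))"
    using st by (intro gbm_measurable_F) auto
  have i1: "integrable M (\<lambda>\<omega>. Z \<omega> * mart \<theta> s \<omega>)"
    using mart_integrable[OF st(1)] Z_M Z(2) by (rule bounded_mult_integrable)
  have i2: "integrable M (\<lambda>\<omega>. Z \<omega> * (mart \<theta> s \<omega>)\<^sup>2)"
    using gbm_second_moment(1)[OF st(1)] Z_M Z(2) by (rule bounded_mult_integrable)
  have m1: "(\<lambda>\<omega>. Z \<omega> * mart \<theta> s \<omega>) \<in> borel_measurable (F (ennreal s))"
    and m2: "(\<lambda>\<omega>. Z \<omega> * (mart \<theta> s \<omega>)\<^sup>2) \<in> borel_measurable (F (ennreal s))"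
    using Z(1) ms by measurable
  have eq: "mart \<theta> t \<omega> = mart \<theta> s \<omega> * f (W t \<omega> - W s \<omega>)" for \<omega>
    by (simp add: gbm_def f_def exp_add[symmetric]) (simp add: algebra_simps diff_divide_distrib)
  have f2: "(f x)\<^sup>2 = exp (2 * \<theta> * x) * exp (- \<theta>\<^sup>2 * (t - s))" for x
    unfolding f_def power_mult_distrib exp_double[symmetric] by (simp add: mult.assoc)
  show "(\<integral>\<omega>. Z \<omega> * mart \<theta> t \<omega> \<partial>M) = (\<integral>\<omega>. Z \<omega> * mart \<theta> s \<omega> \<partial>M)"
  proof (cases "s = t")
    case False
    then have lt: "s < t" using st by simp
    have fi: "integrable M (\<lambda>\<omega>. f (W t \<omega> - W s \<omega>))"
      unfolding f_def using exp_increment(1)[OF st(1) lt] by (rule integrable_mult_left)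
    have f1: "(\<integral>\<omega>. f (W t \<omega> - W s \<omega>) \<partial>M) = 1"
      unfolding f_def integral_mult_left_zero exp_increment(2)[OF st(1) lt] by (simp add: exp_add[symmetric])
    show ?thesis
      using W_indep[OF st(1) lt m1 fm(1) i1 fi] f1 by (simp add: eq mult.assoc)
  qed simp
  show "(\<integral>\<omega>. Z \<omega> * (mart \<theta> s \<omega>)\<^sup>2 \<partial>M) \<le> (\<integral>\<omega>. Z \<omega> * (mart \<theta> t \<omega>)\<^sup>2 \<partial>M)" if Zn: "\<And>\<omega>. 0 \<le> Z \<omega>"
  proof (cases "s = t")
    case False
    then have lt: "s < t" using st by simp
    have fi: "integrable M (\<lambda>\<omega>. (f (W t \<omega> - W s \<omega>))\<^sup>2)"
      unfolding f2 using exp_increment(1)[OF st(1) lt] by (rule integrable_mult_left)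
    have f1: "(\<integral>\<omega>. (f (W t \<omega> - W s \<omega>))\<^sup>2 \<partial>M) = exp (\<theta>\<^sup>2 * (t - s))"
      unfolding f2 integral_mult_left_zero exp_increment(2)[OF st(1) lt] by (simp add: exp_add[symmetric] algebra_simps diff_divide_distrib)
    have "(\<integral>\<omega>. Z \<omega> * (mart \<theta> t \<omega>)\<^sup>2 \<partial>M) = (\<integral>\<omega>. Z \<omega> * (mart \<theta> s \<omega>)\<^sup>2 \<partial>M) * exp (\<theta>\<^sup>2 * (t - s))"
      using W_indep[OF st(1) lt m2 fm(2) i2 fi] f1 by (simp add: eq power_mult_distrib mult.assoc)
    moreover have "0 \<le> (\<integral>\<omega>. Z \<omega> * (mart \<theta> s \<omega>)\<^sup>2 \<partial>M)" using Zn by simp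
    moreover have "1 \<le> exp (\<theta>\<^sup>2 * (t - s))" using lt by simp
    ultimately show ?thesis using mult_left_mono[of 1 "exp (\<theta>\<^sup>2 * (t - s))"] by fastforce
  qed simp
qed

text \<open>The assumption \<open>ZF\<close> says that \<open>Z\<close> is known at time
  \<open>\<nu>\<close>. Rounding \<open>\<nu>\<close> up to a grid reduces the claim to martingale
  steps on the events that a given grid point is selected; the limit is justified by bounded second
  moments.\<close>

lemma optional_stopping_bounded:
  assumes T: "0 < T" and \<nu>: "\<And>\<omega>. 0 \<le> \<nu> \<omega>" "\<And>\<omega>. \<nu> \<omega> \<le> T"
    and \<nu>F: "\<And>t. 0 \<le> t \<Longrightarrow> {\<omega> \<in> space M. \<nu> \<omega> \<le> t} \<in> sets (F (ennreal t))"
    and ZF: "\<And>t. 0 \<le> t \<Longrightarrow> (\<lambda>\<omega>. Z \<omega> * indicator {\<omega> \<in> space M. \<nu> \<omega> \<le> t} \<omega>) \<in> borel_measurable (F (ennreal t))"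
    and ZC: "\<And>\<omega>. \<bar>Z \<omega>\<bar> \<le> C"
  shows "integrable M (\<lambda>\<omega>. Z \<omega> * mart \<theta> (\<nu> \<omega>) \<omega>)"
    and "(\<integral>\<omega>. Z \<omega> * mart \<theta> (\<nu> \<omega>) \<omega> \<partial>M) = (\<integral>\<omega>. Z \<omega> * mart \<theta> T \<omega> \<partial>M)"
proof -
  have Z[measurable]: "Z \<in> borel_measurable M"
  proof -
    have "(\<lambda>\<omega>. Z \<omega> * indicator {\<omega> \<in> space M. \<nu> \<omega> \<le> T} \<omega>) \<in> borel_measurable M"
      using measurable_F_M[OF ZF[of T]] T by simp
    then show ?thesis
      using measurable_cong[of M "\<lambda>\<omega>. Z \<omega> * indicator {\<omega> \<in> space M. \<nu> \<omega> \<le> T} \<omega>" Z borel] \<nu> by simp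
  qed
  have "{\<omega> \<in> space M. \<nu> \<omega> \<le> t} \<in> sets M" for t
  proof (cases "0 \<le> t")
    case True then show ?thesis using \<nu>F sets_F by blast
  next
    case False
    have "\<not> \<nu> \<omega> \<le> t" for \<omega> using False \<nu>(1)[of \<omega>] by linarith
    then show ?thesis by simp
  qed
  then have \<nu>m[measurable]: "\<nu> \<in> borel_measurable M"
    by (rule borel_measurableI_le)
  define g where "g n \<omega> = grid_index T n (\<nu> \<omega>)" for n \<omega>
  define s where "s n j = T * real j / real n" for n j
  define X where "X n \<omega> = mart \<theta> (s n (g n \<omega>)) \<omega>" for n \<omega>
  define I :: "nat \<Rightarrow> nat \<Rightarrow> 'a \<Rightarrow> real"
    where "I n j \<omega> = indicator {\<omega> \<in> space M. g n \<omega> = j} \<omega>" for n j \<omega>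
  have s0: "0 \<le> s n j" for n j using T by (simp add: s_def)
  have sT: "s n j \<le> T" if "0 < n" "j \<le> n" for n j using T that by (simp add: s_def field_simps)
  have gm[measurable]: "g n \<in> measurable M (count_space UNIV)" for n
    unfolding g_def grid_index_def by measurable
  have gn: "g n \<omega> \<le> n" for n \<omega>
    unfolding g_def using T \<nu>(2) by (rule grid_index_le)
  note [measurable] = gbm_measurable[OF s0] gbm_measurable[OF less_imp_le[OF T]]
  have Xm[measurable]: "X n \<in> borel_measurable M" for n
    unfolding X_def by (rule measurable_compose_countable[OF _ gm]) measurable
  have Im[measurable]: "I n j \<in> borel_measurable M" for n j
    unfolding I_def by measurable
  \<comment> \<open>The event of selecting grid point \<open>j\<close> is a difference of two events
    \<open>\<nu> \<le> s\<close>. Index 0 has no predecessor, and natural subtraction would give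
    \<open>j - 1 = 0\<close> there.\<close>
  have I_eq: "I n j \<omega> = (if j = 0 then indicator {\<omega> \<in> space M. \<nu> \<omega> \<le> s n 0} \<omega> else
      indicator {\<omega> \<in> space M. \<nu> \<omega> \<le> s n j} \<omega> - indicator {\<omega> \<in> space M. \<nu> \<omega> \<le> s n (j - 1)} \<omega>)"
    if n: "0 < n" for n j \<omega>
  proof -
    have le: "g n \<omega> \<le> i \<longleftrightarrow> \<nu> \<omega> \<le> s n i" for i \<omega>
      unfolding g_def s_def by (rule grid_index_le_iff[OF T n])
    have "g n \<omega> = j \<longleftrightarrow> g n \<omega> \<le> j \<and> \<not> (j \<noteq> 0 \<and> g n \<omega> \<le> j - 1)" by auto
    moreover have "g n \<omega> \<le> j - 1 \<Longrightarrow> g n \<omega> \<le> j" by simp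
    ultimately show ?thesis
      using le[of \<omega>] by (auto simp: I_def indicator_def)
  qed
  have s_mono: "s n (j - 1) \<le> s n j" for n j
    using T by (auto simp: s_def intro!: divide_right_mono)
  have IF: "I n j \<in> borel_measurable (F (ennreal (s n j)))" if n: "0 < n" for n j
  proof -
    have 1: "(indicator {\<omega> \<in> space M. \<nu> \<omega> \<le> s n i} :: 'a \<Rightarrow> real) \<in> borel_measurable (F (ennreal (s n j)))" if "s n i \<le> s n j" for i
      using \<nu>F[OF s0, of n i] sets_F_mono[OF ennreal_leI[OF that]] by (intro borel_measurable_indicator) auto
    show ?thesis
      unfolding I_eq[OF n, abs_def] using 1[of j] 1[of "j - 1"] s_mono
      by (cases "j = 0") auto
  qed
  have ZIF: "(\<lambda>\<omega>. Z \<omega> * I n j \<omega>) \<in> borel_measurable (F (ennreal (s n j)))" if n: "0 < n" for n j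
  proof -
    have 1: "(\<lambda>\<omega>. Z \<omega> * indicator {\<omega> \<in> space M. \<nu> \<omega> \<le> s n i} \<omega>) \<in> borel_measurable (F (ennreal (s n j)))" if "s n i \<le> s n j" for i
      using ZF[OF s0, of n i] ennreal_leI[OF that] by (rule measurable_F_mono)
    show ?thesis
      unfolding I_eq[OF n] using 1[of j] 1[of "j - 1"] s_mono
      by (cases "j = 0") (auto simp: right_diff_distrib)
  qed
  have I01: "0 \<le> I n j \<omega>" "I n j \<omega> \<le> 1" "\<bar>I n j \<omega>\<bar> \<le> 1" for n j \<omega>
    by (auto simp: I_def indicator_def)
  have ZI_C: "\<bar>Z \<omega> * I n j \<omega>\<bar> \<le> C" for n j \<omega>
    using mult_mono[OF ZC[of \<omega>] I01(3)[of n j \<omega>]] order_trans[OF abs_ge_zero ZC[of \<omega>]]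
    by (simp add: abs_mult)
  have part: "h (g n \<omega>) = (\<Sum>j\<le>n. I n j \<omega> * h j)" if "\<omega> \<in> space M" for h :: "nat \<Rightarrow> real" and n \<omega>
  proof -
    have "(\<Sum>j\<le>n. I n j \<omega> * h j) = (\<Sum>j\<le>n. if j = g n \<omega> then h j else 0)"
      using that by (intro sum.cong) (auto simp: I_def)
    then show ?thesis using gn[of n \<omega>] by simp
  qed
  define Q where "Q = (\<integral>\<omega>. (mart \<theta> T \<omega>)\<^sup>2 \<partial>M)"
  have mT: "integrable M (mart \<theta> T)" "integrable M (\<lambda>\<omega>. (mart \<theta> T \<omega>)\<^sup>2)"
    using T by (auto intro: mart_integrable gbm_second_moment)
  have X2: "integrable M (\<lambda>\<omega>. (X n \<omega>)\<^sup>2) \<and> (\<integral>\<omega>. (X n \<omega>)\<^sup>2 \<partial>M) \<le> Q" if n: "0 < n" for n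
  proof -
    have eq: "(X n \<omega>)\<^sup>2 = (\<Sum>j\<le>n. I n j \<omega> * (mart \<theta> (s n j) \<omega>)\<^sup>2)" if "\<omega> \<in> space M" for \<omega>
      unfolding X_def by (rule part[OF that])
    have i: "integrable M (\<lambda>\<omega>. I n j \<omega> * (mart \<theta> t \<omega>)\<^sup>2)" if "0 \<le> t" for j t
      by (rule bounded_mult_integrable[OF gbm_second_moment(1)[OF that] Im I01(3)])
    have int: "integrable M (\<lambda>\<omega>. \<Sum>j\<le>n. I n j \<omega> * (mart \<theta> (s n j) \<omega>)\<^sup>2)"
      by (intro Bochner_Integration.integrable_sum i s0)
    have "(\<integral>\<omega>. (X n \<omega>)\<^sup>2 \<partial>M) = (\<integral>\<omega>. (\<Sum>j\<le>n. I n j \<omega> * (mart \<theta> (s n j) \<omega>)\<^sup>2) \<partial>M)"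
      by (rule Bochner_Integration.integral_cong) (use eq in auto)
    also have "\<dots> = (\<Sum>j\<le>n. \<integral>\<omega>. I n j \<omega> * (mart \<theta> (s n j) \<omega>)\<^sup>2 \<partial>M)"
      by (rule Bochner_Integration.integral_sum) (intro i s0)
    \<comment> \<open>The square is a submartingale, so the second moment is compared with the
      horizon \<open>T\<close>, uniformly in the mesh.\<close>
    also have "\<dots> \<le> (\<Sum>j\<le>n. \<integral>\<omega>. I n j \<omega> * (mart \<theta> T \<omega>)\<^sup>2 \<partial>M)"
      using n sT by (intro sum_mono mart_step(2)[OF s0 _ IF[OF n] I01(3)] I01(1)) auto
    also have "\<dots> = (\<integral>\<omega>. (\<Sum>j\<le>n. I n j \<omega> * (mart \<theta> T \<omega>)\<^sup>2) \<partial>M)"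
      by (rule Bochner_Integration.integral_sum[symmetric]) (intro i less_imp_le[OF T])
    also have "\<dots> = Q"
      unfolding Q_def by (rule Bochner_Integration.integral_cong) (use part[of _ "\<lambda>_. (mart \<theta> T _)\<^sup>2"] in auto)
    finally show ?thesis
      using int by (subst Bochner_Integration.integrable_cong[OF refl eq]) auto
  qed
  have ZX: "(\<integral>\<omega>. Z \<omega> * X n \<omega> \<partial>M) = (\<integral>\<omega>. Z \<omega> * mart \<theta> T \<omega> \<partial>M)" if n: "0 < n" for n
  proof -
    have i: "integrable M (\<lambda>\<omega>. (Z \<omega> * I n j \<omega>) * mart \<theta> t \<omega>)" if "0 \<le> t" for j t
      by (rule bounded_mult_integrable[OF mart_integrable[OF that] _ ZI_C]) measurable
    have "(\<integral>\<omega>. Z \<omega> * X n \<omega> \<partial>M) = (\<integral>\<omega>. (\<Sum>j\<le>n. (Z \<omega> * I n j \<omega>) * mart \<theta> (s n j) \<omega>) \<partial>M)"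
    proof (rule Bochner_Integration.integral_cong)
      fix \<omega> assume "\<omega> \<in> space M"
      then show "Z \<omega> * X n \<omega> = (\<Sum>j\<le>n. (Z \<omega> * I n j \<omega>) * mart \<theta> (s n j) \<omega>)"
        using part[of \<omega> "\<lambda>j. mart \<theta> (s n j) \<omega>" n] by (simp add: X_def sum_distrib_left mult.assoc)
    qed simp
    also have "\<dots> = (\<Sum>j\<le>n. \<integral>\<omega>. (Z \<omega> * I n j \<omega>) * mart \<theta> (s n j) \<omega> \<partial>M)"
      by (rule Bochner_Integration.integral_sum) (intro i s0)
    also have "\<dots> = (\<Sum>j\<le>n. \<integral>\<omega>. (Z \<omega> * I n j \<omega>) * mart \<theta> T \<omega> \<partial>M)"
      using n sT by (intro sum.cong refl mart_step(1)[OF s0 _ ZIF[OF n] ZI_C, symmetric]) auto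
    also have "\<dots> = (\<integral>\<omega>. (\<Sum>j\<le>n. (Z \<omega> * I n j \<omega>) * mart \<theta> T \<omega>) \<partial>M)"
      by (rule Bochner_Integration.integral_sum[symmetric]) (intro i less_imp_le[OF T])
    also have "\<dots> = (\<integral>\<omega>. Z \<omega> * mart \<theta> T \<omega> \<partial>M)"
    proof (rule Bochner_Integration.integral_cong)
      fix \<omega> assume "\<omega> \<in> space M"
      then show "(\<Sum>j\<le>n. (Z \<omega> * I n j \<omega>) * mart \<theta> T \<omega>) = Z \<omega> * mart \<theta> T \<omega>"
        using part[of \<omega> "\<lambda>j. mart \<theta> T \<omega>" n] by (simp add: sum_distrib_left[symmetric] mult.assoc)
    qed simp
    finally show ?thesis .
  qed
  \<comment> \<open>The shift by one avoids the empty grid \<open>n = 0\<close>, on which neither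
    the moment bound nor the martingale identity is available.\<close>
  have lim: "(\<lambda>n. X (Suc n) \<omega>) \<longlonglongrightarrow> mart \<theta> (\<nu> \<omega>) \<omega>" for \<omega>
  proof -
    have "(\<lambda>n. s n (g n \<omega>)) \<longlonglongrightarrow> \<nu> \<omega>"
      unfolding s_def g_def by (rule grid_index_tendsto[OF T \<nu>(1)])
    then have l: "(\<lambda>n. s (Suc n) (g (Suc n) \<omega>)) \<longlonglongrightarrow> \<nu> \<omega>"
      by (rule LIMSEQ_Suc)
    show ?thesis
      unfolding X_def
      by (rule continuous_on_tendsto_compose[OF gbm_cont l]) (use \<nu> s0 in auto)
  qed
  have m\<nu>: "(\<lambda>\<omega>. mart \<theta> (\<nu> \<omega>) \<omega>) \<in> borel_measurable M"
    by (rule borel_measurable_LIMSEQ_real[OF lim]) measurable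
  note conv = L2_bounded_tendsto[OF Xm m\<nu> _ lim _ _ Z ZC, of Q]
  have Y2: "integrable M (\<lambda>\<omega>. (mart \<theta> (\<nu> \<omega>) \<omega>)\<^sup>2)"
    by (rule conv(1)) (use X2 in \<open>auto simp: X_def mart_pos less_imp_le\<close>)
  show "integrable M (\<lambda>\<omega>. Z \<omega> * mart \<theta> (\<nu> \<omega>) \<omega>)"
    by (rule bounded_mult_integrable[OF _ Z ZC]) (rule square_integrable_imp_integrable[OF m\<nu> Y2])
  have "(\<lambda>n. \<integral>\<omega>. Z \<omega> * X (Suc n) \<omega> \<partial>M) \<longlonglongrightarrow> (\<integral>\<omega>. Z \<omega> * mart \<theta> (\<nu> \<omega>) \<omega> \<partial>M)"
    by (rule conv(2)) (use X2 in \<open>auto simp: X_def mart_pos less_imp_le\<close>)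
  then show "(\<integral>\<omega>. Z \<omega> * mart \<theta> (\<nu> \<omega>) \<omega> \<partial>M) = (\<integral>\<omega>. Z \<omega> * mart \<theta> T \<omega> \<partial>M)"
    by (simp add: ZX LIMSEQ_const_iff)
qed

end

subsection \<open>Stopped processes\<close>

lemma (in prob_space) fatou_tendsto:
  fixes f :: "nat \<Rightarrow> 'a \<Rightarrow> real"
  assumes f: "\<And>n. integrable M (f n)" "\<And>n \<omega>. 0 \<le> f n \<omega>" and g: "g \<in> borel_measurable M" "\<And>\<omega>. 0 \<le> g \<omega>"
    and lim: "AE \<omega> in M. (\<lambda>n. f n \<omega>) \<longlonglongrightarrow> g \<omega>" and L: "(\<lambda>n. \<integral>\<omega>. f n \<omega> \<partial>M) \<longlonglongrightarrow> L"
  shows "integrable M g" "(\<integral>\<omega>. g \<omega> \<partial>M) \<le> L"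
proof -
  have L0: "0 \<le> L"
    using L f(2) by (intro LIMSEQ_le_const) auto
  have "(\<integral>\<^sup>+\<omega>. ennreal (g \<omega>) \<partial>M) = (\<integral>\<^sup>+\<omega>. liminf (\<lambda>n. ennreal (f n \<omega>)) \<partial>M)"
  proof (rule nn_integral_cong_AE, use lim in eventually_elim)
    case (elim \<omega>)
    then have "(\<lambda>n. ennreal (f n \<omega>)) \<longlonglongrightarrow> ennreal (g \<omega>)" by (rule tendsto_ennrealI)
    then show ?case by (rule lim_imp_Liminf[OF trivial_limit_sequentially, symmetric])
  qed
  also have "\<dots> \<le> liminf (\<lambda>n. \<integral>\<^sup>+\<omega>. ennreal (f n \<omega>) \<partial>M)"
    by (rule nn_integral_liminf) (use f in measurable)
  also have "(\<lambda>n. \<integral>\<^sup>+\<omega>. ennreal (f n \<omega>) \<partial>M) = (\<lambda>n. ennreal (\<integral>\<omega>. f n \<omega> \<partial>M))"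
    using f by (intro ext nn_integral_eq_integral) auto
  also have "liminf \<dots> = ennreal L"
    using tendsto_ennrealI[OF L] by (rule lim_imp_Liminf[OF trivial_limit_sequentially])
  finally have le: "(\<integral>\<^sup>+\<omega>. ennreal (g \<omega>) \<partial>M) \<le> ennreal L" .
  also have "\<dots> < \<infinity>" by simp
  finally show i: "integrable M g"
    using g by (intro integrableI_nonneg) auto
  show "(\<integral>\<omega>. g \<omega> \<partial>M) \<le> L"
    using le g L0 by (subst (asm) nn_integral_eq_integral[OF i]) auto
qed

context brownian_space
begin

text \<open>The value 0 at infinity encodes the limit price, and for a weight it removes the event
  that nothing is bought.\<close>

definition value_at :: "(real \<Rightarrow> 'a \<Rightarrow> real) \<Rightarrow> ('a \<Rightarrow> ennreal) \<Rightarrow> 'a \<Rightarrow> real" where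
  "value_at \<phi> \<tau> \<omega> = (if \<tau> \<omega> = \<infinity> then 0 else \<phi> (enn2real (\<tau> \<omega>)) \<omega>)"

definition capped :: "('a \<Rightarrow> ennreal) \<Rightarrow> real \<Rightarrow> 'a \<Rightarrow> real" where
  "capped \<tau> t \<omega> = enn2real (min (\<tau> \<omega>) (ennreal t))"

definition continuous_adapted :: "(real \<Rightarrow> 'a \<Rightarrow> real) \<Rightarrow> bool" where
  "continuous_adapted \<phi> \<longleftrightarrow> adapted F \<phi> \<and> (\<forall>\<omega>. continuous_on {0..} (\<lambda>t. \<phi> t \<omega>))"

lemma capped_bounds: "0 \<le> t \<Longrightarrow> 0 \<le> capped \<tau> t \<omega>" "0 \<le> t \<Longrightarrow> capped \<tau> t \<omega> \<le> t"
  by (cases "\<tau> \<omega>"; simp add: capped_def min_def)+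

lemma capped_le_iff: "0 \<le> t \<Longrightarrow> 0 \<le> s \<Longrightarrow> capped \<tau> t \<omega> \<le> s \<longleftrightarrow> t \<le> s \<or> \<tau> \<omega> \<le> ennreal s"
  by (cases "\<tau> \<omega>") (auto simp: capped_def min_def top_unique)

lemma capped_eq: "\<tau> \<omega> \<le> ennreal t \<Longrightarrow> capped \<tau> t \<omega> = enn2real (\<tau> \<omega>)"
  by (simp add: capped_def min_def)

lemma capped_infinite: "\<tau> \<omega> = \<infinity> \<Longrightarrow> 0 \<le> t \<Longrightarrow> capped \<tau> t \<omega> = t"
  by (simp add: capped_def min_def top_unique)

lemma eventually_le_real: "x \<noteq> \<infinity> \<Longrightarrow> \<forall>\<^sub>F n in sequentially. (x::ennreal) \<le> ennreal (real n)"
proof (cases x)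
  case (real r)
  obtain N :: nat where "r \<le> real N" using real_arch_simple by blast
  then have "x \<le> ennreal (real n)" if "N \<le> n" for n
    using that real by (auto intro!: ennreal_leI)
  then show ?thesis by (auto simp: eventually_sequentially)
qed simp

lemma stopping_sets: "stopping_time F \<tau> \<Longrightarrow> {\<omega> \<in> space M. \<tau> \<omega> \<le> t} \<in> sets (F t)"
  using predE[OF stopping_timeD[of F \<tau> t]] by simp

lemma stopping_measurable: "stopping_time F \<tau> \<Longrightarrow> \<tau> \<in> borel_measurable M"
  by (rule measurable_stopping_time[OF _ sets_F space_F])

lemma capped_sets:
  assumes "stopping_time F \<tau>" "0 \<le> t" "0 \<le> s"
  shows "{\<omega> \<in> space M. capped \<tau> t \<omega> \<le> s} \<in> sets (F (ennreal s))"
proof (cases "t \<le> s")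
  case True
  then have "{\<omega> \<in> space M. capped \<tau> t \<omega> \<le> s} = space (F (ennreal s))"
    using assms by (auto simp: capped_le_iff)
  then show ?thesis using sets.top[of "F (ennreal s)"] by simp
next
  case False
  then have "{\<omega> \<in> space M. capped \<tau> t \<omega> \<le> s} = {\<omega> \<in> space M. \<tau> \<omega> \<le> ennreal s}"
    using assms by (auto simp: capped_le_iff)
  then show ?thesis using stopping_sets[OF assms(1)] by simp
qed

lemma capped_measurable:
  assumes "stopping_time F \<tau>" "0 \<le> t"
  shows "capped \<tau> t \<in> borel_measurable (F (ennreal t))"
proof (rule borel_measurableI_le)
  fix s
  consider "s < 0" | "0 \<le> s" "s \<le> t" | "t < s" by linarith
  then show "{\<omega> \<in> space (F (ennreal t)). capped \<tau> t \<omega> \<le> s} \<in> sets (F (ennreal t))"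
  proof cases
    case 1
    have "\<not> capped \<tau> t \<omega> \<le> s" for \<omega> using capped_bounds(1)[OF assms(2), of \<tau> \<omega>] 1 by linarith
    then show ?thesis by simp
  next
    case 2
    then show ?thesis
      using capped_sets[OF assms, of s] sets_F_mono[OF ennreal_leI[of s t]] by auto
  next
    case 3
    have "capped \<tau> t \<omega> \<le> s" for \<omega> using capped_bounds(2)[OF assms(2), of \<tau> \<omega>] 3 by linarith
    then have "{\<omega> \<in> space (F (ennreal t)). capped \<tau> t \<omega> \<le> s} = space (F (ennreal t))" by auto
    then show ?thesis using sets.top by metis
  qed
qed

lemma continuous_adapted_F:
  "continuous_adapted \<phi> \<Longrightarrow> 0 \<le> s \<Longrightarrow> s \<le> t \<Longrightarrow> \<phi> s \<in> borel_measurable (F (ennreal t))"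
  using measurable_F_mono[of "\<phi> s" "ennreal s" borel "ennreal t"]
  by (simp add: continuous_adapted_def adapted_def ennreal_leI)

lemma continuous_adapted_cont: "continuous_adapted \<phi> \<Longrightarrow> continuous_on {0..} (\<lambda>t. \<phi> t \<omega>)"
  by (simp add: continuous_adapted_def)

text \<open>Progressive measurability by discretisation: the stopped value is a limit of values at
  rounded times, and at each of those countably many times the process is measurable.\<close>

lemma stopped_measurable:
  assumes \<phi>: "continuous_adapted \<phi>" and \<tau>: "stopping_time F \<tau>" and t: "0 \<le> t"
  shows "(\<lambda>\<omega>. \<phi> (capped \<tau> t \<omega>) \<omega>) \<in> borel_measurable (F (ennreal t))"
proof (cases "t = 0")
  case True
  have "capped \<tau> 0 \<omega> = 0" for \<omega>
    using capped_bounds[of 0 \<tau> \<omega>] by simp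
  then show ?thesis using continuous_adapted_F[OF \<phi>, of 0 0] True by simp
next
  case False
  then have T: "0 < t" using t by simp
  define g where "g n \<omega> = grid_index t n (capped \<tau> t \<omega>)" for n \<omega>
  \<comment> \<open>Clipping the index at \<open>n\<close> keeps every grid time at most
    \<open>t\<close>, so measurability at time \<open>t\<close> holds for all indices, including
    those that the rounding never selects.\<close>
  define s where "s n j = t * real (min j n) / real n" for n j
  have s: "0 \<le> s n j" "s n j \<le> t" for n j
  proof -
    show "0 \<le> s n j" using T by (simp add: s_def)
    have "real (min j n) \<le> real n" by simp
    then show "s n j \<le> t" using T by (cases "n = 0") (auto simp: s_def field_simps)
  qed
  have gle: "g n \<omega> \<le> n" for n \<omega>
    unfolding g_def by (rule grid_index_le[OF T capped_bounds(2)[OF t]])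
  have [measurable]: "capped \<tau> t \<in> borel_measurable (F (ennreal t))"
    using \<tau> t by (rule capped_measurable)
  have gm: "g n \<in> measurable (F (ennreal t)) (count_space UNIV)" for n
    unfolding g_def grid_index_def by measurable
  have lim: "(\<lambda>n. \<phi> (s n (g n \<omega>)) \<omega>) \<longlonglongrightarrow> \<phi> (capped \<tau> t \<omega>) \<omega>" for \<omega>
  proof (rule continuous_on_tendsto_compose[OF continuous_adapted_cont[OF \<phi>]])
    show "(\<lambda>n. s n (g n \<omega>)) \<longlonglongrightarrow> capped \<tau> t \<omega>"
      using grid_index_tendsto[OF T capped_bounds(1)[OF t]] gle by (simp add: s_def g_def min_def)
  qed (use s capped_bounds(1)[OF t] in auto)
  show ?thesis
  proof (rule borel_measurable_LIMSEQ_real[OF lim])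
    show "(\<lambda>\<omega>. \<phi> (s n (g n \<omega>)) \<omega>) \<in> borel_measurable (F (ennreal t))" for n
      by (rule measurable_compose_countable[OF continuous_adapted_F[OF \<phi> s] gm])
  qed
qed

lemma value_at_measurable:
  assumes \<phi>: "continuous_adapted \<phi>" and \<tau>: "stopping_time F \<tau>"
  shows "value_at \<phi> \<tau> \<in> borel_measurable M"
proof (rule borel_measurable_LIMSEQ_real)
  show "(\<lambda>n. \<phi> (capped \<tau> (real n) \<omega>) \<omega> * (if \<tau> \<omega> \<le> ennreal (real n) then 1 else 0)) \<longlonglongrightarrow> value_at \<phi> \<tau> \<omega>" for \<omega>
  proof (cases "\<tau> \<omega> = \<infinity>")
    case False
    have "\<forall>\<^sub>F n in sequentially. \<phi> (capped \<tau> (real n) \<omega>) \<omega> * (if \<tau> \<omega> \<le> ennreal (real n) then 1 else 0) = value_at \<phi> \<tau> \<omega>"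
      using eventually_le_real[OF False] by eventually_elim (use False in \<open>simp add: capped_eq value_at_def\<close>)
    then show ?thesis by (rule tendsto_eventually)
  qed (simp add: value_at_def top_unique)
  show "(\<lambda>\<omega>. \<phi> (capped \<tau> (real n) \<omega>) \<omega> * (if \<tau> \<omega> \<le> ennreal (real n) then 1 else 0)) \<in> borel_measurable M" for n
  proof -
    have [measurable]: "\<tau> \<in> borel_measurable M" using \<tau> by (rule stopping_measurable)
    have [measurable]: "(\<lambda>\<omega>. \<phi> (capped \<tau> (real n) \<omega>) \<omega>) \<in> borel_measurable M"
      by (rule measurable_F_M[OF stopped_measurable[OF \<phi> \<tau>]]) simp
    show ?thesis by measurable
  qed
qed

subsection \<open>Optional stopping at unbounded times\<close>

text \<open>The square root of the martingale has mean
  \<open>exp (- \<theta>\<^sup>2 / 8) ^ n\<close> at time \<open>n\<close>. These means are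
  summable, so almost surely the series of square roots converges and its terms vanish. Integer
  times suffice, as all caps are integers.\<close>

lemma mart_tendsto_0:
  assumes "\<theta> \<noteq> 0"
  shows "AE \<omega> in M. (\<lambda>n. mart \<theta> (real n) \<omega>) \<longlonglongrightarrow> 0"
proof -
  define e where "e n \<omega> = exp (\<theta> / 2 * W (real n) \<omega>) * exp (- \<theta>\<^sup>2 / 4 * real n)" for n \<omega>
  define r where "r = exp (- \<theta>\<^sup>2 / 8)"
  have r: "0 < r" "r < 1" using assms by (auto simp: r_def)
  have m[measurable]: "e n \<in> borel_measurable M" for n
    unfolding e_def using W_measurable[of "real n"] by measurable
  have e_exp: "(\<integral>\<^sup>+\<omega>. ennreal (e n \<omega>) \<partial>M) = ennreal (r ^ n)" for n
  proof (cases "n = 0")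
    case True
    then show ?thesis by (simp add: e_def emeasure_space_1)
  next
    case False
    then have n: "0 < real n" by simp
    note x = exp_increment[OF order_refl n, of "\<theta> / 2", simplified]
    have i: "integrable M (e n)"
      unfolding e_def using x(1) by (intro integrable_mult_left) simp
    have "(\<integral>\<omega>. e n \<omega> \<partial>M) = exp ((\<theta> / 2)\<^sup>2 * real n / 2) * exp (- \<theta>\<^sup>2 / 4 * real n)"
      unfolding e_def using x(2) by simp
    also have "\<dots> = r ^ n"
      by (simp add: r_def exp_of_nat_mult[symmetric] exp_add[symmetric] power_divide)
    finally have "(\<integral>\<omega>. e n \<omega> \<partial>M) = r ^ n" .
    moreover have "(\<integral>\<^sup>+\<omega>. ennreal (e n \<omega>) \<partial>M) = ennreal (\<integral>\<omega>. e n \<omega> \<partial>M)"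
      by (rule nn_integral_eq_integral[OF i]) (simp add: e_def)
    ultimately show ?thesis by simp
  qed
  have "(\<integral>\<^sup>+\<omega>. (\<Sum>n. ennreal (e n \<omega>)) \<partial>M) = (\<Sum>n. ennreal (r ^ n))"
    by (subst nn_integral_suminf) (auto simp: e_exp)
  also have "\<dots> \<noteq> \<infinity>"
    using r by (simp add: suminf_ennreal2 summable_geometric)
  finally have "AE \<omega> in M. (\<Sum>n. ennreal (e n \<omega>)) \<noteq> \<infinity>"
    by (intro nn_integral_PInf_AE) auto
  then show ?thesis
  proof eventually_elim
    case (elim \<omega>)
    then have "summable (\<lambda>n. e n \<omega>)"
      by (intro summable_suminf_not_top) (auto simp: e_def)
    then have "(\<lambda>n. (e n \<omega>)\<^sup>2) \<longlonglongrightarrow> 0\<^sup>2"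
      by (intro tendsto_power summable_LIMSEQ_zero)
    moreover have "(e n \<omega>)\<^sup>2 = mart \<theta> (real n) \<omega>" for n
      unfolding e_def gbm_def power_mult_distrib exp_double[symmetric] by (simp add: exp_add[symmetric])
    ultimately show ?case by simp
  qed
qed

lemma gbm_continuous_adapted: "continuous_adapted (gbm \<mu> \<sigma> q)"
  using gbm_measurable_F gbm_cont by (simp add: continuous_adapted_def adapted_def)

lemma stopped_mart_tendsto:
  assumes lim0: "(\<lambda>n. mart \<theta> (real n) \<omega>) \<longlonglongrightarrow> 0"
  shows "(\<lambda>n. mart \<theta> (capped \<rho> (real n) \<omega>) \<omega>) \<longlonglongrightarrow> value_at (mart \<theta>) \<rho> \<omega>"
proof (cases "\<rho> \<omega> = \<infinity>")
  case True
  then show ?thesis using lim0 by (simp add: value_at_def capped_infinite)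
next
  case False
  have "\<forall>\<^sub>F n in sequentially. mart \<theta> (capped \<rho> (real n) \<omega>) \<omega> = value_at (mart \<theta>) \<rho> \<omega>"
    using eventually_le_real[OF False] by eventually_elim (use False in \<open>simp add: capped_eq value_at_def\<close>)
  then show ?thesis by (rule tendsto_eventually)
qed

lemma value_at_mart_nonneg: "0 \<le> value_at (mart \<theta>) \<rho> \<omega>"
  by (simp add: value_at_def mart_pos less_imp_le)

text \<open>At bounded times the mean is 1. Fatou only gives an inequality in the limit, since mass
  may be lost on the event of never stopping.\<close>

lemma value_at_mart_integrable:
  assumes \<theta>: "\<theta> \<noteq> 0" and \<rho>: "stopping_time F \<rho>"
  shows "integrable M (value_at (mart \<theta>) \<rho>) \<and> (\<integral>\<omega>. value_at (mart \<theta>) \<rho> \<omega> \<partial>M) \<le> 1"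
proof -
  have os: "integrable M (\<lambda>\<omega>. 1 * mart \<theta> (capped \<rho> (real (Suc n)) \<omega>) \<omega>)"
    "(\<integral>\<omega>. 1 * mart \<theta> (capped \<rho> (real (Suc n)) \<omega>) \<omega> \<partial>M) = (\<integral>\<omega>. 1 * mart \<theta> (real (Suc n)) \<omega> \<partial>M)" for n
    using optional_stopping_bounded[of "real (Suc n)" "capped \<rho> (real (Suc n))" "\<lambda>_. 1" 1 \<theta>]
      capped_bounds[of "real (Suc n)"] capped_sets[OF \<rho>, of "real (Suc n)"]
    by (auto intro!: borel_measurable_indicator)
  have "(\<integral>\<omega>. 1 * mart \<theta> (real (Suc n)) \<omega> \<partial>M) = 1" for n
    using mart_step(1)[of 0 "real (Suc n)" "\<lambda>_. 1" 1 \<theta>] by (simp add: prob_space)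
  with os have os': "integrable M (\<lambda>\<omega>. mart \<theta> (capped \<rho> (real (Suc n)) \<omega>) \<omega>)"
    "(\<integral>\<omega>. mart \<theta> (capped \<rho> (real (Suc n)) \<omega>) \<omega> \<partial>M) = 1" for n by auto
  have lim: "AE \<omega> in M. (\<lambda>n. mart \<theta> (capped \<rho> (real (Suc n)) \<omega>) \<omega>) \<longlonglongrightarrow> value_at (mart \<theta>) \<rho> \<omega>"
    using mart_tendsto_0[OF \<theta>]
  proof eventually_elim
    case (elim \<omega>)
    then have "(\<lambda>n. mart \<theta> (capped \<rho> (real n) \<omega>) \<omega>) \<longlonglongrightarrow> value_at (mart \<theta>) \<rho> \<omega>"
      by (rule stopped_mart_tendsto)
    then show ?case by (rule LIMSEQ_Suc)
  qed
  show ?thesis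
    using fatou_tendsto[OF os'(1) _ value_at_measurable[OF gbm_continuous_adapted \<rho>] value_at_mart_nonneg lim, of 1] os'(2)
    by (simp add: mart_pos less_imp_le)
qed

section \<open>Optional stopping between two times, with a bounded weight fixed at the earlier
  one\<close>

context
  fixes \<tau> \<nu> :: "'a \<Rightarrow> ennreal" and \<eta> :: "real \<Rightarrow> 'a \<Rightarrow> real" and C :: real
  assumes \<tau>: "stopping_time F \<tau>" and \<nu>: "stopping_time F \<nu>" and le: "\<And>\<omega>. \<omega> \<in> space M \<Longrightarrow> \<tau> \<omega> \<le> \<nu> \<omega>"
    and \<eta>: "continuous_adapted \<eta>" and \<eta>C: "\<And>t \<omega>. 0 \<le> t \<Longrightarrow> 0 \<le> \<eta> t \<omega>" "\<And>t \<omega>. 0 \<le> t \<Longrightarrow> \<eta> t \<omega> \<le> C"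
begin

definition weight :: "real \<Rightarrow> 'a \<Rightarrow> real" where
  "weight N \<omega> = \<eta> (capped \<tau> N \<omega>) \<omega> * indicator {\<omega> \<in> space M. \<tau> \<omega> \<le> ennreal N} \<omega>"

lemma weight_bounds:
  assumes "0 \<le> N" shows "0 \<le> weight N \<omega>" "\<bar>weight N \<omega>\<bar> \<le> C"
proof -
  have "0 \<le> \<eta> 0 \<omega>" "\<eta> 0 \<omega> \<le> C" using \<eta>C[of 0 \<omega>] by auto
  then show "0 \<le> weight N \<omega>" "\<bar>weight N \<omega>\<bar> \<le> C"
    using \<eta>C[OF capped_bounds(1)[OF assms], of \<tau> \<omega> \<omega>] by (auto simp: weight_def indicator_def)
qed

lemma weight_measurable:
  assumes "0 \<le> t" shows "weight t \<in> borel_measurable (F (ennreal t))"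
  unfolding weight_def[abs_def]
  using stopped_measurable[OF \<eta> \<tau> assms] stopping_sets[OF \<tau>, of "ennreal t"]
  by (intro borel_measurable_times borel_measurable_indicator)

text \<open>The right-hand side does not mention \<open>\<rho>\<close>, so any two stopping times
  after \<open>\<tau>\<close> give the same weighted mean at a finite horizon; the purchase time
  itself is one of them.\<close>

lemma weighted_stopping:
  assumes N: "0 < N" and \<rho>: "stopping_time F \<rho>" "\<And>\<omega>. \<omega> \<in> space M \<Longrightarrow> \<tau> \<omega> \<le> \<rho> \<omega>"
  shows "integrable M (\<lambda>\<omega>. weight N \<omega> * mart \<theta> (capped \<rho> N \<omega>) \<omega>)"
    and "(\<integral>\<omega>. weight N \<omega> * mart \<theta> (capped \<rho> N \<omega>) \<omega> \<partial>M) = (\<integral>\<omega>. weight N \<omega> * mart \<theta> N \<omega> \<partial>M)"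
proof -
  have N0: "0 \<le> N" using N by simp
  have m: "(\<lambda>\<omega>. weight N \<omega> * indicator {\<omega> \<in> space M. capped \<rho> N \<omega> \<le> t} \<omega>) \<in> borel_measurable (F (ennreal t))"
    if t: "0 \<le> t" for t
  proof (cases "N \<le> t")
    case True
    have "weight N \<in> borel_measurable (F (ennreal t))"
      using weight_measurable[OF N0] ennreal_leI[OF True] by (rule measurable_F_mono)
    then show ?thesis
      using capped_sets[OF \<rho>(1) N0 t] by (intro borel_measurable_times borel_measurable_indicator)
  next
    case False
    have m0: "(\<lambda>\<omega>. weight t \<omega> * indicator {\<omega> \<in> space M. \<rho> \<omega> \<le> ennreal t} \<omega>) \<in> borel_measurable (F (ennreal t))"
      using weight_measurable[OF t] stopping_sets[OF \<rho>(1), of "ennreal t"]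
      by (intro borel_measurable_times borel_measurable_indicator)
    \<comment> \<open>If \<open>\<rho>\<close> has occurred by \<open>t\<close>, so has
      \<open>\<tau>\<close>, and the weight for horizon \<open>N\<close> is already the one for
      horizon \<open>t\<close>. This is how the weight is known at time
      \<open>\<rho>\<close>.\<close>
    have eq: "weight t \<omega> * indicator {\<omega> \<in> space M. \<rho> \<omega> \<le> ennreal t} \<omega> =
        weight N \<omega> * indicator {\<omega> \<in> space M. capped \<rho> N \<omega> \<le> t} \<omega>" if "\<omega> \<in> space (F (ennreal t))" for \<omega>
    proof (cases "\<rho> \<omega> \<le> ennreal t")
      case True
      have \<omega>: "\<omega> \<in> space M" using that by simp
      have "\<tau> \<omega> \<le> ennreal t" using \<rho>(2)[OF \<omega>] True by simp
      moreover have "ennreal t \<le> ennreal N" using False by (intro ennreal_leI) simp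
      ultimately have "\<tau> \<omega> \<le> ennreal t" "\<tau> \<omega> \<le> ennreal N" by auto
      then show ?thesis
        using True \<omega> capped_le_iff[OF N0 t, of \<rho> \<omega>] by (simp add: weight_def capped_eq)
    next
      case False
      then show ?thesis
        using \<open>\<not> N \<le> t\<close> capped_le_iff[OF N0 t, of \<rho> \<omega>] by simp
    qed
    show ?thesis
      by (rule iffD1[OF measurable_cong[OF eq] m0])
  qed
  note os = optional_stopping_bounded[OF N capped_bounds[OF N0] capped_sets[OF \<rho>(1) N0] m weight_bounds(2)[OF N0]]
  show "integrable M (\<lambda>\<omega>. weight N \<omega> * mart \<theta> (capped \<rho> N \<omega>) \<omega>)"
    by (rule os(1))
  show "(\<integral>\<omega>. weight N \<omega> * mart \<theta> (capped \<rho> N \<omega>) \<omega> \<partial>M) = (\<integral>\<omega>. weight N \<omega> * mart \<theta> N \<omega> \<partial>M)"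
    by (rule os(2))
qed

lemma weight_tendsto:
  assumes lim0: "(\<lambda>n. mart \<theta> (real n) \<omega>) \<longlonglongrightarrow> 0" and \<omega>: "\<omega> \<in> space M"
  shows "(\<lambda>n. weight (real n) \<omega> * mart \<theta> (capped \<rho> (real n) \<omega>) \<omega>) \<longlonglongrightarrow> value_at \<eta> \<tau> \<omega> * value_at (mart \<theta>) \<rho> \<omega>"
proof (cases "\<tau> \<omega> = \<infinity>")
  case True
  then show ?thesis by (simp add: weight_def value_at_def top_unique)
next
  case False
  have w: "\<forall>\<^sub>F n in sequentially. weight (real n) \<omega> = value_at \<eta> \<tau> \<omega>"
    using eventually_le_real[OF False]
    by eventually_elim (use \<omega> False in \<open>simp add: weight_def capped_eq value_at_def\<close>)
  from tendsto_eventually[OF w] stopped_mart_tendsto[OF lim0] show ?thesis by (rule tendsto_mult)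
qed

lemma value_at_weight_bounds: "0 \<le> value_at \<eta> \<tau> \<omega>" "0 \<le> value_at (mart \<theta>) \<rho> \<omega>" "value_at \<eta> \<tau> \<omega> \<le> C"
  using \<eta>C[of "enn2real (\<tau> \<omega>)" \<omega>] \<eta>C[of 0 \<omega>] mart_pos[of \<theta> _ \<omega>] by (auto simp: value_at_def less_imp_le)

text \<open>At each finite horizon the sale time is exchanged for the purchase time. On the support
  of the weight the stopped value is then already final, so a multiple of that value
  dominates.\<close>

lemma weighted_limit:
  assumes \<theta>: "\<theta> \<noteq> 0"
  shows "(\<lambda>n. \<integral>\<omega>. weight (real (Suc n)) \<omega> * mart \<theta> (capped \<nu> (real (Suc n)) \<omega>) \<omega> \<partial>M)
    \<longlonglongrightarrow> (\<integral>\<omega>. value_at \<eta> \<tau> \<omega> * value_at (mart \<theta>) \<tau> \<omega> \<partial>M)"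
proof -
  note m = value_at_measurable[OF \<eta> \<tau>] value_at_measurable[OF gbm_continuous_adapted \<tau>]
  have "(\<integral>\<omega>. weight (real (Suc n)) \<omega> * mart \<theta> (capped \<nu> (real (Suc n)) \<omega>) \<omega> \<partial>M)
    = (\<integral>\<omega>. weight (real (Suc n)) \<omega> * mart \<theta> (capped \<tau> (real (Suc n)) \<omega>) \<omega> \<partial>M)" for n
    using weighted_stopping(2)[of "real (Suc n)" \<nu> \<theta>] weighted_stopping(2)[of "real (Suc n)" \<tau> \<theta>] \<tau> \<nu> le by simp
  moreover have "(\<lambda>n. \<integral>\<omega>. weight (real (Suc n)) \<omega> * mart \<theta> (capped \<tau> (real (Suc n)) \<omega>) \<omega> \<partial>M)
    \<longlonglongrightarrow> (\<integral>\<omega>. value_at \<eta> \<tau> \<omega> * value_at (mart \<theta>) \<tau> \<omega> \<partial>M)"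
  proof (rule integral_dominated_convergence[where w = "\<lambda>\<omega>. C * value_at (mart \<theta>) \<tau> \<omega>"])
    show "(\<lambda>\<omega>. value_at \<eta> \<tau> \<omega> * value_at (mart \<theta>) \<tau> \<omega>) \<in> borel_measurable M"
      using m by (rule borel_measurable_times)
    show "(\<lambda>\<omega>. weight (real (Suc n)) \<omega> * mart \<theta> (capped \<tau> (real (Suc n)) \<omega>) \<omega>) \<in> borel_measurable M" for n
      using weighted_stopping(1)[of "real (Suc n)" \<tau> \<theta>] \<tau> by auto
    show "integrable M (\<lambda>\<omega>. C * value_at (mart \<theta>) \<tau> \<omega>)"
      using value_at_mart_integrable[OF \<theta> \<tau>] by simp
    show "AE \<omega> in M. (\<lambda>n. weight (real (Suc n)) \<omega> * mart \<theta> (capped \<tau> (real (Suc n)) \<omega>) \<omega>) \<longlonglongrightarrow> value_at \<eta> \<tau> \<omega> * value_at (mart \<theta>) \<tau> \<omega>"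
      using mart_tendsto_0[OF \<theta>] AE_space
      by eventually_elim (rule LIMSEQ_Suc, rule weight_tendsto)
    show "AE \<omega> in M. norm (weight (real (Suc n)) \<omega> * mart \<theta> (capped \<tau> (real (Suc n)) \<omega>) \<omega>) \<le> C * value_at (mart \<theta>) \<tau> \<omega>" for n
    proof (rule AE_I2)
      fix \<omega>
      have C0: "0 \<le> C" using \<eta>C[of 0 \<omega>] by simp
      show "norm (weight (real (Suc n)) \<omega> * mart \<theta> (capped \<tau> (real (Suc n)) \<omega>) \<omega>) \<le> C * value_at (mart \<theta>) \<tau> \<omega>"
      proof (cases "\<tau> \<omega> \<le> ennreal (real (Suc n))")
        case True
        then have "mart \<theta> (capped \<tau> (real (Suc n)) \<omega>) \<omega> = value_at (mart \<theta>) \<tau> \<omega>"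
          by (auto simp: value_at_def capped_eq top_unique)
        then show ?thesis
          using weight_bounds(2)[of "real (Suc n)" \<omega>] value_at_weight_bounds(2)[of \<theta> \<tau> \<omega>]
          by (simp add: abs_mult mult_right_mono)
      next
        case False
        then show ?thesis using C0 value_at_weight_bounds(2)[of \<theta> \<tau> \<omega>] by (simp add: weight_def)
      qed
    qed
  qed
  ultimately show ?thesis by simp
qed

lemma value_at_supermartingale:
  assumes \<theta>: "\<theta> \<noteq> 0"
  shows "integrable M (\<lambda>\<omega>. value_at \<eta> \<tau> \<omega> * value_at (mart \<theta>) \<nu> \<omega>)"
    and "(\<integral>\<omega>. value_at \<eta> \<tau> \<omega> * value_at (mart \<theta>) \<nu> \<omega> \<partial>M) \<le> (\<integral>\<omega>. value_at \<eta> \<tau> \<omega> * value_at (mart \<theta>) \<tau> \<omega> \<partial>M)"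
proof -
  have i: "integrable M (\<lambda>\<omega>. weight (real (Suc n)) \<omega> * mart \<theta> (capped \<nu> (real (Suc n)) \<omega>) \<omega>)" for n
    using weighted_stopping(1)[of "real (Suc n)" \<nu> \<theta>] \<nu> le by simp
  have nn: "0 \<le> weight (real (Suc n)) \<omega> * mart \<theta> (capped \<nu> (real (Suc n)) \<omega>) \<omega>" for n \<omega>
    using weight_bounds(1)[of "real (Suc n)" \<omega>] mart_pos by (simp add: less_imp_le)
  have lim: "AE \<omega> in M. (\<lambda>n. weight (real (Suc n)) \<omega> * mart \<theta> (capped \<nu> (real (Suc n)) \<omega>) \<omega>) \<longlonglongrightarrow> value_at \<eta> \<tau> \<omega> * value_at (mart \<theta>) \<nu> \<omega>"
    using mart_tendsto_0[OF \<theta>] AE_space by eventually_elim (rule LIMSEQ_Suc, rule weight_tendsto)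
  have m: "(\<lambda>\<omega>. value_at \<eta> \<tau> \<omega> * value_at (mart \<theta>) \<nu> \<omega>) \<in> borel_measurable M"
    using value_at_measurable[OF \<eta> \<tau>] value_at_measurable[OF gbm_continuous_adapted \<nu>] by (rule borel_measurable_times)
  have g: "0 \<le> value_at \<eta> \<tau> \<omega> * value_at (mart \<theta>) \<nu> \<omega>" for \<omega>
    using value_at_weight_bounds by simp
  show "integrable M (\<lambda>\<omega>. value_at \<eta> \<tau> \<omega> * value_at (mart \<theta>) \<nu> \<omega>)"
    and "(\<integral>\<omega>. value_at \<eta> \<tau> \<omega> * value_at (mart \<theta>) \<nu> \<omega> \<partial>M) \<le> (\<integral>\<omega>. value_at \<eta> \<tau> \<omega> * value_at (mart \<theta>) \<tau> \<omega> \<partial>M)"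
    using fatou_tendsto[OF i nn m g lim weighted_limit[OF \<theta>]] by auto
qed

text \<open>Domination replaces Fatou, so no mass escapes. The bound is needed only after the
  purchase time, since the weight vanishes before it.\<close>

lemma value_at_martingale:
  assumes \<theta>: "\<theta> \<noteq> 0" and D: "integrable M D"
    and dom: "\<And>\<omega> n. \<omega> \<in> space M \<Longrightarrow> \<tau> \<omega> \<le> ennreal (real n) \<Longrightarrow> mart \<theta> (capped \<nu> (real n) \<omega>) \<omega> \<le> D \<omega>"
    and D0: "\<And>\<omega>. 0 \<le> D \<omega>"
  shows "(\<integral>\<omega>. value_at \<eta> \<tau> \<omega> * value_at (mart \<theta>) \<nu> \<omega> \<partial>M) = (\<integral>\<omega>. value_at \<eta> \<tau> \<omega> * value_at (mart \<theta>) \<tau> \<omega> \<partial>M)"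
proof (rule LIMSEQ_unique[OF _ weighted_limit[OF \<theta>]], rule integral_dominated_convergence[where w = "\<lambda>\<omega>. C * D \<omega>"])
  show "(\<lambda>\<omega>. value_at \<eta> \<tau> \<omega> * value_at (mart \<theta>) \<nu> \<omega>) \<in> borel_measurable M"
    using value_at_measurable[OF \<eta> \<tau>] value_at_measurable[OF gbm_continuous_adapted \<nu>] by (rule borel_measurable_times)
  show "(\<lambda>\<omega>. weight (real (Suc n)) \<omega> * mart \<theta> (capped \<nu> (real (Suc n)) \<omega>) \<omega>) \<in> borel_measurable M" for n
    using weighted_stopping(1)[of "real (Suc n)" \<nu> \<theta>] \<nu> le by auto
  show "AE \<omega> in M. (\<lambda>n. weight (real (Suc n)) \<omega> * mart \<theta> (capped \<nu> (real (Suc n)) \<omega>) \<omega>) \<longlonglongrightarrow> value_at \<eta> \<tau> \<omega> * value_at (mart \<theta>) \<nu> \<omega>"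
    using mart_tendsto_0[OF \<theta>] AE_space by eventually_elim (rule LIMSEQ_Suc, rule weight_tendsto)
  show "AE \<omega> in M. norm (weight (real (Suc n)) \<omega> * mart \<theta> (capped \<nu> (real (Suc n)) \<omega>) \<omega>) \<le> C * D \<omega>" for n
  proof (rule AE_I2)
    fix \<omega> assume \<omega>: "\<omega> \<in> space M"
    have C0: "0 \<le> C" using \<eta>C[of 0 \<omega>] by simp
    show "norm (weight (real (Suc n)) \<omega> * mart \<theta> (capped \<nu> (real (Suc n)) \<omega>) \<omega>) \<le> C * D \<omega>"
    proof (cases "\<tau> \<omega> \<le> ennreal (real (Suc n))")
      case True
      then show ?thesis
        using weight_bounds(2)[of "real (Suc n)" \<omega>] dom[OF \<omega> True] mart_pos[of \<theta> "capped \<nu> (real (Suc n)) \<omega>" \<omega>] C0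
        by (auto simp: abs_mult intro!: mult_mono)
    next
      case False
      then show ?thesis using C0 D0[of \<omega>] by (simp add: weight_def)
    qed
  qed
qed (use D in auto)

end

subsection \<open>Hitting times\<close>

definition hit :: "(real \<Rightarrow> 'a \<Rightarrow> real) \<Rightarrow> 'a \<Rightarrow> ennreal" where
  "hit \<phi> \<omega> = Inf {ennreal t | t. 0 \<le> t \<and> \<phi> t \<omega> \<le> 0}"

text \<open>For a continuous path the nonpositive times form a closed set, so a finite infimum is
  attained.\<close>

lemma hit_cases:
  assumes cont: "continuous_on {0..} (\<lambda>t. \<phi> t \<omega>)"
  obtains (never) "hit \<phi> \<omega> = \<infinity>" "\<And>t. 0 \<le> t \<Longrightarrow> 0 < \<phi> t \<omega>"
    | (at) s where "0 \<le> s" "hit \<phi> \<omega> = ennreal s" "\<phi> s \<omega> \<le> 0" "\<And>t. 0 \<le> t \<Longrightarrow> t < s \<Longrightarrow> 0 < \<phi> t \<omega>"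
proof (cases "\<exists>t\<ge>0. \<phi> t \<omega> \<le> 0")
  case False
  then have empty: "{ennreal t | t. 0 \<le> t \<and> \<phi> t \<omega> \<le> 0} = {}" by auto
  show thesis
  proof (rule never)
    show "hit \<phi> \<omega> = \<infinity>" unfolding hit_def empty by simp
    show "0 < \<phi> t \<omega>" if "0 \<le> t" for t using False that by (meson not_le)
  qed
next
  case True
  define S where "S = {t \<in> {0..}. \<phi> t \<omega> \<le> 0}"
  have "closed ({0..} \<inter> (\<lambda>t. \<phi> t \<omega>) -` {..0})"
    using cont by (intro continuous_closed_preimage) auto
  moreover have "{0..} \<inter> (\<lambda>t. \<phi> t \<omega>) -` {..0} = S" by (auto simp: S_def)
  ultimately have "closed S" by simp
  moreover have "S \<noteq> {}" using True by (auto simp: S_def)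
  moreover have bdd: "bdd_below S" by (rule bdd_belowI[of _ 0]) (auto simp: S_def)
  ultimately have s: "Inf S \<in> S" by (intro closed_contains_Inf) auto
  have low: "Inf S \<le> t" if "0 \<le> t" "\<phi> t \<omega> \<le> 0" for t
    using that bdd by (intro cInf_lower) (auto simp: S_def)
  show thesis
  proof (rule at)
    show "0 \<le> Inf S" "\<phi> (Inf S) \<omega> \<le> 0" using s by (auto simp: S_def)
    show "0 < \<phi> t \<omega>" if "0 \<le> t" "t < Inf S" for t using low[of t] that by fastforce
    show "hit \<phi> \<omega> = ennreal (Inf S)"
      unfolding hit_def
    proof (rule antisym)
      show "Inf {ennreal t |t. 0 \<le> t \<and> \<phi> t \<omega> \<le> 0} \<le> ennreal (Inf S)"
        using s by (intro Inf_lower) (auto simp: S_def)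
      show "ennreal (Inf S) \<le> Inf {ennreal t |t. 0 \<le> t \<and> \<phi> t \<omega> \<le> 0}"
        using low by (intro Inf_greatest) (auto intro!: ennreal_leI)
    qed
  qed
qed

text \<open>A continuous path on a compact interval touches the nonpositive half-line exactly when
  its rational values come arbitrarily close to it. The right-hand side involves countably many
  measurable conditions.\<close>

lemma hit_le_iff:
  assumes cont: "continuous_on {0..} (\<lambda>t. \<phi> t \<omega>)" and t: "0 \<le> t"
  shows "hit \<phi> \<omega> \<le> ennreal t \<longleftrightarrow> (\<forall>n. \<exists>r\<in>{r \<in> \<rat>. 0 \<le> r \<and> r \<le> t}. \<phi> r \<omega> < 1 / real (Suc n))"
proof
  have ct: "continuous_on {0..t} (\<lambda>s. \<phi> s \<omega>)"
    using cont by (rule continuous_on_subset) auto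
  assume h: "hit \<phi> \<omega> \<le> ennreal t"
  from cont obtain s where s: "0 \<le> s" "s \<le> t" "\<phi> s \<omega> \<le> 0"
  proof (cases rule: hit_cases)
    case never
    then show ?thesis using h by (simp add: top_unique)
  next
    case (at s)
    then show ?thesis using h t that[of s] by auto
  qed
  show "\<forall>n. \<exists>r\<in>{r \<in> \<rat>. 0 \<le> r \<and> r \<le> t}. \<phi> r \<omega> < 1 / real (Suc n)"
  proof (rule ccontr)
    assume "\<not> ?thesis"
    then obtain n where n: "\<And>r. r \<in> \<rat> \<Longrightarrow> 0 \<le> r \<Longrightarrow> r \<le> t \<Longrightarrow> \<phi> r \<omega> \<in> {1 / real (Suc n)..}"
      by (auto simp: not_less)
    have "\<phi> s \<omega> \<in> {1 / real (Suc n)..}"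
      using continuous_on_rationals_closed[OF ct closed_atLeast t n s(1,2)] by blast
    moreover have "0 < 1 / real (Suc n)" by simp
    ultimately show False using s(3) by (simp only: atLeast_iff)
  qed
next
  assume R: "\<forall>n. \<exists>r\<in>{r \<in> \<rat>. 0 \<le> r \<and> r \<le> t}. \<phi> r \<omega> < 1 / real (Suc n)"
  show "hit \<phi> \<omega> \<le> ennreal t"
  proof (rule ccontr)
    assume nh: "\<not> hit \<phi> \<omega> \<le> ennreal t"
    have pos: "0 < \<phi> s \<omega>" if "0 \<le> s" "s \<le> t" for s
    proof (rule ccontr)
      assume "\<not> 0 < \<phi> s \<omega>"
      then have "hit \<phi> \<omega> \<le> ennreal s"
        unfolding hit_def using that by (intro Inf_lower) auto
      also have "\<dots> \<le> ennreal t" using that by (intro ennreal_leI)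
      finally show False using nh by simp
    qed
    have "continuous_on {0..t} (\<lambda>s. \<phi> s \<omega>)"
      using cont by (rule continuous_on_subset) auto
    then obtain v where v: "v \<in> {0..t}" "\<forall>s\<in>{0..t}. \<phi> v \<omega> \<le> \<phi> s \<omega>"
      using continuous_attains_inf[of "{0..t}" "\<lambda>s. \<phi> s \<omega>"] t by auto
    have "0 < \<phi> v \<omega>" using pos v by simp
    then obtain n where "inverse (real (Suc n)) < \<phi> v \<omega>" using reals_Archimedean by blast
    then show False using R[rule_format, of n] v(2) by (force simp: inverse_eq_divide)
  qed
qed

lemma hit_stopping_time:
  assumes \<phi>: "continuous_adapted \<phi>"
  shows "stopping_time F (hit \<phi>)"
proof
  fix t :: ennreal
  show "Measurable.pred (F t) (\<lambda>\<omega>. hit \<phi> \<omega> \<le> t)"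
  proof (cases t)
    case (real r)
    have "countable {r' \<in> \<rat>. 0 \<le> r' \<and> r' \<le> r}"
      using countable_rat by (rule countable_subset[rotated]) auto
    then have "Measurable.pred (F (ennreal r)) (\<lambda>\<omega>. \<forall>n. \<exists>r'\<in>{r' \<in> \<rat>. 0 \<le> r' \<and> r' \<le> r}. \<phi> r' \<omega> < 1 / real (Suc n))"
    proof (intro pred_intros_countable measurable_pred_countable)
      fix n r' assume "r' \<in> {r' \<in> \<rat>. 0 \<le> r' \<and> r' \<le> r}"
      then have [measurable]: "\<phi> r' \<in> borel_measurable (F (ennreal r))"
        using continuous_adapted_F[OF \<phi>, of r' r] by simp
      show "Measurable.pred (F (ennreal r)) (\<lambda>\<omega>. \<phi> r' \<omega> < 1 / real (Suc n))"
        by measurable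
    qed
    then show ?thesis
      using real hit_le_iff[OF continuous_adapted_cont[OF \<phi>]] by simp
  qed simp
qed

end

subsection \<open>Extended expectations\<close>

lemma ext_expectation_real:
  assumes X: "integrable M X"
  shows "ext_expectation M (\<lambda>\<omega>. ereal (X \<omega>)) = ereal (\<integral>\<omega>. X \<omega> \<partial>M)"
proof -
  have fin: "(\<integral>\<^sup>+\<omega>. ennreal (X \<omega>) \<partial>M) \<noteq> \<infinity>" "(\<integral>\<^sup>+\<omega>. ennreal (- X \<omega>) \<partial>M) \<noteq> \<infinity>"
    using X by (auto simp: real_integrable_def)
  have "ext_expectation M (\<lambda>\<omega>. ereal (X \<omega>)) =
      enn2ereal (\<integral>\<^sup>+\<omega>. ennreal (X \<omega>) \<partial>M) - enn2ereal (\<integral>\<^sup>+\<omega>. ennreal (- X \<omega>) \<partial>M)"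
    by (simp add: ext_expectation_def)
  also have "\<dots> = ereal (\<integral>\<omega>. X \<omega> \<partial>M)"
    unfolding real_lebesgue_integral_def[OF X] using fin
    by (cases rule: ennreal2_cases[of "\<integral>\<^sup>+\<omega>. ennreal (X \<omega>) \<partial>M" "\<integral>\<^sup>+\<omega>. ennreal (- X \<omega>) \<partial>M"]) auto
  finally show ?thesis .
qed

lemma ext_expectation_cong_AE:
  assumes "AE \<omega> in M. X \<omega> = Y \<omega>"
  shows "ext_expectation M X = ext_expectation M Y"
proof -
  have "(\<integral>\<^sup>+\<omega>. e2ennreal (X \<omega>) \<partial>M) = (\<integral>\<^sup>+\<omega>. e2ennreal (Y \<omega>) \<partial>M)"
    "(\<integral>\<^sup>+\<omega>. e2ennreal (- X \<omega>) \<partial>M) = (\<integral>\<^sup>+\<omega>. e2ennreal (- Y \<omega>) \<partial>M)"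
    using assms by (intro nn_integral_cong_AE; auto)+
  then show ?thesis by (simp add: ext_expectation_def)
qed

section \<open>The price in natural scale and the integrability of costs\<close>

locale trading_problem =
  brownian_space M F W + trading_parameters \<alpha> \<beta> k \<gamma> l \<Psi> R c
  for M :: "'a measure" and F W \<alpha> \<beta> k \<gamma> l \<Psi> R c +
  fixes \<mu> \<sigma> :: real
  assumes \<sigma>: "0 < \<sigma>" and \<beta>_eq: "\<beta> = 1 - 2 * \<mu> / \<sigma>\<^sup>2"
begin

abbreviation U :: "real \<Rightarrow> real" where "U \<equiv> utility \<alpha> k"

abbreviation X :: "real \<Rightarrow> real \<Rightarrow> 'a \<Rightarrow> real" where "X \<equiv> gbm \<mu> \<sigma>"

abbreviation Y :: "real \<Rightarrow> 'a \<Rightarrow> real" where "Y \<equiv> mart (\<sigma> * \<beta>)"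

lemma \<theta>: "\<sigma> * \<beta> \<noteq> 0"
  using \<sigma> \<beta>_pos by simp

text \<open>The definition of \<open>\<beta>\<close> turns the drift of the exponent, times
  \<open>\<beta>\<close>, into \<open>- (\<sigma> * \<beta>)\<^sup>2 / 2\<close>, exactly the
  compensator of the exponential martingale with parameter
  \<open>\<sigma> * \<beta>\<close>.\<close>

lemma price_powr: "0 < q \<Longrightarrow> X q t \<omega> powr \<beta> = q powr \<beta> * Y t \<omega>"
proof -
  assume q: "0 < q"
  have drift: "(\<mu> - \<sigma>\<^sup>2 / 2) * \<beta> = - (\<sigma> * \<beta>)\<^sup>2 / 2"
  proof -
    have "\<mu> - \<sigma>\<^sup>2 / 2 = - \<beta> * \<sigma>\<^sup>2 / 2" using \<sigma> by (simp add: \<beta>_eq field_simps)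
    then show ?thesis by (simp add: power2_eq_square)
  qed
  have "(\<sigma> * W t \<omega> + (\<mu> - \<sigma>\<^sup>2 / 2) * t) * \<beta> = \<sigma> * \<beta> * W t \<omega> + ((\<mu> - \<sigma>\<^sup>2 / 2) * \<beta>) * t"
    by (simp add: algebra_simps)
  then have "exp (\<sigma> * W t \<omega> + (\<mu> - \<sigma>\<^sup>2 / 2) * t) powr \<beta> = Y t \<omega>"
    unfolding drift by (simp add: gbm_def exp_powr_real)
  then show ?thesis using q by (simp add: gbm_def powr_mult)
qed

lemma price_pos: "0 < q \<Longrightarrow> 0 < X q t \<omega>"
  by (simp add: gbm_def)

lemma price_at_eq: "price_at X q \<tau> = value_at (X q) \<tau>"
  by (auto simp: price_at_def value_at_def fun_eq_iff)

lemma value_nonneg: "0 < q \<Longrightarrow> 0 \<le> value_at (X q) \<tau> \<omega>"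
  by (simp add: value_at_def price_pos less_imp_le)

lemma value_powr: "0 < q \<Longrightarrow> value_at (X q) \<tau> \<omega> powr \<beta> = q powr \<beta> * value_at Y \<tau> \<omega>"
  by (simp add: value_at_def price_powr)

lemma value_at_measurable_price: "stopping_time F \<tau> \<Longrightarrow> value_at (X q) \<tau> \<in> borel_measurable M"
  by (rule value_at_measurable[OF gbm_continuous_adapted])

lemma value_Y:
  assumes "stopping_time F \<tau>"
  shows "integrable M (value_at Y \<tau>)" "(\<integral>\<omega>. value_at Y \<tau> \<omega> \<partial>M) \<le> 1" "0 \<le> value_at Y \<tau> \<omega>"
  using value_at_mart_integrable[OF \<theta> assms] value_at_mart_nonneg by auto

text \<open>Coefficient of the martingale at the sale time in the tangent line of a purchase at time
  \<open>t\<close>; the factor \<open>q powr \<beta>\<close> converts the martingale into the power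
  of the price.\<close>

definition weight_process :: "real \<Rightarrow> real \<Rightarrow> 'a \<Rightarrow> real" where
  "weight_process q t \<omega> = q powr \<beta> * \<zeta> (X q t \<omega>)"

lemma weight_process:
  assumes q: "0 < q"
  shows "continuous_adapted (weight_process q)" "0 \<le> weight_process q t \<omega>"
    "weight_process q t \<omega> \<le> q powr \<beta> * (A * \<gamma> powr \<beta> * R powr (\<alpha> - \<beta>))"
proof -
  have "weight_process q t \<in> borel_measurable (F (ennreal t))" if "0 \<le> t" for t
    using gbm_measurable_F[OF that order_refl] unfolding weight_process_def[abs_def] \<zeta>_def cost_def
    by measurable
  moreover have "continuous_on {0..} (\<lambda>t. weight_process q t \<omega>)" for \<omega>
    unfolding weight_process_def
    by (intro continuous_intros continuous_on_compose2[OF \<zeta>_cont gbm_cont]) (use price_pos[OF q] in \<open>auto simp: less_imp_le\<close>)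
  ultimately show "continuous_adapted (weight_process q)"
    by (simp add: continuous_adapted_def adapted_def)
  show "0 \<le> weight_process q t \<omega>"
    using \<zeta>_pos[of "X q t \<omega>"] price_pos[OF q, of t \<omega>] by (simp add: weight_process_def less_imp_le)
  show "weight_process q t \<omega> \<le> q powr \<beta> * (A * \<gamma> powr \<beta> * R powr (\<alpha> - \<beta>))"
    using \<zeta>_bound[of "X q t \<omega>"] price_pos[OF q, of t \<omega>]
    unfolding weight_process_def by (intro mult_left_mono) auto
qed

lemma cost_powr_\<beta>:
  assumes x: "0 \<le> x"
  shows "cost x powr \<beta> \<le> 2 powr \<beta> * (l powr \<beta> * x powr \<beta> + (\<Psi> + R) powr \<beta>)"
proof -
  define a where "a = l * x"
  define b where "b = \<Psi> + R"
  have ab: "0 \<le> a" "0 < b" using l x \<Psi> R by (auto simp: a_def b_def)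
  have "cost x = a + b" by (simp add: cost_def a_def b_def)
  also have "\<dots> \<le> 2 * max a b" by simp
  finally have "cost x powr \<beta> \<le> (2 * max a b) powr \<beta>"
    using \<beta>_pos cost_ge(3)[OF x] by (intro powr_mono2) auto
  also have "\<dots> = 2 powr \<beta> * max a b powr \<beta>" using ab by (simp add: powr_mult)
  also have "\<dots> \<le> 2 powr \<beta> * (a powr \<beta> + b powr \<beta>)"
    by (intro mult_left_mono) (auto simp: max_def)
  also have "a powr \<beta> = l powr \<beta> * x powr \<beta>" using l x by (simp add: a_def powr_mult)
  finally show ?thesis by (simp add: b_def)
qed

text \<open>The power \<open>\<beta>\<close> is controlled linearly by the martingale. As the cost
  is at least \<open>R\<close> and \<open>\<alpha> \<le> \<beta>\<close>, the power
  \<open>\<alpha>\<close> is a bounded multiple of the power \<open>\<beta>\<close>.\<close>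

lemma cost_integrable:
  assumes q: "0 < q" and \<tau>: "stopping_time F \<tau>"
  shows "integrable M (\<lambda>\<omega>. cost (value_at (X q) \<tau> \<omega>) powr \<beta>)"
    and "integrable M (\<lambda>\<omega>. cost (value_at (X q) \<tau> \<omega>) powr \<alpha>)"
proof -
  note [measurable] = value_at_measurable_price[OF \<tau>, of q]
  show 1: "integrable M (\<lambda>\<omega>. cost (value_at (X q) \<tau> \<omega>) powr \<beta>)"
  proof (rule Bochner_Integration.integrable_bound)
    show "integrable M (\<lambda>\<omega>. 2 powr \<beta> * (l powr \<beta> * (q powr \<beta> * value_at Y \<tau> \<omega>) + (\<Psi> + R) powr \<beta>))"
      using value_Y(1)[OF \<tau>] by simp
    show "AE \<omega> in M. norm (cost (value_at (X q) \<tau> \<omega>) powr \<beta>) \<le> norm (2 powr \<beta> * (l powr \<beta> * (q powr \<beta> * value_at Y \<tau> \<omega>) + (\<Psi> + R) powr \<beta>))"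
      using cost_powr_\<beta>[OF value_nonneg[OF q]] by (intro AE_I2) (simp add: value_powr[OF q] order_trans[OF _ abs_ge_self])
  qed (unfold cost_def, measurable)
  show "integrable M (\<lambda>\<omega>. cost (value_at (X q) \<tau> \<omega>) powr \<alpha>)"
  proof (rule Bochner_Integration.integrable_bound)
    show "integrable M (\<lambda>\<omega>. R powr (\<alpha> - \<beta>) * cost (value_at (X q) \<tau> \<omega>) powr \<beta>)"
      using 1 by simp
    show "AE \<omega> in M. norm (cost (value_at (X q) \<tau> \<omega>) powr \<alpha>) \<le> norm (R powr (\<alpha> - \<beta>) * cost (value_at (X q) \<tau> \<omega>) powr \<beta>)"
    proof (rule AE_I2)
      fix \<omega>
      let ?H = "cost (value_at (X q) \<tau> \<omega>)"
      have H: "R \<le> ?H" using cost_ge(1) value_nonneg[OF q] by blast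
      have "?H powr (\<alpha> - \<beta>) \<le> R powr (\<alpha> - \<beta>)"
        using H R \<alpha> by (intro powr_mono2') auto
      then have "?H powr (\<alpha> - \<beta>) * ?H powr \<beta> \<le> R powr (\<alpha> - \<beta>) * ?H powr \<beta>"
        by (rule mult_right_mono) simp
      then show "norm (?H powr \<alpha>) \<le> norm (R powr (\<alpha> - \<beta>) * ?H powr \<beta>)"
        by (simp add: powr_add[symmetric])
    qed
  qed (unfold cost_def, measurable)
qed

subsection \<open>The sequential problem for given stopping times\<close>

definition payoff :: "real \<Rightarrow> ('a \<Rightarrow> ennreal) \<Rightarrow> ('a \<Rightarrow> ennreal) \<Rightarrow> 'a \<Rightarrow> real" where
  "payoff q \<tau> \<nu> \<omega> = U (\<gamma> * price_at X q \<nu> \<omega> * of_bool (\<tau> \<omega> < \<infinity> \<and> \<nu> \<omega> < \<infinity>)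
     - (l * price_at X q \<tau> \<omega> + \<Psi>) * of_bool (\<tau> \<omega> < \<infinity>) - R)"

definition fixed_loss :: "real \<Rightarrow> ('a \<Rightarrow> ennreal) \<Rightarrow> 'a \<Rightarrow> real" where
  "fixed_loss q \<tau> \<omega> = (if \<tau> \<omega> = \<infinity> then k * R powr \<alpha> else k * cost (value_at (X q) \<tau> \<omega>) powr \<alpha>)"

text \<open>The tangent line evaluated at the sale price: linear in the martingale at the sale time,
  with slope and intercept fixed at the purchase time. This is the shape to which optional stopping
  applies.\<close>

definition tangent_payoff :: "real \<Rightarrow> ('a \<Rightarrow> ennreal) \<Rightarrow> ('a \<Rightarrow> ennreal) \<Rightarrow> 'a \<Rightarrow> real" where
  "tangent_payoff q \<tau> \<nu> \<omega> = value_at (weight_process q) \<tau> \<omega> * value_at Y \<nu> \<omega> - fixed_loss q \<tau> \<omega>"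

lemma payoff_infinite: "\<tau> \<omega> = \<infinity> \<Longrightarrow> payoff q \<tau> \<nu> \<omega> = - k * R powr \<alpha>"
  by (simp add: payoff_def utility_neg_R)

lemma payoff_finite: "\<tau> \<omega> \<noteq> \<infinity> \<Longrightarrow>
    payoff q \<tau> \<nu> \<omega> = U (\<gamma> * value_at (X q) \<nu> \<omega> - cost (value_at (X q) \<tau> \<omega>))"
  by (cases "\<nu> \<omega> = \<infinity>")
     (auto simp: payoff_def price_at_eq cost_def value_at_def less_top[symmetric] intro!: arg_cong[of _ _ "utility \<alpha> k"])

lemma tangent_payoff_finite:
  assumes "\<tau> \<omega> \<noteq> \<infinity>" "0 < q"
  shows "tangent_payoff q \<tau> \<nu> \<omega> =
    \<zeta> (value_at (X q) \<tau> \<omega>) * value_at (X q) \<nu> \<omega> powr \<beta> - k * cost (value_at (X q) \<tau> \<omega>) powr \<alpha>"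
proof -
  have "value_at (weight_process q) \<tau> \<omega> = q powr \<beta> * \<zeta> (value_at (X q) \<tau> \<omega>)"
    using assms by (simp add: value_at_def weight_process_def)
  then show ?thesis
    using assms by (simp add: tangent_payoff_def fixed_loss_def value_powr)
qed

lemma tangent_payoff_infinite: "\<tau> \<omega> = \<infinity> \<Longrightarrow> tangent_payoff q \<tau> \<nu> \<omega> = - k * R powr \<alpha>"
  by (simp add: tangent_payoff_def fixed_loss_def value_at_def)

lemma tangent_payoff_self: "0 < q \<Longrightarrow> tangent_payoff q \<tau> \<tau> \<omega> =
    (if \<tau> \<omega> = \<infinity> then - k * R powr \<alpha> else buy_value (value_at (X q) \<tau> \<omega>))"
  by (simp add: tangent_payoff_infinite tangent_payoff_finite buy_value_def)

lemma payoff_le_tangent: "0 < q \<Longrightarrow> payoff q \<tau> \<nu> \<omega> \<le> tangent_payoff q \<tau> \<nu> \<omega>"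
  using utility_le[of "value_at (X q) \<tau> \<omega>" "value_at (X q) \<nu> \<omega>"] value_nonneg[of q \<tau> \<omega>] value_nonneg[of q \<nu> \<omega>]
  by (cases "\<tau> \<omega> = \<infinity>") (simp_all add: payoff_infinite payoff_finite tangent_payoff_finite tangent_payoff_infinite)

text \<open>Selling at price 0 is the worst outcome for a given purchase; this lower bound supplies
  integrability from below.\<close>

lemma payoff_ge: "0 < q \<Longrightarrow> - fixed_loss q \<tau> \<omega> \<le> payoff q \<tau> \<nu> \<omega>"
proof (cases "\<tau> \<omega> = \<infinity>")
  case False
  assume q: "0 < q"
  let ?y = "\<gamma> * value_at (X q) \<nu> \<omega>" and ?H = "cost (value_at (X q) \<tau> \<omega>)"
  have y: "0 \<le> ?y" using \<gamma> value_nonneg[OF q, of \<nu> \<omega>] by simp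
  have H: "0 < ?H" using cost_ge(3) value_nonneg[OF q] by blast
  have "- (k * ?H powr \<alpha>) \<le> U (?y - ?H)"
  proof (cases "?y - ?H > 0")
    case True
    then have "0 \<le> U (?y - ?H)" by (simp add: utility_def)
    moreover have "0 \<le> k * ?H powr \<alpha>" using k by simp
    ultimately show ?thesis by linarith
  next
    case False
    then have "\<bar>?y - ?H\<bar> powr \<alpha> \<le> ?H powr \<alpha>" using y \<alpha> by (intro powr_mono2) auto
    then show ?thesis using False k by (simp add: utility_def)
  qed
  then show ?thesis using False by (simp add: fixed_loss_def payoff_finite)
qed (simp add: fixed_loss_def payoff_infinite)

lemma fixed_loss_integrable:
  assumes q: "0 < q" and \<tau>: "stopping_time F \<tau>"
  shows "integrable M (fixed_loss q \<tau>)"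
proof (rule Bochner_Integration.integrable_bound)
  show "integrable M (\<lambda>\<omega>. k * R powr \<alpha> + k * cost (value_at (X q) \<tau> \<omega>) powr \<alpha>)"
    using cost_integrable(2)[OF assms] by simp
  have [measurable]: "\<tau> \<in> borel_measurable M" "value_at (X q) \<tau> \<in> borel_measurable M"
    using stopping_measurable[OF \<tau>] value_at_measurable_price[OF \<tau>] by auto
  show "fixed_loss q \<tau> \<in> borel_measurable M"
    unfolding fixed_loss_def[abs_def] cost_def by measurable
  show "AE \<omega> in M. norm (fixed_loss q \<tau> \<omega>) \<le> norm (k * R powr \<alpha> + k * cost (value_at (X q) \<tau> \<omega>) powr \<alpha>)"
    using k by (intro AE_I2) (auto simp: fixed_loss_def)
qed

lemma utility_measurable [measurable]: "U \<in> borel_measurable borel"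
  unfolding utility_def[abs_def] by measurable

lemma tangent_payoff_integral:
  assumes q: "0 < q" and \<tau>: "stopping_time F \<tau>" and \<nu>: "stopping_time F \<nu>"
    and le: "\<And>\<omega>. \<omega> \<in> space M \<Longrightarrow> \<tau> \<omega> \<le> \<nu> \<omega>"
  shows "integrable M (tangent_payoff q \<tau> \<nu>)"
    and "(\<integral>\<omega>. tangent_payoff q \<tau> \<nu> \<omega> \<partial>M) \<le> (\<integral>\<omega>. tangent_payoff q \<tau> \<tau> \<omega> \<partial>M)"
proof -
  note s = value_at_supermartingale[OF \<tau> \<nu> le weight_process(1)[OF q] weight_process(2)[OF q] weight_process(3)[OF q] \<theta>]
  note s' = value_at_supermartingale[OF \<tau> \<tau> order_refl weight_process(1)[OF q] weight_process(2)[OF q] weight_process(3)[OF q] \<theta>]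
  note f = fixed_loss_integrable[OF q \<tau>]
  show "integrable M (tangent_payoff q \<tau> \<nu>)"
    unfolding tangent_payoff_def[abs_def] using s(1) f by (rule Bochner_Integration.integrable_diff)
  show "(\<integral>\<omega>. tangent_payoff q \<tau> \<nu> \<omega> \<partial>M) \<le> (\<integral>\<omega>. tangent_payoff q \<tau> \<tau> \<omega> \<partial>M)"
    unfolding tangent_payoff_def using s(2)
    by (subst (1 2) Bochner_Integration.integral_diff) (use s(1) s'(1) f in simp_all)
qed

lemma payoff_integrable:
  assumes q: "0 < q" and \<tau>: "stopping_time F \<tau>" and \<nu>: "stopping_time F \<nu>"
    and le: "\<And>\<omega>. \<omega> \<in> space M \<Longrightarrow> \<tau> \<omega> \<le> \<nu> \<omega>"
  shows "integrable M (payoff q \<tau> \<nu>)"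
proof (rule Bochner_Integration.integrable_bound)
  show "integrable M (\<lambda>\<omega>. \<bar>tangent_payoff q \<tau> \<nu> \<omega>\<bar> + \<bar>fixed_loss q \<tau> \<omega>\<bar>)"
    using tangent_payoff_integral(1)[OF assms] fixed_loss_integrable[OF q \<tau>] by simp
  have [measurable]: "\<tau> \<in> borel_measurable M" "\<nu> \<in> borel_measurable M"
      "value_at (X q) \<tau> \<in> borel_measurable M" "value_at (X q) \<nu> \<in> borel_measurable M"
    using stopping_measurable \<tau> \<nu> value_at_measurable_price by auto
  show "payoff q \<tau> \<nu> \<in> borel_measurable M"
    unfolding payoff_def[abs_def] price_at_eq by measurable
  show "AE \<omega> in M. norm (payoff q \<tau> \<nu> \<omega>) \<le> norm (\<bar>tangent_payoff q \<tau> \<nu> \<omega>\<bar> + \<bar>fixed_loss q \<tau> \<omega>\<bar>)"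
  proof (rule AE_I2)
    fix \<omega>
    show "norm (payoff q \<tau> \<nu> \<omega>) \<le> norm (\<bar>tangent_payoff q \<tau> \<nu> \<omega>\<bar> + \<bar>fixed_loss q \<tau> \<omega>\<bar>)"
      using payoff_le_tangent[OF q, of \<tau> \<nu> \<omega>] payoff_ge[OF q, of \<tau> \<omega> \<nu>] by auto
  qed
qed

lemma J_eq_payoff:
  assumes "0 < q" "stopping_time F \<tau>" "stopping_time F \<nu>" "\<And>\<omega>. \<omega> \<in> space M \<Longrightarrow> \<tau> \<omega> \<le> \<nu> \<omega>"
  shows "J M X U \<gamma> l \<Psi> R q \<tau> \<nu> = ereal (\<integral>\<omega>. payoff q \<tau> \<nu> \<omega> \<partial>M)"
  using ext_expectation_real[OF payoff_integrable[OF assms]] by (simp add: J_def payoff_def)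

text \<open>The line bounds the utility pointwise, and optional stopping moves the sale back to the
  purchase time without lowering the mean of the line.\<close>

lemma J_le:
  assumes "0 < q" "stopping_time F \<tau>" "stopping_time F \<nu>" "\<And>\<omega>. \<omega> \<in> space M \<Longrightarrow> \<tau> \<omega> \<le> \<nu> \<omega>"
  shows "J M X U \<gamma> l \<Psi> R q \<tau> \<nu> \<le> ereal (\<integral>\<omega>. tangent_payoff q \<tau> \<tau> \<omega> \<partial>M)"
proof -
  have "(\<integral>\<omega>. payoff q \<tau> \<nu> \<omega> \<partial>M) \<le> (\<integral>\<omega>. tangent_payoff q \<tau> \<nu> \<omega> \<partial>M)"
    by (intro integral_mono payoff_integrable[OF assms] tangent_payoff_integral(1)[OF assms] payoff_le_tangent assms)
  also have "\<dots> \<le> (\<integral>\<omega>. tangent_payoff q \<tau> \<tau> \<omega> \<partial>M)"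
    by (rule tangent_payoff_integral(2)[OF assms])
  finally show ?thesis by (simp add: J_eq_payoff[OF assms])
qed

subsection \<open>The sale rule attains the tangent payoff\<close>

text \<open>Since the threshold exceeds the purchase price, stopping the threshold at \<open>\<tau>\<close> turns the sale
  rule into the hitting time of a single continuous adapted process.\<close>

definition sale_gap :: "real \<Rightarrow> ('a \<Rightarrow> ennreal) \<Rightarrow> real \<Rightarrow> 'a \<Rightarrow> real" where
  "sale_gap q \<tau> t \<omega> = c / \<gamma> * cost (X q (capped \<tau> t \<omega>) \<omega>) - X q t \<omega>"

lemma capped_before: "0 \<le> t \<Longrightarrow> ennreal t \<le> \<tau> \<omega> \<Longrightarrow> capped \<tau> t \<omega> = t"
  by (simp add: capped_def min_absorb2)

lemma capped_cont: "continuous_on {0..} (\<lambda>t. capped \<tau> t \<omega>)"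
proof (cases "\<tau> \<omega>")
  case (real r)
  have "capped \<tau> t \<omega> = min r t" if "t \<in> {0..}" for t
    using real that by (simp add: capped_def min_def)
  then show ?thesis
    by (subst continuous_on_cong[OF refl]) (auto intro!: continuous_intros)
next
  case top
  have "capped \<tau> t \<omega> = t" if "t \<in> {0..}" for t
    using top that by (simp add: capped_def)
  then show ?thesis
    by (subst continuous_on_cong[OF refl]) (auto intro!: continuous_intros)
qed

lemma sale_gap_continuous_adapted:
  assumes \<tau>: "stopping_time F \<tau>"
  shows "continuous_adapted (sale_gap q \<tau>)"
  unfolding continuous_adapted_def adapted_def
proof (intro conjI allI impI)
  fix t :: real assume t: "0 \<le> t"
  have [measurable]: "(\<lambda>\<omega>. X q (capped \<tau> t \<omega>) \<omega>) \<in> borel_measurable (F (ennreal t))"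
    "X q t \<in> borel_measurable (F (ennreal t))"
    using stopped_measurable[OF gbm_continuous_adapted \<tau> t] gbm_measurable_F[OF t order_refl] by auto
  show "sale_gap q \<tau> t \<in> borel_measurable (F (ennreal t))"
    unfolding sale_gap_def[abs_def] cost_def by measurable
next
  fix \<omega>
  have "continuous_on {0..} (\<lambda>t. X q (capped \<tau> t \<omega>) \<omega>)"
    by (rule continuous_on_compose2[OF gbm_cont capped_cont]) (auto simp: capped_bounds)
  then show "continuous_on {0..} (\<lambda>t. sale_gap q \<tau> t \<omega>)"
    unfolding sale_gap_def cost_def by (intro continuous_intros gbm_cont)
qed

lemma sale_gap_before:
  assumes "0 < q" "0 \<le> t" "ennreal t \<le> \<tau> \<omega>"
  shows "0 < sale_gap q \<tau> t \<omega>"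
  using threshold_gt[of "X q t \<omega>"] price_pos[OF assms(1), of t \<omega>] assms by (simp add: sale_gap_def capped_before)

lemma sale_gap_after:
  assumes "\<tau> \<omega> \<le> ennreal t"
  shows "sale_gap q \<tau> t \<omega> = c / \<gamma> * cost (value_at (X q) \<tau> \<omega>) - X q t \<omega>"
proof -
  have "\<tau> \<omega> \<noteq> \<infinity>" using assms by (auto simp: top_unique)
  then show ?thesis using assms by (simp add: sale_gap_def capped_eq value_at_def)
qed

text \<open>Before the purchase the gap is positive, so it adds no hitting times; from the purchase
  on it is the distance to the true threshold.\<close>

lemma sale_rule_eq_hit:
  assumes q: "0 < q"
  shows "sale_rule X c \<gamma> l \<Psi> R q \<tau> \<omega> = hit (sale_gap q \<tau>) \<omega>"
proof -
  have "0 \<le> t \<and> \<tau> \<omega> \<le> ennreal t \<and> c / \<gamma> * (l * price_at X q \<tau> \<omega> + \<Psi> + R) \<le> X q t \<omega> \<longleftrightarrow>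
      0 \<le> t \<and> sale_gap q \<tau> t \<omega> \<le> 0" for t
  proof (cases "0 \<le> t \<and> \<not> \<tau> \<omega> \<le> ennreal t")
    case True
    then have "ennreal t \<le> \<tau> \<omega>" using linear by blast
    then show ?thesis using True sale_gap_before[OF q, of t \<tau> \<omega>] by auto
  next
    case False
    then show ?thesis
      using sale_gap_after[of \<tau> \<omega> t q] by (auto simp: cost_def[symmetric] price_at_eq)
  qed
  then show ?thesis by (simp add: sale_rule_def hit_def)
qed

lemma sale_rule_ge: "\<tau> \<omega> \<le> sale_rule X c \<gamma> l \<Psi> R q \<tau> \<omega>"
  unfolding sale_rule_def by (rule Inf_greatest) auto

lemma sale_rule_stopping:
  assumes "0 < q" "stopping_time F \<tau>"
  shows "stopping_time F (sale_rule X c \<gamma> l \<Psi> R q \<tau>)"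
  using hit_stopping_time[OF sale_gap_continuous_adapted[OF assms(2)]] sale_rule_eq_hit[OF assms(1)]
  by (simp add: fun_eq_iff[symmetric] cong: stopping_time_cong)

text \<open>Either no sale happens and the value is 0, or continuity makes the sale price equal to
  the threshold; the line touches the utility at both values.\<close>

lemma payoff_sale_rule:
  assumes q: "0 < q" and \<tau>: "stopping_time F \<tau>"
  shows "payoff q \<tau> (sale_rule X c \<gamma> l \<Psi> R q \<tau>) \<omega> = tangent_payoff q \<tau> (sale_rule X c \<gamma> l \<Psi> R q \<tau>) \<omega>"
proof (cases "\<tau> \<omega> = \<infinity>")
  case False
  let ?\<nu> = "sale_rule X c \<gamma> l \<Psi> R q \<tau>" and ?x = "value_at (X q) \<tau> \<omega>"
  have x: "0 \<le> ?x" using value_nonneg[OF q] .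
  note cont = continuous_adapted_cont[OF sale_gap_continuous_adapted[OF \<tau>], of q \<omega>]
  from cont have "U (\<gamma> * value_at (X q) ?\<nu> \<omega> - cost ?x) = \<zeta> ?x * value_at (X q) ?\<nu> \<omega> powr \<beta> - k * cost ?x powr \<alpha>"
  proof (cases rule: hit_cases)
    case never
    then have "value_at (X q) ?\<nu> \<omega> = 0" by (simp add: sale_rule_eq_hit[OF q] value_at_def)
    then show ?thesis using utility_zero[OF x] by simp
  next
    case (at s)
    have \<tau>s: "\<tau> \<omega> \<le> ennreal s"
      using sale_gap_before[OF q at(1), of \<tau> \<omega>] at(3) by (cases "ennreal s \<le> \<tau> \<omega>") auto
    have "s \<noteq> 0"
      using sale_gap_before[OF q, of 0 \<tau> \<omega>] at(3) by auto
    then have s: "0 < s" using at(1) by simp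
    \<comment> \<open>The gap is positive to the left of the hitting time, so its left limit is
      nonnegative. Being also nonpositive there it is 0, which excludes a sale above the
      threshold.\<close>
    have "((\<lambda>t. sale_gap q \<tau> t \<omega>) \<longlongrightarrow> sale_gap q \<tau> s \<omega>) (at s within {0..<s})"
      using cont at(1) by (auto simp: continuous_on_def intro: tendsto_within_subset)
    moreover have "\<forall>\<^sub>F t in at s within {0..<s}. 0 \<le> sale_gap q \<tau> t \<omega>"
      using at(4) by (auto simp: eventually_at_filter less_imp_le intro: always_eventually)
    moreover have "at s within {0..<s} \<noteq> bot"
      using s by (simp add: at_within_eq_bot_iff)
    ultimately have "0 \<le> sale_gap q \<tau> s \<omega>"
      by (rule tendsto_lowerbound)
    then have "X q s \<omega> = c / \<gamma> * cost ?x"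
      using at(3) by (simp add: sale_gap_after[of \<tau> \<omega> s, OF \<tau>s])
    moreover have "value_at (X q) ?\<nu> \<omega> = X q s \<omega>"
      using at(1,2) by (simp add: sale_rule_eq_hit[OF q] value_at_def)
    ultimately show ?thesis using utility_threshold[OF x] by simp
  qed
  then show ?thesis using False q by (simp add: payoff_finite tangent_payoff_finite)
qed (simp add: payoff_infinite tangent_payoff_infinite)

text \<open>Up to the sale the price stays at or below the threshold, whose power
  \<open>\<beta>\<close> is integrable. The martingale is thereby dominated and its weighted mean is
  preserved.\<close>

lemma J_sale_rule:
  assumes q: "0 < q" and \<tau>: "stopping_time F \<tau>"
  shows "J M X U \<gamma> l \<Psi> R q \<tau> (sale_rule X c \<gamma> l \<Psi> R q \<tau>) = ereal (\<integral>\<omega>. tangent_payoff q \<tau> \<tau> \<omega> \<partial>M)"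
proof -
  let ?\<nu> = "sale_rule X c \<gamma> l \<Psi> R q \<tau>"
  note \<nu> = sale_rule_stopping[OF q \<tau>]
  define D where "D \<omega> = (c / \<gamma>) powr \<beta> * cost (value_at (X q) \<tau> \<omega>) powr \<beta> / q powr \<beta>" for \<omega>
  have dom: "Y (capped ?\<nu> (real n) \<omega>) \<omega> \<le> D \<omega>" if "\<tau> \<omega> \<le> ennreal (real n)" for \<omega> n
  proof -
    define t where "t = capped ?\<nu> (real n) \<omega>"
    have t: "0 \<le> t" by (simp add: t_def capped_bounds)
    have t_eq: "ennreal t = min (?\<nu> \<omega>) (ennreal (real n))"
      by (simp add: t_def capped_def ennreal_enn2real_if min_def top_unique)
    have \<tau>t: "\<tau> \<omega> \<le> ennreal t" unfolding t_eq using that sale_rule_ge by simp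
    \<comment> \<open>A negative gap would, by the intermediate value theorem, have vanished
      earlier, so the sale would precede \<open>t\<close>; but \<open>t\<close> is at most the sale
      time.\<close>
    have "0 \<le> sale_gap q \<tau> t \<omega>"
    proof (rule ccontr)
      assume neg: "\<not> 0 \<le> sale_gap q \<tau> t \<omega>"
      note cont = continuous_adapted_cont[OF sale_gap_continuous_adapted[OF \<tau>], of q \<omega>]
      have "continuous_on {0..t} (\<lambda>t. sale_gap q \<tau> t \<omega>)"
        using cont by (rule continuous_on_subset) auto
      moreover have "0 < sale_gap q \<tau> 0 \<omega>" using sale_gap_before[OF q] by simp
      ultimately obtain u where u: "0 \<le> u" "u \<le> t" "sale_gap q \<tau> u \<omega> = 0"
        using IVT2'[of "\<lambda>t. sale_gap q \<tau> t \<omega>" t 0 0] neg t by auto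
      then have "u < t" using neg by (cases "u = t") auto
      have "?\<nu> \<omega> \<le> ennreal u"
        unfolding sale_rule_eq_hit[OF q] hit_def using u by (intro Inf_lower) auto
      also have "\<dots> < ennreal t" using u \<open>u < t\<close> by (simp add: ennreal_less_iff)
      also have "\<dots> \<le> ?\<nu> \<omega>" unfolding t_eq by simp
      finally show False by simp
    qed
    then have "X q t \<omega> \<le> c / \<gamma> * cost (value_at (X q) \<tau> \<omega>)"
      by (simp add: sale_gap_after[of \<tau> \<omega> t, OF \<tau>t])
    then have "X q t \<omega> powr \<beta> \<le> (c / \<gamma> * cost (value_at (X q) \<tau> \<omega>)) powr \<beta>"
      using price_pos[OF q, of t \<omega>] \<beta>_pos by (intro powr_mono2) auto
    also have "\<dots> = (c / \<gamma>) powr \<beta> * cost (value_at (X q) \<tau> \<omega>) powr \<beta>"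
      by (subst powr_mult) (use c \<gamma> cost_ge(3)[OF value_nonneg[OF q, of \<tau> \<omega>]] in auto)
    finally show ?thesis using q by (simp add: D_def price_powr t_def[symmetric] field_simps)
  qed
  have Di: "integrable M D" unfolding D_def using cost_integrable(1)[OF q \<tau>] by simp
  have D0: "0 \<le> D \<omega>" for \<omega> by (simp add: D_def)
  note vm = value_at_martingale[OF \<tau> \<nu> sale_rule_ge weight_process(1)[OF q] weight_process(2)[OF q] weight_process(3)[OF q] \<theta> Di dom D0]
  note s = value_at_supermartingale(1)[OF \<tau> \<nu> sale_rule_ge weight_process(1)[OF q] weight_process(2)[OF q] weight_process(3)[OF q] \<theta>]
  note s' = value_at_supermartingale(1)[OF \<tau> \<tau> order_refl weight_process(1)[OF q] weight_process(2)[OF q] weight_process(3)[OF q] \<theta>]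
  note f = fixed_loss_integrable[OF q \<tau>]
  have "(\<integral>\<omega>. payoff q \<tau> ?\<nu> \<omega> \<partial>M) = (\<integral>\<omega>. tangent_payoff q \<tau> ?\<nu> \<omega> \<partial>M)"
    by (simp add: payoff_sale_rule[OF q \<tau>])
  also have "\<dots> = (\<integral>\<omega>. tangent_payoff q \<tau> \<tau> \<omega> \<partial>M)"
    unfolding tangent_payoff_def using vm
    by (subst (1 2) Bochner_Integration.integral_diff) (use s s' f in simp_all)
  finally show ?thesis by (simp add: J_eq_payoff[OF q \<tau> \<nu> sale_rule_ge])
qed

end

context trading_problem
begin

subsection \<open>The exit and entry problems\<close>

text \<open>The exit problem is the sequential one with purchase at time 0, where the reference
  level is \<open>cost q\<close>. The tangent bound and the sale rule therefore give its
  value.\<close>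

lemma V1_eq:
  assumes q: "0 < q"
  shows "V1 M F X U \<gamma> q (l * q + \<Psi> + R) = ereal (buy_value q)"
proof -
  have st0: "stopping_time F (\<lambda>_. 0)" by (rule stopping_time_const)
  have J0: "ext_expectation M (\<lambda>\<omega>. ereal (U (\<gamma> * price_at X q \<nu> \<omega> - (l * q + \<Psi> + R)))) = J M X U \<gamma> l \<Psi> R q (\<lambda>_. 0) \<nu>" for \<nu>
  proof -
    have "payoff q (\<lambda>_. 0) \<nu> \<omega> = U (\<gamma> * price_at X q \<nu> \<omega> - (l * q + \<Psi> + R))" for \<omega>
      by (simp add: payoff_finite price_at_eq cost_def) (simp add: value_at_def gbm_def)
    then show ?thesis by (simp add: J_def payoff_def)
  qed
  have E0: "(\<integral>\<omega>. tangent_payoff q (\<lambda>_. 0) (\<lambda>_. 0) \<omega> \<partial>M) = buy_value q"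
    using q by (simp add: tangent_payoff_self value_at_def gbm_def prob_space)
  have "V1 M F X U \<gamma> q (l * q + \<Psi> + R) = (SUP \<nu>\<in>{\<nu>. stopping_time F \<nu>}. J M X U \<gamma> l \<Psi> R q (\<lambda>_. 0) \<nu>)"
    using q by (simp add: V1_def J0)
  also have "\<dots> = ereal (buy_value q)"
  proof (rule antisym)
    show "(SUP \<nu>\<in>{\<nu>. stopping_time F \<nu>}. J M X U \<gamma> l \<Psi> R q (\<lambda>_. 0) \<nu>) \<le> ereal (buy_value q)"
      using J_le[OF q st0] E0 by (intro SUP_least) auto
    have "ereal (buy_value q) = J M X U \<gamma> l \<Psi> R q (\<lambda>_. 0) (sale_rule X c \<gamma> l \<Psi> R q (\<lambda>_. 0))"
      using J_sale_rule[OF q st0] E0 by simp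
    also have "\<dots> \<le> (SUP \<nu>\<in>{\<nu>. stopping_time F \<nu>}. J M X U \<gamma> l \<Psi> R q (\<lambda>_. 0) \<nu>)"
      using sale_rule_stopping[OF q st0] by (intro SUP_upper) auto
    finally show "ereal (buy_value q) \<le> (SUP \<nu>\<in>{\<nu>. stopping_time F \<nu>}. J M X U \<gamma> l \<Psi> R q (\<lambda>_. 0) \<nu>)" .
  qed
  finally show ?thesis .
qed

lemma G2_eq:
  assumes "0 \<le> q"
  shows "G2 M F X U \<gamma> l \<Psi> R q = ereal (entry_gain q)"
proof (cases "q = 0")
  case True
  then have "G2 M F X U \<gamma> l \<Psi> R q = max (ereal (buy_value 0)) (ereal (- k * R powr \<alpha>))"
    by (simp add: G2_def V1_def buy_value_0 utility_neg_R)
  then show ?thesis using True by (simp add: entry_gain_def max_def)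
next
  case False
  then have "G2 M F X U \<gamma> l \<Psi> R q = max (ereal (buy_value q)) (ereal (- k * R powr \<alpha>))"
    using assms V1_eq[of q] by (simp add: G2_def utility_neg_R)
  then show ?thesis by (simp add: entry_gain_def max_def)
qed

lemma entry_gain_measurable [measurable]: "entry_gain \<in> borel_measurable borel"
  unfolding entry_gain_def[abs_def] buy_value_def \<zeta>_def cost_def by measurable

lemma entry_gain_eq: "0 \<le> x \<Longrightarrow> entry_gain x = gain (x powr \<beta>) - k * R powr \<alpha>"
  by (simp add: gain_powr)

lemma entry_gain_value:
  assumes q: "0 < q"
  shows "entry_gain (value_at (X q) \<tau> \<omega>) = gain (q powr \<beta> * value_at Y \<tau> \<omega>) - k * R powr \<alpha>"
  by (simp add: entry_gain_eq value_nonneg[OF q] value_powr[OF q])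

lemma entry_integrable:
  assumes q: "0 < q" and \<tau>: "stopping_time F \<tau>"
  shows "integrable M (\<lambda>\<omega>. entry_gain (value_at (X q) \<tau> \<omega>))"
proof (rule Bochner_Integration.integrable_bound)
  define m where "m = A * \<gamma> powr \<beta> * R powr (\<alpha> - \<beta>)"
  have mn: "(m, 0) \<in> affine_majorants gain" using gain_majorant by (simp add: m_def)
  show "integrable M (\<lambda>\<omega>. m * (q powr \<beta> * value_at Y \<tau> \<omega>) + k * R powr \<alpha>)"
    using value_Y(1)[OF \<tau>] by simp
  show "(\<lambda>\<omega>. entry_gain (value_at (X q) \<tau> \<omega>)) \<in> borel_measurable M"
    using value_at_measurable_price[OF \<tau>] by measurable
  show "AE \<omega> in M. norm (entry_gain (value_at (X q) \<tau> \<omega>)) \<le> norm (m * (q powr \<beta> * value_at Y \<tau> \<omega>) + k * R powr \<alpha>)"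
  proof (rule AE_I2)
    fix \<omega>
    define s where "s = q powr \<beta> * value_at Y \<tau> \<omega>"
    have "0 \<le> s" using value_Y(3)[OF \<tau>] by (simp add: s_def)
    then have "0 \<le> gain s" "gain s \<le> m * s" using gain_nonneg majorant_le[OF mn, of s] by auto
    moreover have "0 \<le> k * R powr \<alpha>" using k by simp
    ultimately show "norm (entry_gain (value_at (X q) \<tau> \<omega>)) \<le> norm (m * (q powr \<beta> * value_at Y \<tau> \<omega>) + k * R powr \<alpha>)"
      unfolding entry_gain_value[OF q] s_def[symmetric] by auto
  qed
qed

lemma entry_expectation:
  assumes q: "0 < q" and \<tau>: "stopping_time F \<tau>"
  shows "ext_expectation M (\<lambda>\<omega>. G2 M F X U \<gamma> l \<Psi> R (price_at X q \<tau> \<omega>)) =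
    ereal (\<integral>\<omega>. entry_gain (value_at (X q) \<tau> \<omega>) \<partial>M)"
  using ext_expectation_real[OF entry_integrable[OF assms]]
  by (simp add: price_at_eq G2_eq[OF value_nonneg[OF q]])

text \<open>Each affine majorant is integrated separately: its slope is nonnegative and the
  martingale mean at \<open>\<tau>\<close> is at most 1. The infimum over majorants is taken
  last.\<close>

lemma entry_le_envelope:
  assumes q: "0 < q" and \<tau>: "stopping_time F \<tau>"
  shows "(\<integral>\<omega>. entry_gain (value_at (X q) \<tau> \<omega>) \<partial>M) \<le> envelope gain (q powr \<beta>) - k * R powr \<alpha>"
proof -
  have "(\<integral>\<omega>. entry_gain (value_at (X q) \<tau> \<omega>) \<partial>M) + k * R powr \<alpha> \<le> envelope gain (q powr \<beta>)"
  proof (rule envelope_greatest)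
    fix m n assume mn: "(m, n) \<in> affine_majorants gain"
    then have m0: "0 \<le> m" by (simp add: affine_majorants_def)
    have i: "integrable M (\<lambda>\<omega>. m * (q powr \<beta> * value_at Y \<tau> \<omega>) + n - k * R powr \<alpha>)"
      using value_Y(1)[OF \<tau>] by simp
    have "(\<integral>\<omega>. entry_gain (value_at (X q) \<tau> \<omega>) \<partial>M) \<le> (\<integral>\<omega>. m * (q powr \<beta> * value_at Y \<tau> \<omega>) + n - k * R powr \<alpha> \<partial>M)"
    proof (rule integral_mono[OF entry_integrable[OF assms] i])
      fix \<omega>
      have "gain (q powr \<beta> * value_at Y \<tau> \<omega>) \<le> m * (q powr \<beta> * value_at Y \<tau> \<omega>) + n"
        using value_Y(3)[OF \<tau>] by (intro majorant_le[OF mn]) simp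
      then show "entry_gain (value_at (X q) \<tau> \<omega>) \<le> m * (q powr \<beta> * value_at Y \<tau> \<omega>) + n - k * R powr \<alpha>"
        by (simp add: entry_gain_value[OF q])
    qed
    also have "\<dots> = m * (q powr \<beta> * (\<integral>\<omega>. value_at Y \<tau> \<omega> \<partial>M)) + n - k * R powr \<alpha>"
      using value_Y(1)[OF \<tau>] by (simp add: prob_space)
    also have "\<dots> \<le> m * (q powr \<beta> * 1) + n - k * R powr \<alpha>"
      using value_Y(2)[OF \<tau>] m0 by (intro diff_right_mono add_right_mono mult_left_mono) auto
    finally show "(\<integral>\<omega>. entry_gain (value_at (X q) \<tau> \<omega>) \<partial>M) + k * R powr \<alpha> \<le> m * q powr \<beta> + n"
      by simp
  qed
  then show ?thesis by simp
qed

definition entry_gap :: "real \<Rightarrow> real \<Rightarrow> 'a \<Rightarrow> real" where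
  "entry_gap q t \<omega> = envelope gain (q powr \<beta> * Y t \<omega>) - gain (q powr \<beta> * Y t \<omega>)"

definition entry_time :: "real \<Rightarrow> 'a \<Rightarrow> ennreal" where
  "entry_time q = hit (entry_gap q)"

lemma Y_pos: "0 < q \<Longrightarrow> 0 < q powr \<beta> * Y t \<omega>"
  by (simp add: mart_pos)

lemma scaled_Y_cont: "continuous_on {0..} (\<lambda>t. q powr \<beta> * Y t \<omega>)"
  by (intro continuous_intros gbm_cont)

lemma entry_gap_nonneg: "0 < q \<Longrightarrow> 0 \<le> entry_gap q t \<omega>"
  using le_envelope[OF less_imp_le[OF Y_pos]] by (simp add: entry_gap_def)

lemma entry_gap_continuous_adapted:
  assumes q: "0 < q"
  shows "continuous_adapted (entry_gap q)"
proof -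
  have gap: "continuous_on {0<..} (\<lambda>s. envelope gain s - gain s)"
    by (intro continuous_intros envelope_cont continuous_on_subset[OF g_cont]) auto
  \<comment> \<open>The envelope is known to be continuous on the open half-line only. Passing to
    the logarithm gives a function continuous on all reals, hence Borel.\<close>
  have e: "continuous_on UNIV (\<lambda>x. envelope gain (exp x) - gain (exp x))"
    by (rule continuous_on_compose2[OF gap]) (auto intro!: continuous_intros)
  have "entry_gap q t \<in> borel_measurable (F (ennreal t))" if t: "0 \<le> t" for t
  proof -
    have [measurable]: "Y t \<in> borel_measurable (F (ennreal t))"
      using gbm_measurable_F[OF t order_refl] .
    have [measurable]: "(\<lambda>x. envelope gain (exp x) - gain (exp x)) \<in> borel_measurable borel"
      using e by (rule borel_measurable_continuous_onI)
    have "(\<lambda>\<omega>. (\<lambda>x. envelope gain (exp x) - gain (exp x)) (ln (q powr \<beta> * Y t \<omega>))) \<in> borel_measurable (F (ennreal t))"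
      by measurable
    then show ?thesis
      using Y_pos[OF q, of t] by (simp add: entry_gap_def[abs_def])
  qed
  moreover have "continuous_on {0..} (\<lambda>t. entry_gap q t \<omega>)" for \<omega>
    unfolding entry_gap_def
    by (rule continuous_on_compose2[OF gap scaled_Y_cont]) (use Y_pos[OF q] in auto)
  ultimately show ?thesis by (simp add: continuous_adapted_def adapted_def)
qed

lemma entry_time_stopping: "0 < q \<Longrightarrow> stopping_time F (entry_time q)"
  unfolding entry_time_def by (rule hit_stopping_time[OF entry_gap_continuous_adapted])

lemma contact_stops:
  assumes q: "0 < q" and t: "0 \<le> t" "ennreal t \<le> entry_time q \<omega>" and u: "0 \<le> u" "u < t"
  shows "gain (q powr \<beta> * Y u \<omega>) < envelope gain (q powr \<beta> * Y u \<omega>)"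
proof (rule ccontr)
  assume "\<not> ?thesis"
  then have "entry_time q \<omega> \<le> ennreal u"
    unfolding entry_time_def hit_def using u by (intro Inf_lower) (auto simp: entry_gap_def)
  also have "ennreal u < ennreal t" using u by (simp add: ennreal_less_iff)
  finally show False using t by simp
qed

text \<open>Until the entry time the path cannot cross a contact point of the minimal majorant,
  because the envelope meets the gain there. It thus ends where the envelope is this majorant, and
  the mean of an affine function is computed by optional stopping.\<close>

lemma entry_attained:
  assumes q: "0 < q"
  shows "(\<integral>\<omega>. entry_gain (value_at (X q) (entry_time q) \<omega>) \<partial>M) = envelope gain (q powr \<beta>) - k * R powr \<alpha>"
proof -
  let ?\<tau> = "entry_time q"
  let ?s = "q powr \<beta>"
  let ?S = "\<lambda>t \<omega>. ?s * Y t \<omega>"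
  note \<tau> = entry_time_stopping[OF q]
  have s: "0 < ?s" using q by simp
  obtain \<kappa> where \<kappa>: "0 \<le> \<kappa>" "\<And>m. \<kappa> < m \<Longrightarrow> \<exists>K. \<forall>u\<ge>K. gain u \<le> m * u"
    "\<kappa> = 0 \<or> (\<forall>u\<ge>0. gain u < \<kappa> * u + k * R powr \<alpha>) \<and>
      (\<forall>e>0. \<exists>K. \<forall>u\<ge>K. \<kappa> * u + k * R powr \<alpha> - e \<le> gain u)"
    using gain_growth by blast
  obtain m n a where mn: "(m, n) \<in> affine_majorants gain" and att: "envelope gain ?s = m * ?s + n"
    and a: "0 \<le> a" "a \<le> ?s" "gain a = m * a + n" and b: "m = 0 \<or> (\<exists>b\<ge>?s. gain b = m * b + n)"
    using contact_points[OF \<kappa>(2) \<kappa>(1) \<kappa>(3) s] by blast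
  have contact: "envelope gain v \<le> gain v" if "0 \<le> v" "gain v = m * v + n" for v
    using envelope_le[OF mn that(1)] that by simp
  have cont: "continuous_on {0..t} (\<lambda>t. ?S t \<omega>)" for t \<omega>
    using scaled_Y_cont by (rule continuous_on_subset) auto
  have above_a: "a \<le> ?S t \<omega>" if t: "0 \<le> t" "ennreal t \<le> ?\<tau> \<omega>" for t \<omega>
  proof (rule ccontr)
    assume neg: "\<not> a \<le> ?S t \<omega>"
    then obtain u where u: "0 \<le> u" "u \<le> t" "?S u \<omega> = a"
      using IVT2'[of "\<lambda>t. ?S t \<omega>" t a 0] cont[of t \<omega>] t a by auto
    then have "u < t" using neg by (cases "u = t") auto
    then show False using contact_stops[OF q t u(1)] contact[OF a(1,3)] u(3) by simp
  qed
  have below_b: "?S t \<omega> \<le> b" if t: "0 \<le> t" "ennreal t \<le> ?\<tau> \<omega>" and b: "?s \<le> b" "gain b = m * b + n" for t \<omega> b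
  proof (rule ccontr)
    assume neg: "\<not> ?S t \<omega> \<le> b"
    then obtain u where u: "0 \<le> u" "u \<le> t" "?S u \<omega> = b"
      using IVT'[of "\<lambda>t. ?S t \<omega>" 0 b t] cont[of t \<omega>] t b by auto
    then have "u < t" using neg by (cases "u = t") auto
    moreover have "0 \<le> b" using b(1) s by linarith
    ultimately show False using contact_stops[OF q t u(1)] contact[OF _ b(2)] u(3) by simp
  qed
  have affine: "AE \<omega> in M. gain (?s * value_at Y ?\<tau> \<omega>) = m * (?s * value_at Y ?\<tau> \<omega>) + n"
    using mart_tendsto_0[OF \<theta>]
  proof eventually_elim
    case (elim \<omega>)
    from continuous_adapted_cont[OF entry_gap_continuous_adapted[OF q], of \<omega>] show ?case
    proof (cases rule: hit_cases)
      \<comment> \<open>A path that never stops stays above \<open>a\<close> yet tends to 0, so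
        \<open>a = 0\<close>; contact at 0 is then exactly the required identity at the limit
        price.\<close>
      case never
      then have inf: "?\<tau> \<omega> = \<infinity>" by (simp add: entry_time_def)
      have "(\<lambda>n. ?S (real n) \<omega>) \<longlonglongrightarrow> ?s * 0" by (intro tendsto_intros elim)
      moreover have "a \<le> ?S (real n) \<omega>" for n using above_a[of "real n" \<omega>] inf by simp
      ultimately have "a \<le> ?s * 0" by (intro LIMSEQ_le_const) auto
      then have "a = 0" using a by simp
      then show ?thesis using a inf by (simp add: value_at_def)
    next
      case (at t)
      then have \<tau>t: "?\<tau> \<omega> = ennreal t" by (simp add: entry_time_def)
      then have v: "?s * value_at Y ?\<tau> \<omega> = ?S t \<omega>" using at(1) by (simp add: value_at_def)
      have low: "a \<le> ?S t \<omega>" using above_a[OF at(1)] \<tau>t by simp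
      have "?S t \<omega> \<le> b" if "?s \<le> b" "gain b = m * b + n" for b
        using below_b[OF at(1) _ that, of \<omega>] \<tau>t by simp
      then have "m = 0 \<or> (\<exists>b\<ge>?S t \<omega>. gain b = m * b + n)"
        using b by blast
      then have "envelope gain (?S t \<omega>) = m * ?S t \<omega> + n"
        by (rule envelope_affine[OF mn a(1,3) low])
      moreover have "gain (?S t \<omega>) = envelope gain (?S t \<omega>)"
        using at(3) entry_gap_nonneg[OF q, of t \<omega>] by (simp add: entry_gap_def)
      ultimately show ?thesis unfolding v by simp
    qed
  qed
  \<comment> \<open>For slope 0 the martingale mean is irrelevant. Otherwise the right contact point
    bounds the path up to the entry time, and the mean is preserved.\<close>
  have mean: "m * (?s * (\<integral>\<omega>. value_at Y ?\<tau> \<omega> \<partial>M)) = m * ?s"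
    using b
  proof
    assume "\<exists>b\<ge>?s. gain b = m * b + n"
    then obtain b where b: "?s \<le> b" "gain b = m * b + n" by blast
    have one: "continuous_adapted (\<lambda>_ _. 1)"
      by (simp add: continuous_adapted_def adapted_def)
    have dom: "Y (capped ?\<tau> (real n) \<omega>) \<omega> \<le> b / ?s" for n \<omega>
    proof -
      have "ennreal (capped ?\<tau> (real n) \<omega>) = min (?\<tau> \<omega>) (ennreal (real n))"
        by (simp add: capped_def ennreal_enn2real_if min_def top_unique)
      also have "\<dots> \<le> ?\<tau> \<omega>" by (rule min.cobounded1)
      finally have "?S (capped ?\<tau> (real n) \<omega>) \<omega> \<le> b"
        using below_b[OF capped_bounds(1) _ b] by simp
      then show ?thesis using s by (simp add: field_simps)
    qed
    \<comment> \<open>Constant weight 1 and initial time 0 turn weighted optional stopping into the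
      plain statement.\<close>
    have "(\<integral>\<omega>. value_at (\<lambda>_ _. 1) (\<lambda>_. 0) \<omega> * value_at Y ?\<tau> \<omega> \<partial>M) = (\<integral>\<omega>. value_at (\<lambda>_ _. 1) (\<lambda>_. 0) \<omega> * value_at Y (\<lambda>_. 0) \<omega> \<partial>M)"
      by (rule value_at_martingale[OF stopping_time_const \<tau> _ one, where C = 1 and D = "\<lambda>_. b / ?s"])
         (use \<theta> dom order_trans[OF less_imp_le[OF s] b(1)] in auto)
    then show ?thesis by (simp add: value_at_def prob_space)
  qed simp
  have "(\<integral>\<omega>. entry_gain (value_at (X q) ?\<tau> \<omega>) \<partial>M) = (\<integral>\<omega>. m * (?s * value_at Y ?\<tau> \<omega>) + n - k * R powr \<alpha> \<partial>M)"
  proof (rule integral_cong_AE)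
    show "(\<lambda>\<omega>. entry_gain (value_at (X q) ?\<tau> \<omega>)) \<in> borel_measurable M"
      using entry_integrable[OF q \<tau>] by simp
    show "(\<lambda>\<omega>. m * (?s * value_at Y ?\<tau> \<omega>) + n - k * R powr \<alpha>) \<in> borel_measurable M"
      using value_Y(1)[OF \<tau>] by (auto dest: borel_measurable_integrable)
    show "AE \<omega> in M. entry_gain (value_at (X q) ?\<tau> \<omega>) = m * (?s * value_at Y ?\<tau> \<omega>) + n - k * R powr \<alpha>"
      using affine by eventually_elim (simp add: entry_gain_value[OF q])
  qed
  also have "\<dots> = m * (?s * (\<integral>\<omega>. value_at Y ?\<tau> \<omega> \<partial>M)) + n - k * R powr \<alpha>"
    using value_Y(1)[OF \<tau>] by (simp add: prob_space)
  finally show ?thesis using mean att by simp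
qed

lemma V2_eq:
  assumes q: "0 < q"
  shows "V2 M F X U \<gamma> l \<Psi> R q = ereal (envelope gain (q powr \<beta>) - k * R powr \<alpha>)"
  unfolding V2_def
proof (rule antisym)
  show "(SUP \<tau>\<in>{\<tau>. stopping_time F \<tau>}. ext_expectation M (\<lambda>\<omega>. G2 M F X U \<gamma> l \<Psi> R (price_at X q \<tau> \<omega>)))
      \<le> ereal (envelope gain (q powr \<beta>) - k * R powr \<alpha>)"
    using entry_le_envelope[OF q] by (intro SUP_least) (auto simp: entry_expectation[OF q])
  have "ereal (envelope gain (q powr \<beta>) - k * R powr \<alpha>) =
      ext_expectation M (\<lambda>\<omega>. G2 M F X U \<gamma> l \<Psi> R (price_at X q (entry_time q) \<omega>))"
    by (simp add: entry_expectation[OF q entry_time_stopping[OF q]] entry_attained[OF q])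
  also have "\<dots> \<le> (SUP \<tau>\<in>{\<tau>. stopping_time F \<tau>}. ext_expectation M (\<lambda>\<omega>. G2 M F X U \<gamma> l \<Psi> R (price_at X q \<tau> \<omega>)))"
    using entry_time_stopping[OF q] by (intro SUP_upper) simp
  finally show "ereal (envelope gain (q powr \<beta>) - k * R powr \<alpha>) \<le>
      (SUP \<tau>\<in>{\<tau>. stopping_time F \<tau>}. ext_expectation M (\<lambda>\<omega>. G2 M F X U \<gamma> l \<Psi> R (price_at X q \<tau> \<omega>)))" .
qed

lemma entry_gap_eq_0_iff:
  assumes q: "0 < q"
  shows "V2 M F X U \<gamma> l \<Psi> R (X q t \<omega>) = G2 M F X U \<gamma> l \<Psi> R (X q t \<omega>) \<longleftrightarrow> entry_gap q t \<omega> \<le> 0"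
  using entry_gap_nonneg[OF q, of t \<omega>] price_pos[OF q, of t \<omega>]
  by (simp add: V2_eq G2_eq entry_gain_eq price_powr[OF q] entry_gap_def)

lemma purchase_rule_eq: "0 < q \<Longrightarrow> purchase_rule M F X U \<gamma> l \<Psi> R q = entry_time q"
  by (simp add: purchase_rule_def entry_time_def hit_def fun_eq_iff entry_gap_eq_0_iff)

text \<open>The entry reward allows staying out even when stopped, whereas a finite purchase time
  forces a purchase. The two agree if the envelope is positive at the start; if it is 0, the rule
  buys at once, and never trading attains the value.\<close>

lemma sequential_eq:
  assumes p: "0 < p"
  defines "\<tau> \<equiv> purchase_rule M F X U \<gamma> l \<Psi> R p"
  defines "\<nu> \<equiv> sale_rule X c \<gamma> l \<Psi> R p \<tau>"
  shows "sequential_value M F X U \<gamma> l \<Psi> R p = V2 M F X U \<gamma> l \<Psi> R p"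
    and "stopping_time F \<tau>" "stopping_time F \<nu>"
    and "V2 M F X U \<gamma> l \<Psi> R p \<noteq> ereal (U (- R)) \<or> V1 M F X U \<gamma> p (l * p + \<Psi> + R) = ereal (U (- R)) \<Longrightarrow>
      J M X U \<gamma> l \<Psi> R p \<tau> \<nu> = V2 M F X U \<gamma> l \<Psi> R p"
    and "V2 M F X U \<gamma> l \<Psi> R p = ereal (U (- R)) \<Longrightarrow>
      J M X U \<gamma> l \<Psi> R p (\<lambda>_. \<infinity>) (\<lambda>_. \<infinity>) = V2 M F X U \<gamma> l \<Psi> R p"
proof -
  have \<tau>_eq: "\<tau> = entry_time p" unfolding \<tau>_def by (rule purchase_rule_eq[OF p])
  show st: "stopping_time F \<tau>" unfolding \<tau>_eq by (rule entry_time_stopping[OF p])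
  then show sn: "stopping_time F \<nu>" unfolding \<nu>_def by (rule sale_rule_stopping[OF p])
  let ?v = "envelope gain (p powr \<beta>) - k * R powr \<alpha>"
  have V2: "V2 M F X U \<gamma> l \<Psi> R p = ereal ?v" by (rule V2_eq[OF p])
  \<comment> \<open>With a positive envelope the gain is positive wherever the rule stops, so the
    maximum in the reward is the value of buying. Never stopping yields the reward at 0, which is
    that of staying out.\<close>
  have J\<tau>: "J M X U \<gamma> l \<Psi> R p \<tau> \<nu> = V2 M F X U \<gamma> l \<Psi> R p" if pos: "envelope gain (p powr \<beta>) \<noteq> 0"
  proof -
    have "tangent_payoff p \<tau> \<tau> \<omega> = entry_gain (value_at (X p) \<tau> \<omega>)" for \<omega>
    proof (cases "\<tau> \<omega> = \<infinity>")
      case True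
      then show ?thesis by (simp add: tangent_payoff_infinite value_at_def entry_gain_0)
    next
      case False
      from continuous_adapted_cont[OF entry_gap_continuous_adapted[OF p], of \<omega>] show ?thesis
      proof (cases rule: hit_cases)
        case never
        then show ?thesis using False by (simp add: \<tau>_eq entry_time_def)
      next
        case (at t)
        let ?S = "p powr \<beta> * Y t \<omega>"
        have v: "value_at Y \<tau> \<omega> = Y t \<omega>"
          using at(1,2) by (simp add: \<tau>_eq entry_time_def value_at_def)
        have "envelope gain ?S \<noteq> 0"
          using envelope_zero[OF Y_pos[OF p] _ , of t \<omega> "p powr \<beta>"] pos by auto
        moreover have "gain ?S = envelope gain ?S"
          using at(3) entry_gap_nonneg[OF p, of t \<omega>] by (simp add: entry_gap_def)
        ultimately have "gain ?S > 0" using gain_nonneg[of ?S] by simp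
        then have "entry_gain (value_at (X p) \<tau> \<omega>) > - k * R powr \<alpha>"
          by (simp add: entry_gain_value[OF p] v)
        then show ?thesis using False p by (simp add: tangent_payoff_self entry_gain_def max_def split: if_splits)
      qed
    qed
    then have "(\<integral>\<omega>. tangent_payoff p \<tau> \<tau> \<omega> \<partial>M) = (\<integral>\<omega>. entry_gain (value_at (X p) \<tau> \<omega>) \<partial>M)"
      by simp
    also have "\<dots> = ?v" unfolding \<tau>_eq by (rule entry_attained[OF p])
    finally show ?thesis unfolding \<nu>_def J_sale_rule[OF p st] V2 by simp
  qed
  have Jinf: "J M X U \<gamma> l \<Psi> R p (\<lambda>_. \<infinity>) (\<lambda>_. \<infinity>) = ereal (U (- R))"
    using ext_expectation_real[of M "\<lambda>_. U (- R)"] by (simp add: J_def prob_space)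
  have zero_iff: "V2 M F X U \<gamma> l \<Psi> R p = ereal (U (- R)) \<longleftrightarrow> envelope gain (p powr \<beta>) = 0"
    by (simp add: V2 utility_neg_R)
  show "J M X U \<gamma> l \<Psi> R p (\<lambda>_. \<infinity>) (\<lambda>_. \<infinity>) = V2 M F X U \<gamma> l \<Psi> R p"
    if "V2 M F X U \<gamma> l \<Psi> R p = ereal (U (- R))"
    using Jinf that by simp
  show "J M X U \<gamma> l \<Psi> R p \<tau> \<nu> = V2 M F X U \<gamma> l \<Psi> R p"
    if "V2 M F X U \<gamma> l \<Psi> R p \<noteq> ereal (U (- R)) \<or> V1 M F X U \<gamma> p (l * p + \<Psi> + R) = ereal (U (- R))"
  proof (cases "envelope gain (p powr \<beta>) = 0")
    case True
    then have V2R: "V2 M F X U \<gamma> l \<Psi> R p = ereal (U (- R))" using zero_iff by simp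
    then have bv: "buy_value p = U (- R)" using that V1_eq[OF p] by simp
    \<comment> \<open>Gain and envelope are both 0 at the starting point, so contact already occurs
      at time 0 and the payoff is the exit value.\<close>
    have "\<tau> \<omega> = 0" for \<omega>
    proof -
      have "gain (p powr \<beta>) \<le> 0" using le_envelope[of "p powr \<beta>"] True by simp
      then have "entry_gap p 0 \<omega> \<le> 0" using True gain_nonneg[of "p powr \<beta>"] by (simp add: entry_gap_def)
      then have "hit (entry_gap p) \<omega> \<le> ennreal 0" unfolding hit_def by (intro Inf_lower CollectI exI[of _ 0]) auto
      then show ?thesis by (simp add: \<tau>_eq entry_time_def)
    qed
    then have "tangent_payoff p \<tau> \<tau> = (\<lambda>_. U (- R))"
      using p bv by (intro ext) (simp add: tangent_payoff_self value_at_def gbm_def)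
    then show ?thesis
      unfolding \<nu>_def J_sale_rule[OF p st] V2R by (simp add: prob_space)
  qed (rule J\<tau>)
  show "sequential_value M F X U \<gamma> l \<Psi> R p = V2 M F X U \<gamma> l \<Psi> R p"
    unfolding sequential_value_def
  proof (rule antisym)
    show "(SUP (\<tau>, \<nu>)\<in>admissible_pairs M F. J M X U \<gamma> l \<Psi> R p \<tau> \<nu>) \<le> V2 M F X U \<gamma> l \<Psi> R p"
    proof (intro SUP_least, clarify)
      fix \<tau> \<nu> assume "(\<tau>, \<nu>) \<in> admissible_pairs M F"
      then have st: "stopping_time F \<tau>" "stopping_time F \<nu>" "\<And>\<omega>. \<omega> \<in> space M \<Longrightarrow> \<tau> \<omega> \<le> \<nu> \<omega>"
        by (auto simp: admissible_pairs_def)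
      have "J M X U \<gamma> l \<Psi> R p \<tau> \<nu> \<le> ereal (\<integral>\<omega>. tangent_payoff p \<tau> \<tau> \<omega> \<partial>M)"
        using p st by (rule J_le)
      also have "\<dots> \<le> ereal (\<integral>\<omega>. entry_gain (value_at (X p) \<tau> \<omega>) \<partial>M)"
        unfolding ereal_less_eq
      proof (rule integral_mono[OF _ entry_integrable[OF p st(1)]])
        show "integrable M (tangent_payoff p \<tau> \<tau>)"
          using p st by (intro tangent_payoff_integral(1)) auto
        show "tangent_payoff p \<tau> \<tau> \<omega> \<le> entry_gain (value_at (X p) \<tau> \<omega>)" for \<omega>
          using p by (simp add: tangent_payoff_self entry_gain_def)
      qed
      also have "\<dots> \<le> V2 M F X U \<gamma> l \<Psi> R p"
        using entry_le_envelope[OF p st(1)] by (simp add: V2)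
      finally show "J M X U \<gamma> l \<Psi> R p \<tau> \<nu> \<le> V2 M F X U \<gamma> l \<Psi> R p" .
    qed
    show "V2 M F X U \<gamma> l \<Psi> R p \<le> (SUP (\<tau>, \<nu>)\<in>admissible_pairs M F. J M X U \<gamma> l \<Psi> R p \<tau> \<nu>)"
    proof (cases "envelope gain (p powr \<beta>) = 0")
      case True
      then have "V2 M F X U \<gamma> l \<Psi> R p = J M X U \<gamma> l \<Psi> R p (\<lambda>_. \<infinity>) (\<lambda>_. \<infinity>)"
        using Jinf zero_iff by simp
      moreover have "(\<lambda>_. \<infinity>, \<lambda>_. \<infinity>) \<in> admissible_pairs M F"
        by (simp add: admissible_pairs_def stopping_time_const)
      ultimately show ?thesis by (intro SUP_upper2) auto
    next
      case False
      have "(\<tau>, \<nu>) \<in> admissible_pairs M F"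
        using st sn sale_rule_ge by (simp add: admissible_pairs_def \<nu>_def)
      then show ?thesis using J\<tau>[OF False] by (intro SUP_upper2) auto
    qed
  qed
qed

end

section \<open>Transfer from the explicit exponential to the given price process\<close>

lemma stopping_time_AE_cong:
  assumes uc: "usual_conditions M F" and T: "stopping_time F T" and ae: "AE \<omega> in M. T \<omega> = S \<omega>"
  shows "stopping_time F S"
proof
  fix t
  show "Measurable.pred (F t) (\<lambda>\<omega>. S \<omega> \<le> t)"
  proof (rule measurable_AE_filtration[OF uc stopping_timeD[OF T]])
    show "AE \<omega> in M. (T \<omega> \<le> t) = (S \<omega> \<le> t)" using ae by eventually_elim simp
  qed simp
qed

text \<open>When \<open>V2\<close> equals \<open>U (- R)\<close> at \<open>p\<close>, the purchase
  rule is 0 and yields \<open>V1\<close>, which may be smaller than \<open>U (- R)\<close>. The pair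
  is then optimal if \<open>V1\<close> also equals \<open>U (- R)\<close>, and never trading is
  optimal in every such case. The claims for the exponential carry over because only null sets are
  involved.\<close>

theorem theorem4p13:
  fixes M :: "'a measure" and F :: "ennreal \<Rightarrow> 'a measure"
    and B :: "real \<Rightarrow> 'a \<Rightarrow> real" and P :: "real \<Rightarrow> real \<Rightarrow> 'a \<Rightarrow> real"
    and \<mu> \<sigma> \<alpha> \<beta> k \<gamma> l \<Psi> R c p :: real
    and U :: "real \<Rightarrow> real" and \<tau> \<nu> :: "'a \<Rightarrow> ennreal"
  assumes "usual_conditions M F" and "brownian_motion M F B"
    and "\<And>q. q > 0 \<Longrightarrow> geometric_brownian_motion M F B \<mu> \<sigma> q (P q)"
    and "\<mu> \<ge> 0" and "\<sigma> > 0" and "\<beta> = 1 - 2 * \<mu> / \<sigma>\<^sup>2"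
    and "l \<ge> 1" and "0 < \<gamma>" and "\<gamma> \<le> 1" and "\<Psi> \<ge> 0" and "R > 0"
    and "0 < \<alpha>" and "\<alpha> < 1" and "k > 1"
    and "\<alpha> \<le> \<beta>" and "\<beta> \<le> 1"
    and "c > 1"
    and "\<alpha> / \<beta> * c * (c - 1) powr (\<alpha> - 1) - (c - 1) powr \<alpha> - k = 0"
    and "p > 0"
    and "U = utility \<alpha> k"
    and "\<tau> = purchase_rule M F P U \<gamma> l \<Psi> R p"
    and "\<nu> = sale_rule P c \<gamma> l \<Psi> R p \<tau>"
  shows "sequential_value M F P U \<gamma> l \<Psi> R p = V2 M F P U \<gamma> l \<Psi> R p
    \<and> (\<tau>, \<nu>) \<in> admissible_pairs M F
    \<and> (V2 M F P U \<gamma> l \<Psi> R p \<noteq> ereal (U (- R)) \<or>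
       V1 M F P U \<gamma> p (l * p + \<Psi> + R) = ereal (U (- R))
         \<longrightarrow> optimal_pair M F P U \<gamma> l \<Psi> R p \<tau> \<nu>)
    \<and> (V2 M F P U \<gamma> l \<Psi> R p = ereal (U (- R))
         \<longrightarrow> optimal_pair M F P U \<gamma> l \<Psi> R p (\<lambda>_. \<infinity>) (\<lambda>_. \<infinity>))"
proof -
  note uc = \<open>usual_conditions M F\<close> and bm = \<open>brownian_motion M F B\<close> and p = \<open>p > 0\<close>
  note defs = \<open>U = utility \<alpha> k\<close> \<open>\<tau> = purchase_rule M F P U \<gamma> l \<Psi> R p\<close> \<open>\<nu> = sale_rule P c \<gamma> l \<Psi> R p \<tau>\<close>
  obtain W where W: "brownian_space M F W" and BW: "AE \<omega> in M. \<forall>t\<ge>0. B t \<omega> = W t \<omega>"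
    using ex_brownian_space[OF uc bm] by blast
  interpret brownian_space M F W by (rule W)
  interpret trading_parameters \<alpha> \<beta> k \<gamma> l \<Psi> R c
    by standard (use assms in auto)
  interpret trading_problem M F W \<alpha> \<beta> k \<gamma> l \<Psi> R c \<mu> \<sigma>
    by standard (use assms in auto)
  have adB: "adapted F B" using bm by (simp add: brownian_motion_def)
  have PX: "AE \<omega> in M. \<forall>t\<ge>0. P q t \<omega> = X q t \<omega>" if "0 < q" for q
    by (rule gbm_unique[OF adB BW assms(3)[OF that] \<open>\<mu> \<ge> 0\<close>])
  have price: "AE \<omega> in M. price_at P q \<tau> \<omega> = price_at X q \<tau> \<omega>" if "0 < q" for q and \<tau> :: "'a \<Rightarrow> ennreal"
    using PX[OF that] by eventually_elim (simp add: price_at_def)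
  have J: "J M P U \<gamma> l \<Psi> R p \<tau> \<nu> = J M X U \<gamma> l \<Psi> R p \<tau> \<nu>" for \<tau> \<nu>
    unfolding J_def
    by (rule ext_expectation_cong_AE) (use price[OF p, of \<tau>] price[OF p, of \<nu>] in \<open>eventually_elim; simp\<close>)
  have V1: "V1 M F P U \<gamma> q H = V1 M F X U \<gamma> q H" if "0 \<le> q" for q H
  proof (cases "q = 0")
    case False
    then have q: "0 < q" using that by simp
    have "ext_expectation M (\<lambda>\<omega>. ereal (U (\<gamma> * price_at P q \<nu> \<omega> - H))) = ext_expectation M (\<lambda>\<omega>. ereal (U (\<gamma> * price_at X q \<nu> \<omega> - H)))" for \<nu>
      by (rule ext_expectation_cong_AE) (use price[OF q, of \<nu>] in \<open>eventually_elim; simp\<close>)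
    then show ?thesis by (simp add: V1_def)
  qed (simp add: V1_def)
  have G2: "G2 M F P U \<gamma> l \<Psi> R q = G2 M F X U \<gamma> l \<Psi> R q" if "0 \<le> q" for q
    using V1[OF that] by (simp add: G2_def)
  have V2: "V2 M F P U \<gamma> l \<Psi> R q = V2 M F X U \<gamma> l \<Psi> R q" if q: "0 < q" for q
  proof -
    have "ext_expectation M (\<lambda>\<omega>. G2 M F P U \<gamma> l \<Psi> R (price_at P q \<tau> \<omega>)) =
        ext_expectation M (\<lambda>\<omega>. G2 M F X U \<gamma> l \<Psi> R (price_at X q \<tau> \<omega>))" for \<tau>
    proof (rule ext_expectation_cong_AE, use price[OF q, of \<tau>] in eventually_elim)
      case (elim \<omega>)
      have "0 \<le> price_at X q \<tau> \<omega>" using value_nonneg[OF q] by (simp add: price_at_eq)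
      then show ?case using elim by (simp add: G2)
    qed
    then show ?thesis by (simp add: V2_def)
  qed
  define \<tau>' where "\<tau>' = purchase_rule M F X U \<gamma> l \<Psi> R p"
  define \<nu>' where "\<nu>' = sale_rule X c \<gamma> l \<Psi> R p \<tau>'"
  note seq = sequential_eq[OF p, folded \<open>U = utility \<alpha> k\<close>, folded \<tau>'_def, folded \<nu>'_def]
  \<comment> \<open>The functions \<open>V1\<close>, \<open>G2\<close> and \<open>V2\<close> are the
    same for both processes on the prices that occur, so the stopping sets coincide along every path
    on which the processes agree.\<close>
  have \<tau>': "AE \<omega> in M. \<tau>' \<omega> = \<tau> \<omega>"
    using PX[OF p]
  proof eventually_elim
    case (elim \<omega>)
    have "0 \<le> t \<and> V2 M F P U \<gamma> l \<Psi> R (P p t \<omega>) = G2 M F P U \<gamma> l \<Psi> R (P p t \<omega>) \<longleftrightarrow>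
        0 \<le> t \<and> V2 M F X U \<gamma> l \<Psi> R (X p t \<omega>) = G2 M F X U \<gamma> l \<Psi> R (X p t \<omega>)" for t
      using elim price_pos[OF p, of t \<omega>] by (auto simp: V2 G2)
    then show ?case by (simp add: \<tau>'_def defs(2) purchase_rule_def)
  qed
  have \<nu>': "AE \<omega> in M. \<nu>' \<omega> = \<nu> \<omega>"
    using PX[OF p] \<tau>'
  proof eventually_elim
    case (elim \<omega>)
    have "price_at P p \<tau> \<omega> = price_at X p \<tau>' \<omega>" using elim by (simp add: price_at_def)
    moreover have "0 \<le> t \<and> \<tau> \<omega> \<le> ennreal t \<and> z \<le> P p t \<omega> \<longleftrightarrow> 0 \<le> t \<and> \<tau>' \<omega> \<le> ennreal t \<and> z \<le> X p t \<omega>" for t z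
      using elim by auto
    ultimately show ?case by (simp add: \<nu>'_def defs(3) sale_rule_def)
  qed
  have st: "stopping_time F \<tau>" "stopping_time F \<nu>"
    using stopping_time_AE_cong[OF uc] seq(2,3) \<tau>' \<nu>' by blast+
  have adm: "(\<tau>, \<nu>) \<in> admissible_pairs M F"
    using st by (auto simp: admissible_pairs_def defs(3) sale_rule_def intro!: Inf_greatest)
  have seqP: "sequential_value M F P U \<gamma> l \<Psi> R p = V2 M F P U \<gamma> l \<Psi> R p"
    using seq(1) by (simp add: sequential_value_def J V2[OF p])
  have J\<tau>: "J M X U \<gamma> l \<Psi> R p \<tau> \<nu> = J M X U \<gamma> l \<Psi> R p \<tau>' \<nu>'"
    unfolding J_def
    by (rule ext_expectation_cong_AE) (use \<tau>' \<nu>' in \<open>eventually_elim; simp add: price_at_def\<close>)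
  have "(\<lambda>_. \<infinity>, \<lambda>_. \<infinity>) \<in> admissible_pairs M F"
    by (simp add: admissible_pairs_def stopping_time_const)
  then show ?thesis
    using seqP adm seq(4,5) V1[of p] p by (simp add: optimal_pair_def J\<tau> J V2[OF p])
qed

end
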